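(* Let $(A,\Delta)$ be an algebraic quantum group and $(X,\alpha)$ a right $A$-Galois object. The algebra $X$ is of compact type if and only if $A$ is an algebraic quantum group of compact type. The algebra $X$ is of discrete type if and only if $A$ is an algebraic quantum group of discrete type.
   Context: Conventions: $k$ is a field; all algebras are $k$-algebras, non-zero, possibly without unit, and non-degenerate ($ab=0$ for all $b$ implies $a=0$, and $ab=0$ for all $a$ implies $b=0$). $M(X)$ is the multiplier algebra of $X$, with $X\subseteq M(X)$ and $k=k\cdot 1\subseteq M(X)$; $\otimes$ is over $k$; $\iota$ is the identity map. A regular multiplier Hopf algebra is a pair $(A,\Delta)$ with $A$ an algebra and $\Delta:A\to M(A\otimes A)$ a coassociative homomorphism which is non-degenerate ($\Delta(A)(A\otimes A)=A\otimes A=(A\otimes A)\Delta(A)$) and such that the maps sending $a\otimes b$ to $\Delta(a)(1\otimes b)$, $(a\otimes 1)\Delta(b)$, $\Delta(a)(b\otimes 1)$, $(1\otimes a)\Delta(b)$ are all bijections of $A\otimes A$ onto $A\otimes A$; it has a unique counit $\varepsilon$ and antipode $S$. An algebraic quantum group is a regular multiplier Hopf algebra with a non-zero functional $\varphi$ such that $(\iota\otimes\varphi)(\Delta(a)(b\otimes 1))=\varphi(a)b$. It is of compact type if $A$ has a unit, and of discrete type if there is a non-zero left cointegral $h\in A$, i.e. $ah=\varepsilon(a)h$ for all $a\in A$ (equivalently, the dual $\hat A=\{\varphi(\,\cdot\,a)\mid a\in A\}$ has a unit, i.e. $\varepsilon\in\hat A$). A right coaction of $A$ on an algebra $X$ is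 an injective homomorphism $\alpha:X\to M(X\otimes A)$ with $\alpha(X)(1\otimes A)\subseteq X\otimes A$, $(1\otimes A)\alpha(X)\subseteq X\otimes A$ and $(\alpha\otimes\iota)\alpha=(\iota\otimes\Delta)\alpha$; it extends canonically to $M(X)\to M(X\otimes A)$. It is reduced if also $(X\otimes 1)\alpha(X)\subseteq X\otimes A$ (then also $\alpha(X)(X\otimes 1)\subseteq X\otimes A$). $(X,\alpha)$ is a right $A$-Galois object if $\alpha$ is a reduced right coaction, the only $f\in M(X)$ with $\alpha(f)=f\otimes 1$ are the scalars, and $V:X\otimes X\to X\otimes A$, $x\otimes y\mapsto (x\otimes 1)\alpha(y)$, is bijective. A non-degenerate algebra $X$ is called of compact type if $X$ has a unit, and of discrete type if every subspace of the form $xX$ or $Xx$ with $x\in X$ is finite dimensional. *)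

theory Defs
  imports Complex_Main
begin

section \<open>Non-degenerate algebras\<close>

text \<open>
  An algebra over the field \<open>'k\<close> is a type \<open>'a\<close> of class \<^class>\<open>ring\<close> (associative, possibly without
  unit) together with a compatible scalar multiplication.
\<close>

locale algebra = vector_space scale
  for scale :: "'k::field \<Rightarrow> 'a::ring \<Rightarrow> 'a" +
  assumes mult_scale_left: "scale c a * b = scale c (a * b)"
    and mult_scale_right: "a * scale c b = scale c (a * b)"

locale nondeg_algebra = algebra scale
  for scale :: "'k::field \<Rightarrow> 'a::ring \<Rightarrow> 'a" +
  assumes nonzero: "\<exists>a::'a. a \<noteq> 0"
    and nondeg_left: "(\<And>b::'a. a * b = 0) \<Longrightarrow> a = 0"
    and nondeg_right: "(\<And>a::'a. a * b = 0) \<Longrightarrow> b = 0"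


section \<open>Multipliers\<close>

text \<open>
  A multiplier \<open>m\<close> of \<open>X\<close> is a pair of a left multiplier \<open>x \<mapsto> m x\<close> and a right multiplier
  \<open>x \<mapsto> x m\<close> with \<open>(x m) y = x (m y)\<close>.  For non-degenerate algebras both maps are automatically
  linear over the base field (lemma \<open>multiplier_linear\<close> below), so the type need not mention the
  scalars.
\<close>

typedef (overloaded) 'a multiplier =
  "{(l :: 'a::ring \<Rightarrow> 'a, r :: 'a \<Rightarrow> 'a).
      (\<forall>x y. l (x + y) = l x + l y) \<and> (\<forall>x y. r (x + y) = r x + r y) \<and>
      (\<forall>x y. l (x * y) = l x * y) \<and> (\<forall>x y. r (x * y) = x * r y) \<and>
      (\<forall>x y. r x * y = x * l y)}"
  by (rule exI[of _ "(\<lambda>x. x, \<lambda>x. x)"]) simp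

setup_lifting type_definition_multiplier

text \<open>\<open>lmul m x\<close> is \<open>m x\<close> and \<open>rmul m x\<close> is \<open>x m\<close>.\<close>

lift_definition lmul :: "'a::ring multiplier \<Rightarrow> 'a \<Rightarrow> 'a" is fst .
lift_definition rmul :: "'a::ring multiplier \<Rightarrow> 'a \<Rightarrow> 'a" is snd .

lemma multiplier_eqI:
  assumes "\<And>x. lmul m x = lmul n x" "\<And>x. rmul m x = rmul n x"
  shows "m = n"
proof -
  have "fst (Rep_multiplier m) = fst (Rep_multiplier n)"
    "snd (Rep_multiplier m) = snd (Rep_multiplier n)"
    using assms by (auto simp: lmul.rep_eq rmul.rep_eq fun_eq_iff)
  then show ?thesis by (metis Rep_multiplier_inject prod_eqI)
qed

lemma lmul_add: "lmul m (x + y) = lmul m x + lmul m y" by transfer auto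
lemma rmul_add: "rmul m (x + y) = rmul m x + rmul m y" by transfer auto
lemma lmul_mult: "lmul m (x * y) = lmul m x * y" by transfer auto
lemma rmul_mult: "rmul m (x * y) = x * rmul m y" by transfer auto
lemma rmul_lmul: "rmul m x * y = x * lmul m y" by transfer auto

lemma make_multiplier:
  assumes "\<And>x y. l (x + y) = l x + l y" "\<And>x y. r (x + y) = r x + r y"
    and "\<And>x y. l (x * y) = l x * y" "\<And>x y. r (x * y) = x * r y" "\<And>x y. r x * y = x * l y"
  shows "lmul (Abs_multiplier (l, r)) = l" "rmul (Abs_multiplier (l, r)) = r"
  using assms by (simp_all add: lmul.rep_eq rmul.rep_eq Abs_multiplier_inverse)

instantiation multiplier :: (ring) "{ring, monoid_mult}"
begin

lift_definition zero_multiplier :: "'a multiplier" is "(\<lambda>x. 0, \<lambda>x. 0)" by simp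
lift_definition one_multiplier :: "'a multiplier" is "(\<lambda>x. x, \<lambda>x. x)" by simp
lift_definition plus_multiplier :: "'a multiplier \<Rightarrow> 'a multiplier \<Rightarrow> 'a multiplier"
  is "\<lambda>(l, r) (l', r'). (\<lambda>x. l x + l' x, \<lambda>x. r x + r' x)"
  by (auto simp: algebra_simps)
lift_definition uminus_multiplier :: "'a multiplier \<Rightarrow> 'a multiplier"
  is "\<lambda>(l, r). (\<lambda>x. - l x, \<lambda>x. - r x)"
  by auto
lift_definition minus_multiplier :: "'a multiplier \<Rightarrow> 'a multiplier \<Rightarrow> 'a multiplier"
  is "\<lambda>(l, r) (l', r'). (\<lambda>x. l x - l' x, \<lambda>x. r x - r' x)"
  by (auto simp: algebra_simps)
lift_definition times_multiplier :: "'a multiplier \<Rightarrow> 'a multiplier \<Rightarrow> 'a multiplier"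
  is "\<lambda>(l, r) (l', r'). (\<lambda>x. l (l' x), \<lambda>x. r' (r x))"
  by auto

instance
  by standard (transfer; auto simp: algebra_simps fun_eq_iff)+

end

lemma lmul_simps [simp]:
  "lmul 0 x = 0" "lmul 1 x = x" "lmul (m + n) x = lmul m x + lmul n x"
  "lmul (m * n) x = lmul m (lmul n x)"
  by (transfer; auto)+

lemma rmul_simps [simp]:
  "rmul 0 x = 0" "rmul 1 x = x" "rmul (m + n) x = rmul m x + rmul n x"
  "rmul (m * n) x = rmul n (rmul m x)"
  by (transfer; auto)+

text \<open>The inclusion \<open>X \<subseteq> M(X)\<close>.\<close>

lift_definition of_alg :: "'a::ring \<Rightarrow> 'a multiplier" is "\<lambda>a. (\<lambda>x. a * x, \<lambda>x. x * a)"
  by (auto simp: algebra_simps)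

lemma lmul_of_alg [simp]: "lmul (of_alg a) x = a * x" by transfer simp
lemma rmul_of_alg [simp]: "rmul (of_alg a) x = x * a" by transfer simp

definition mult_scale :: "('k \<Rightarrow> 'a \<Rightarrow> 'a) \<Rightarrow> 'k \<Rightarrow> 'a::ring multiplier \<Rightarrow> 'a multiplier" where
  "mult_scale s c m = Abs_multiplier (\<lambda>x. s c (lmul m x), \<lambda>x. s c (rmul m x))"

context algebra
begin

lemma lmul_mult_scale [simp]: "lmul (mult_scale scale c m) x = scale c (lmul m x)"
  and rmul_mult_scale [simp]: "rmul (mult_scale scale c m) x = scale c (rmul m x)"
  unfolding mult_scale_def
  by (subst make_multiplier;
      simp add: lmul_add rmul_add scale_right_distrib lmul_mult rmul_mult rmul_lmul
        mult_scale_left mult_scale_right)+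

lemma vector_space_multiplier: "vector_space (mult_scale scale)"
  by standard (auto intro!: multiplier_eqI simp: scale_left_distrib scale_right_distrib)

end

context nondeg_algebra
begin

lemma cancel_left: "(\<And>y::'a. y * a = y * b) \<Longrightarrow> a = b"
  using nondeg_right[of "a - b"] by (simp add: algebra_simps)

lemma cancel_right: "(\<And>y::'a. a * y = b * y) \<Longrightarrow> a = b"
  using nondeg_left[of "a - b"] by (simp add: algebra_simps)

lemma multiplier_linear: "Vector_Spaces.linear scale scale (lmul m)"
  "Vector_Spaces.linear scale scale (rmul m)"
proof -
  have "lmul m (scale c x) = scale c (lmul m x)" for c x
    by (rule cancel_left) (simp add: rmul_lmul[symmetric] mult_scale_right)
  moreover have "rmul m (scale c x) = scale c (rmul m x)" for c x
    by (rule cancel_right) (simp add: rmul_lmul mult_scale_left)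
  ultimately show "Vector_Spaces.linear scale scale (lmul m)"
    "Vector_Spaces.linear scale scale (rmul m)"
    by (simp_all add: Vector_Spaces.linear_iff lmul_add rmul_add vector_space_axioms)
qed

lemma of_alg_eq_iff: "of_alg (a::'a) = of_alg b \<longleftrightarrow> a = b"
proof
  assume "of_alg a = of_alg b"
  then have "a * y = b * y" for y
    using lmul_of_alg[of a y] lmul_of_alg[of b y] by simp
  then show "a = b" by (rule cancel_right)
qed simp

end


section \<open>Tensor products\<close>

definition bilin ::
  "('k::field \<Rightarrow> 'v::ab_group_add \<Rightarrow> 'v) \<Rightarrow> ('k \<Rightarrow> 'w::ab_group_add \<Rightarrow> 'w) \<Rightarrow>
   ('k \<Rightarrow> 'u::ab_group_add \<Rightarrow> 'u) \<Rightarrow> ('v \<Rightarrow> 'w \<Rightarrow> 'u) \<Rightarrow> bool" where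
  "bilin sV sW sU B \<longleftrightarrow>
     (\<forall>w. Vector_Spaces.linear sV sU (\<lambda>v. B v w)) \<and> (\<forall>v. Vector_Spaces.linear sW sU (B v))"

text \<open>
  The scalar multiplication is not determined by the type, so a tensor product of two vector spaces
  cannot be a type constructor; instead \<open>(T, tens)\<close> is any realisation of \<open>V \<otimes> W\<close>, described by
  its universal property.  The property is stated for bilinear forms; since we work over a field, it
  then holds for bilinear maps into an arbitrary vector space (lemma \<open>universal\<close> below).
\<close>

locale tensor_product = V: vector_space sV + W: vector_space sW + T: vector_space sT
  for sV :: "'k::field \<Rightarrow> 'v::ab_group_add \<Rightarrow> 'v"
    and sW :: "'k \<Rightarrow> 'w::ab_group_add \<Rightarrow> 'w"
    and sT :: "'k \<Rightarrow> 't::ab_group_add \<Rightarrow> 't" +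
  fixes tens :: "'v \<Rightarrow> 'w \<Rightarrow> 't"
  assumes tens_bilin: "bilin sV sW sT tens"
    and universal_form: "bilin sV sW (*) B \<Longrightarrow>
      \<exists>!f. Vector_Spaces.linear sT (*) f \<and> (\<forall>v w. f (tens v w) = B v w)"

text \<open>The linear map on \<open>V \<otimes> W\<close> induced by a bilinear map on \<open>V \<times> W\<close>.\<close>

definition tensor_lift ::
  "('k::field \<Rightarrow> 't::ab_group_add \<Rightarrow> 't) \<Rightarrow> ('k \<Rightarrow> 'u::ab_group_add \<Rightarrow> 'u) \<Rightarrow>
   ('v \<Rightarrow> 'w \<Rightarrow> 't) \<Rightarrow> ('v \<Rightarrow> 'w \<Rightarrow> 'u) \<Rightarrow> 't \<Rightarrow> 'u" where
  "tensor_lift sT sU tens B =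
     (THE f. Vector_Spaces.linear sT sU f \<and> (\<forall>v w. f (tens v w) = B v w))"

lemma vector_space_self: "vector_space ((*) :: 'k::field \<Rightarrow> 'k \<Rightarrow> 'k)"
  by standard (auto simp: algebra_simps)

lemma (in vector_space) separating_functional:
  assumes "x \<noteq> 0"
  shows "\<exists>f. Vector_Spaces.linear scale (*) f \<and> f x = 1"
proof -
  interpret P: vector_space_pair scale "(*)"
    using vector_space_axioms vector_space_self by (rule vector_space_pair.intro)
  have ind: "independent {x}" using assms by simp
  show ?thesis
    using P.linear_construct[OF ind, of "\<lambda>_. 1"] P.construct_basis[OF ind, of x "\<lambda>_. 1"] by blast
qed

lemma linear_comp:
  assumes "Vector_Spaces.linear s1 s2 f" "Vector_Spaces.linear s2 s3 g"
  shows "Vector_Spaces.linear s1 s3 (\<lambda>x. g (f x))"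
  using assms by (simp add: Vector_Spaces.linear_iff)

context tensor_product
begin

lemma span_tens: "T.span {tens v w | v w. True} = UNIV"
proof (rule ccontr)
  let ?P = "{tens v w | v w. True}"
  assume "T.span ?P \<noteq> UNIV"
  then obtain x where x: "x \<notin> T.span ?P" by auto
  obtain C where C: "C \<subseteq> ?P" "T.independent C" "?P \<subseteq> T.span C"
    using T.maximal_independent_subset[of ?P] by blast
  have xC: "x \<notin> T.span C" using x T.span_mono[OF C(1)] by auto
  then have ind: "T.independent (insert x C)" by (rule T.independent_insertI) (rule C)
  interpret P: vector_space_pair sT "(*)"
    using T.vector_space_axioms vector_space_self by (rule vector_space_pair.intro)
  define g where "g = P.construct (insert x C) (\<lambda>b. if b = x then 1 else 0)"
  have lin: "Vector_Spaces.linear sT (*) g"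
    unfolding g_def by (rule P.linear_construct[OF ind])
  have gx: "g x = 1" and gC: "b \<in> C \<Longrightarrow> g b = 0" for b
    using P.construct_basis[OF ind, of x] P.construct_basis[OF ind, of b] xC T.span_base[of x C]
    by (auto simp: g_def)
  have lin0: "Vector_Spaces.linear sT (*) (\<lambda>_. 0)"
    by (simp add: Vector_Spaces.linear_iff T.vector_space_axioms vector_space_self)
  have g0: "g (tens v w) = 0" for v w
    using P.linear_eq_on[OF lin lin0, of "tens v w" C] gC C(3) by auto
  have "bilin sV sW (*) (\<lambda>_ _. 0)"
    by (simp add: bilin_def Vector_Spaces.linear_iff V.vector_space_axioms W.vector_space_axioms
        vector_space_self)
  from universal_form[OF this] lin lin0 g0 have "g = (\<lambda>_. 0)" by blast
  with gx show False by simp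
qed

lemma linear_eqI:
  assumes "Vector_Spaces.linear sT sU f" "Vector_Spaces.linear sT sU g"
    and "\<And>v w. f (tens v w) = g (tens v w)"
  shows "f = g"
proof
  fix z
  interpret U: Vector_Spaces.linear sT sU f by fact
  interpret P: vector_space_pair sT sU by unfold_locales
  show "f z = g z"
    using P.linear_eq_on[OF assms(1,2), of z "{tens v w | v w. True}"] assms(3) span_tens by auto
qed

lemma universal:
  assumes B: "bilin sV sW sU B"
  shows "\<exists>!f. Vector_Spaces.linear sT sU f \<and> (\<forall>v w. f (tens v w) = B v w)"
proof (rule ex_ex1I)
  interpret U: vector_space sU
    using B by (simp add: bilin_def Vector_Spaces.linear_iff)
  interpret P: vector_space_pair sT sU by unfold_locales
  interpret Q: vector_space_pair sT "(*)"
    using T.vector_space_axioms vector_space_self by (rule vector_space_pair.intro)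
  let ?P = "{tens v w | v w. True}"
  obtain C where C: "C \<subseteq> ?P" "T.independent C" "?P \<subseteq> T.span C"
    using T.maximal_independent_subset[of ?P] by blast
  have "\<forall>b\<in>C. \<exists>p. b = tens (fst p) (snd p)" using C(1) by force
  then obtain p where p: "\<And>b. b \<in> C \<Longrightarrow> b = tens (fst (p b)) (snd (p b))"
    by metis
  define f where "f = P.construct C (\<lambda>b. B (fst (p b)) (snd (p b)))"
  have lin: "Vector_Spaces.linear sT sU f"
    unfolding f_def by (rule P.linear_construct[OF C(2)])
  have fC: "f b = B (fst (p b)) (snd (p b))" if "b \<in> C" for b
    using P.construct_basis[OF C(2) that] by (simp add: f_def)
  have "f (tens v w) = B v w" for v w
  proof (rule ccontr)
    assume "f (tens v w) \<noteq> B v w"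
    then obtain g where g: "Vector_Spaces.linear sU (*) g" "g (f (tens v w) - B v w) = 1"
      using U.separating_functional[of "f (tens v w) - B v w"] by auto
    have "bilin sV sW (*) (\<lambda>v w. g (B v w))"
      using B g(1) by (auto simp: bilin_def intro: linear_comp)
    then obtain h where h: "Vector_Spaces.linear sT (*) h" "\<And>v w. h (tens v w) = g (B v w)"
      using universal_form by blast
    have "h (tens v w) = g (f (tens v w))"
    proof (rule Q.linear_eq_on[OF h(1) linear_comp[OF lin g(1)], of _ C])
      show "tens v w \<in> T.span C" using C(3) by auto
      show "h b = g (f b)" if "b \<in> C" for b
        using that fC[OF that] h(2) p[OF that] by metis
    qed
    then have "g (f (tens v w) - B v w) = 0"
      using h(2)[of v w] module_hom.diff[OF Vector_Spaces.linear.axioms(3)[OF g(1)]] by simp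
    with g(2) show False by simp
  qed
  with lin show "\<exists>f. Vector_Spaces.linear sT sU f \<and> (\<forall>v w. f (tens v w) = B v w)" by blast
next
  fix f g
  assume "Vector_Spaces.linear sT sU f \<and> (\<forall>v w. f (tens v w) = B v w)"
    "Vector_Spaces.linear sT sU g \<and> (\<forall>v w. g (tens v w) = B v w)"
  then show "f = g" by (intro linear_eqI[of sU f g]) auto
qed

lemma tensor_lift:
  assumes "bilin sV sW sU B"
  shows "Vector_Spaces.linear sT sU (tensor_lift sT sU tens B)"
    and "tensor_lift sT sU tens B (tens v w) = B v w"
  using theI'[OF universal[OF assms]] by (auto simp: tensor_lift_def)

lemma tens_simps:
  "tens (v + v') w = tens v w + tens v' w" "tens v (w + w') = tens v w + tens v w'"
  "tens (sV c v) w = sT c (tens v w)" "tens v (sW c w) = sT c (tens v w)"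
  using tens_bilin by (auto simp: bilin_def Vector_Spaces.linear_iff)

lemma span_tens_basis:
  assumes E: "V.span E = UNIV" and F: "W.span F = UNIV"
  shows "T.span {tens e f | e f. e \<in> E \<and> f \<in> F} = UNIV"
proof -
  let ?S = "T.span {tens e f | e f. e \<in> E \<and> f \<in> F}"
  have zero: "tens 0 w = 0" "tens v 0 = 0" for v w
    using tens_simps(1)[of 0 0 w] tens_simps(2)[of v 0 0] by auto
  have 1: "tens e w \<in> ?S" if "e \<in> E" for e w
  proof -
    have "w \<in> W.span F" using F by auto
    then show ?thesis
    proof (induction w rule: W.span_induct_alt)
      case base
      show ?case by (simp add: zero T.span_zero)
    next
      case (step c x y)
      then show ?case
        using that unfolding tens_simps
        by (intro T.span_add[OF T.span_scale[OF T.span_base]]) auto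
    qed
  qed
  have 2: "tens v w \<in> ?S" for v w
  proof -
    have "v \<in> V.span E" using E by auto
    then show ?thesis
      by (induction v rule: V.span_induct_alt)
        (auto simp: zero tens_simps intro!: T.span_zero T.span_add T.span_scale 1)
  qed
  have "T.span {tens v w | v w. True} \<subseteq> ?S"
    by (rule T.span_minimal) (auto intro: 2)
  with span_tens show ?thesis by auto
qed

lemma separating_forms:
  assumes "\<And>\<theta> \<omega> F. Vector_Spaces.linear sV (*) \<theta> \<Longrightarrow> Vector_Spaces.linear sW (*) \<omega> \<Longrightarrow>
      Vector_Spaces.linear sT (*) F \<Longrightarrow> (\<And>v w. F (tens v w) = \<theta> v * \<omega> w) \<Longrightarrow> F z = 0"
  shows "z = 0"
proof -
  obtain E where E: "V.independent E" "UNIV \<subseteq> V.span E"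
    using V.maximal_independent_subset[of UNIV] by blast
  obtain F where F: "W.independent F" "UNIV \<subseteq> W.span F"
    using W.maximal_independent_subset[of UNIV] by blast
  let ?P = "{tens e f | e f. e \<in> E \<and> f \<in> F}"
  have "z \<in> T.span ?P" using span_tens_basis[of E F] E F by auto
  then obtain K c where K: "finite K" "K \<subseteq> ?P" "z = (\<Sum>t\<in>K. sT (c t) t)"
    by (auto simp: T.span_explicit)
  have "\<forall>t\<in>K. \<exists>e f. e \<in> E \<and> f \<in> F \<and> t = tens e f" using K(2) by blast
  then obtain e f where ef: "\<And>t. t \<in> K \<Longrightarrow> e t \<in> E \<and> f t \<in> F \<and> t = tens (e t) (f t)"
    by metis
  have "c t = 0" if t: "t \<in> K" for t
  proof -
    define \<theta> where "\<theta> = (\<lambda>v. V.representation E v (e t))"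
    define \<omega> where "\<omega> = (\<lambda>w. W.representation F w (f t))"
    have spE: "v \<in> V.span E" and spF: "w \<in> W.span F" for v w using E(2) F(2) by auto
    have \<theta>: "Vector_Spaces.linear sV (*) \<theta>"
      by (simp add: Vector_Spaces.linear_iff \<theta>_def V.representation_add[OF E(1) spE spE]
          V.representation_scale[OF E(1) spE] V.vector_space_axioms vector_space_self)
    have \<omega>: "Vector_Spaces.linear sW (*) \<omega>"
      by (simp add: Vector_Spaces.linear_iff \<omega>_def W.representation_add[OF F(1) spF spF]
          W.representation_scale[OF F(1) spF] W.vector_space_axioms vector_space_self)
    have bil: "bilin sV sW (*) (\<lambda>v w. \<theta> v * \<omega> w)"
      using \<theta> \<omega> by (auto simp: bilin_def Vector_Spaces.linear_iff algebra_simps)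
    then obtain G where G: "Vector_Spaces.linear sT (*) G" "\<And>v w. G (tens v w) = \<theta> v * \<omega> w"
      using universal_form by blast
    interpret G: Vector_Spaces.linear sT "(*)" G by (rule G(1))
    have "G s = (if s = t then 1 else 0)" if s: "s \<in> K" for s
    proof -
      have "G s = \<theta> (e s) * \<omega> (f s)" using ef[OF s] G(2) by metis
      also have "\<dots> = (if e s = e t \<and> f s = f t then 1 else 0)"
        using ef[OF s] ef[OF t] E(1) F(1)
        by (auto simp: \<theta>_def \<omega>_def V.representation_basis W.representation_basis)
      also have "e s = e t \<and> f s = f t \<longleftrightarrow> s = t" using ef[OF s] ef[OF t] by metis
      finally show ?thesis .
    qed
    then have "G z = (\<Sum>s\<in>K. c s * (if s = t then 1 else 0))"
      by (simp add: K(3) G.sum G.scale)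
    also have "\<dots> = (\<Sum>s\<in>K. if s = t then c s else 0)" by (rule sum.cong) auto
    also have "\<dots> = c t" using K(1) t by simp
    finally show ?thesis using assms[OF \<theta> \<omega> G(1) G(2)] by simp
  qed
  then show ?thesis by (simp add: K(3))
qed

end

text \<open>
  The tensor product of algebras, where the multiplication of the ring \<open>'t\<close> is
  \<open>(a \<otimes> b)(c \<otimes> d) = ac \<otimes> bd\<close>.
\<close>

locale tensor_algebra =
  A: nondeg_algebra sA + B: nondeg_algebra sB + tensor_product sA sB sT tens
  for sA :: "'k::field \<Rightarrow> 'a::ring \<Rightarrow> 'a"
    and sB :: "'k \<Rightarrow> 'b::ring \<Rightarrow> 'b"
    and sT :: "'k \<Rightarrow> 't::ring \<Rightarrow> 't"
    and tens :: "'a \<Rightarrow> 'b \<Rightarrow> 't" +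
  assumes tens_mult: "tens a b * tens c d = tens (a * c) (b * d)"

text \<open>
  \<open>m \<otimes> n \<in> M(A \<otimes> B)\<close> for \<open>m \<in> M(A)\<close> and \<open>n \<in> M(B)\<close>; it is the unique multiplier with the stated
  property by lemma \<open>mult_tensor\<close> below.
\<close>

definition mult_tensor ::
  "('a \<Rightarrow> 'b \<Rightarrow> 't) \<Rightarrow> 'a::ring multiplier \<Rightarrow> 'b::ring multiplier \<Rightarrow> 't::ring multiplier" where
  "mult_tensor tens m n =
     (THE u. \<forall>a b. lmul u (tens a b) = tens (lmul m a) (lmul n b) \<and>
                   rmul u (tens a b) = tens (rmul m a) (rmul n b))"

context tensor_algebra
begin

lemma tensor_induct [case_names add tens]:
  assumes "\<And>x y. P x \<Longrightarrow> P y \<Longrightarrow> P (x + y)" "\<And>a b. P (tens a b)"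
  shows "P z"
proof -
  have "z \<in> T.span {tens v w | v w. True}" using span_tens by auto
  then show ?thesis
  proof (induction z rule: T.span_induct_alt)
    case base
    have "tens 0 0 = 0" using tens_simps(1)[of 0 0 0] by simp
    then show ?case using assms(2)[of 0 0] by simp
  next
    case (step c x y)
    then obtain v w where "x = tens v w" by auto
    then have "sT c x = tens (sA c v) w" by (simp add: tens_simps)
    with step assms show ?case by metis
  qed
qed

lemma algebra_T: "algebra sT"
proof
  fix c and x y :: 't
  show "sT c x * y = sT c (x * y)"
  proof (induction x rule: tensor_induct)
    case (tens a b)
    show ?case
      by (induction y rule: tensor_induct)
        (simp_all add: algebra_simps T.scale_right_distrib tens_mult A.mult_scale_left
          flip: tens_simps(3))
  qed (simp add: algebra_simps T.scale_right_distrib)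
  show "x * sT c y = sT c (x * y)"
  proof (induction x rule: tensor_induct)
    case (tens a b)
    show ?case
      by (induction y rule: tensor_induct)
        (simp_all add: algebra_simps T.scale_right_distrib tens_mult A.mult_scale_right
          flip: tens_simps(3))
  qed (simp add: algebra_simps T.scale_right_distrib)
qed

sublocale T: algebra sT by (rule algebra_T)

lemma separating_slices:
  assumes "\<And>\<theta> f. Vector_Spaces.linear sA (*) \<theta> \<Longrightarrow> Vector_Spaces.linear sT sB f \<Longrightarrow>
      (\<And>a b. f (tens a b) = sB (\<theta> a) b) \<Longrightarrow> f z = 0"
  shows "z = 0"
proof (rule separating_forms)
  fix \<theta> \<omega> F
  assume \<theta>: "Vector_Spaces.linear sA (*) \<theta>" and \<omega>: "Vector_Spaces.linear sB (*) \<omega>"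
    and F: "Vector_Spaces.linear sT (*) F" "\<And>v w. F (tens v w) = \<theta> v * \<omega> w"
  have "bilin sA sB sB (\<lambda>a b. sB (\<theta> a) b)"
    using \<theta> by (auto simp: bilin_def Vector_Spaces.linear_iff B.scale_right_distrib
        B.scale_left_distrib B.vector_space_axioms mult.commute)
  then obtain f where f: "Vector_Spaces.linear sT sB f" "\<And>a b. f (tens a b) = sB (\<theta> a) b"
    using universal by blast
  have "F = (\<lambda>x. \<omega> (f x))"
    using linear_comp[OF f(1) \<omega>] F \<omega>
    by (intro linear_eqI[of "(*)"]) (auto simp: f(2) Vector_Spaces.linear_iff)
  moreover have "f z = 0" by (rule assms[OF \<theta> f])
  moreover have "\<omega> 0 = 0"
    by (rule module_hom.zero[OF Vector_Spaces.linear.axioms(3)[OF \<omega>]])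
  ultimately show "F z = 0" by simp
qed

lemma functionals_zero:
  assumes "\<And>\<omega>. Vector_Spaces.linear sB (*) \<omega> \<Longrightarrow> \<omega> b = 0"
  shows "b = 0"
proof (rule ccontr)
  assume "b \<noteq> 0"
  then obtain \<omega> where "Vector_Spaces.linear sB (*) \<omega>" "\<omega> b = 1"
    using B.separating_functional by blast
  with assms show False by force
qed

lemma nondeg_T_aux:
  fixes R :: "'b \<Rightarrow> 'b \<Rightarrow> 'b" and Q :: "'a \<Rightarrow> 'a \<Rightarrow> 'a" and P :: "'t \<Rightarrow> 't \<Rightarrow> 't"
  assumes R: "\<And>b. Vector_Spaces.linear sB sB (\<lambda>x. R x b)"
    and Q: "\<And>a. Vector_Spaces.linear sA sA (\<lambda>x. Q x a)"
    and P: "\<And>u. Vector_Spaces.linear sT sT (\<lambda>x. P x u)"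
    and PQR: "\<And>a b c d. P (tens a b) (tens c d) = tens (Q a c) (R b d)"
    and ndQ: "\<And>x. (\<And>a. Q x a = 0) \<Longrightarrow> x = 0" and ndR: "\<And>x. (\<And>b. R x b = 0) \<Longrightarrow> x = 0"
    and z: "\<And>u. P z u = 0"
  shows "z = 0"
proof (rule separating_slices)
  fix \<theta> K
  assume \<theta>: "Vector_Spaces.linear sA (*) \<theta>"
    and K: "Vector_Spaces.linear sT sB K" "\<And>a b. K (tens a b) = sB (\<theta> a) b"
  show "K z = 0"
  proof (rule ndR, rule functionals_zero)
    fix b \<omega>
    assume \<omega>: "Vector_Spaces.linear sB (*) \<omega>"
    have \<omega>R: "Vector_Spaces.linear sB (*) (\<lambda>x. \<omega> (R x b))" by (rule linear_comp[OF R \<omega>])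
    have bil: "bilin sA sB sA (\<lambda>x y. sA (\<omega>' y) x)" if "Vector_Spaces.linear sB (*) \<omega>'" for \<omega>'
      using that by (auto simp: bilin_def Vector_Spaces.linear_iff A.scale_right_distrib
          A.scale_left_distrib A.vector_space_axioms mult.commute)
    obtain G where G: "Vector_Spaces.linear sT sA G" "\<And>x y. G (tens x y) = sA (\<omega> (R y b)) x"
      using universal[OF bil[OF \<omega>R]] by blast
    obtain H where H: "Vector_Spaces.linear sT sA H" "\<And>x y. H (tens x y) = sA (\<omega> y) x"
      using universal[OF bil[OF \<omega>]] by blast
    have "Q (G z) a = 0" for a
    proof -
      have "(\<lambda>x. Q (G x) a) = (\<lambda>x. H (P x (tens a b)))"
        using Q[of a]
        by (intro linear_eqI[OF linear_comp[OF G(1) Q] linear_comp[OF P H(1)]])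
          (simp add: G(2) H(2) PQR Vector_Spaces.linear_iff)
      then have "Q (G z) a = H (P z (tens a b))" by meson
      also have "\<dots> = 0"
        using z module_hom.zero[OF Vector_Spaces.linear.axioms(3)[OF H(1)]] by simp
      finally show ?thesis .
    qed
    then have "G z = 0" by (rule ndQ)
    have "(\<lambda>x. \<theta> (G x)) = (\<lambda>x. \<omega> (R (K x) b))"
      using \<theta> \<omega>R
      by (intro linear_eqI[OF linear_comp[OF G(1) \<theta>] linear_comp[OF K(1) \<omega>R]])
        (simp add: G(2) K(2) Vector_Spaces.linear_iff mult.commute)
    then have "\<omega> (R (K z) b) = \<theta> (G z)" by (rule fun_cong[symmetric])
    also have "\<dots> = 0"
      using \<open>G z = 0\<close> module_hom.zero[OF Vector_Spaces.linear.axioms(3)[OF \<theta>]] by simp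
    finally show "\<omega> (R (K z) b) = 0" .
  qed
qed

lemma nondeg_algebra_T: "nondeg_algebra sT"
proof
  have lin: "Vector_Spaces.linear s s (\<lambda>x. x * u)" "Vector_Spaces.linear s s (\<lambda>x. u * x)"
    if "algebra s" for s :: "'k \<Rightarrow> 'u::ring \<Rightarrow> 'u" and u
  proof -
    interpret algebra s by fact
    show "Vector_Spaces.linear s s (\<lambda>x. x * u)" "Vector_Spaces.linear s s (\<lambda>x. u * x)"
      by (simp_all add: Vector_Spaces.linear_iff vector_space_axioms algebra_simps
          mult_scale_left mult_scale_right)
  qed
  show "z = 0" if "\<And>u. z * u = 0" for z :: 't
    by (rule nondeg_T_aux[of "(*)" "(*)" "(*)", OF lin(1)[OF B.algebra_axioms] lin(1)[OF A.algebra_axioms]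
          lin(1)[OF algebra_T] tens_mult A.nondeg_left B.nondeg_left that])
  show "z = 0" if "\<And>u. u * z = 0" for z :: 't
    by (rule nondeg_T_aux[of "\<lambda>x y. y * x" "\<lambda>x y. y * x" "\<lambda>x y. y * x", OF lin(2)[OF B.algebra_axioms] lin(2)[OF A.algebra_axioms]
          lin(2)[OF algebra_T] tens_mult A.nondeg_right B.nondeg_right that])
  show "\<exists>z::'t. z \<noteq> 0"
  proof -
    obtain a b where ab: "a \<noteq> (0::'a)" "b \<noteq> (0::'b)" using A.nonzero B.nonzero by blast
    obtain \<theta> where \<theta>: "Vector_Spaces.linear sA (*) \<theta>" "\<theta> a = 1"
      using A.separating_functional[OF ab(1)] by blast
    have "bilin sA sB sB (\<lambda>a b. sB (\<theta> a) b)"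
      using \<theta> by (auto simp: bilin_def Vector_Spaces.linear_iff B.scale_right_distrib
          B.scale_left_distrib B.vector_space_axioms mult.commute)
    then obtain f where f: "Vector_Spaces.linear sT sB f" "\<And>a b. f (tens a b) = sB (\<theta> a) b"
      using universal by blast
    have "f (tens a b) \<noteq> f 0"
      using f(2)[of a b] \<theta>(2) ab(2) module_hom.zero[OF Vector_Spaces.linear.axioms(3)[OF f(1)]]
      by simp
    then show ?thesis by metis
  qed
qed

sublocale T: nondeg_algebra sT by (rule nondeg_algebra_T)

lemma mult_tensor:
  shows lmul_mult_tensor [simp]: "lmul (mult_tensor tens m n) (tens a b) = tens (lmul m a) (lmul n b)"
    and rmul_mult_tensor [simp]: "rmul (mult_tensor tens m n) (tens a b) = tens (rmul m a) (rmul n b)"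
    and mult_tensor_unique:
      "(\<And>a b. lmul u (tens a b) = tens (lmul m a) (lmul n b)) \<Longrightarrow>
       (\<And>a b. rmul u (tens a b) = tens (rmul m a) (rmul n b)) \<Longrightarrow> u = mult_tensor tens m n"
proof -
  let ?C = "\<lambda>u. \<forall>a b. lmul u (tens a b) = tens (lmul m a) (lmul n b) \<and>
                     rmul u (tens a b) = tens (rmul m a) (rmul n b)"
  have bil: "bilin sA sB sT (\<lambda>a b. tens (f a) (g b))"
    if "Vector_Spaces.linear sA sA f" "Vector_Spaces.linear sB sB g" for f g
    using that by (auto simp: bilin_def Vector_Spaces.linear_iff tens_simps T.vector_space_axioms)
  obtain l where l: "Vector_Spaces.linear sT sT l" "\<And>a b. l (tens a b) = tens (lmul m a) (lmul n b)"
    using universal[OF bil[OF A.multiplier_linear(1) B.multiplier_linear(1)]] by blast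
  obtain r where r: "Vector_Spaces.linear sT sT r" "\<And>a b. r (tens a b) = tens (rmul m a) (rmul n b)"
    using universal[OF bil[OF A.multiplier_linear(2) B.multiplier_linear(2)]] by blast
  have l_add: "l (x + y) = l x + l y" and r_add: "r (x + y) = r x + r y" for x y
    using l(1) r(1) by (auto simp: Vector_Spaces.linear_iff)
  have 1: "l (x * y) = l x * y" for x y
  proof (induction x rule: tensor_induct)
    case (tens a b)
    show ?case
      by (induction y rule: tensor_induct) (simp_all add: algebra_simps l_add l(2) tens_mult lmul_mult)
  qed (simp add: algebra_simps l_add)
  have 2: "r (x * y) = x * r y" for x y
  proof (induction x rule: tensor_induct)
    case (tens a b)
    show ?case
      by (induction y rule: tensor_induct) (simp_all add: algebra_simps r_add r(2) tens_mult rmul_mult)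
  qed (simp add: algebra_simps r_add)
  have 3: "r x * y = x * l y" for x y
  proof (induction x rule: tensor_induct)
    case (tens a b)
    show ?case
      by (induction y rule: tensor_induct)
        (simp_all add: algebra_simps l_add l(2) r(2) tens_mult rmul_lmul)
  qed (simp add: algebra_simps r_add)
  have ex: "?C (Abs_multiplier (l, r))"
    using make_multiplier[of l r, OF l_add r_add 1 2 3] l(2) r(2) by simp
  have un: "u = v" if "?C u" "?C v" for u v
  proof (rule multiplier_eqI)
    show "lmul u x = lmul v x" for x
      by (induction x rule: tensor_induct) (use that in \<open>simp_all add: lmul_add\<close>)
    show "rmul u x = rmul v x" for x
      by (induction x rule: tensor_induct) (use that in \<open>simp_all add: rmul_add\<close>)
  qed
  have C: "?C (mult_tensor tens m n)"
    unfolding mult_tensor_def by (rule theI[of ?C, OF ex]) (rule un[OF _ ex])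
  then show "lmul (mult_tensor tens m n) (tens a b) = tens (lmul m a) (lmul n b)"
    "rmul (mult_tensor tens m n) (tens a b) = tens (rmul m a) (rmul n b)" by auto
  show "u = mult_tensor tens m n"
    if "\<And>a b. lmul u (tens a b) = tens (lmul m a) (lmul n b)"
      "\<And>a b. rmul u (tens a b) = tens (rmul m a) (rmul n b)"
    using un[OF _ C] that by blast
qed

end

text \<open>A threefold tensor product, with \<open>(X \<otimes> Y) \<otimes> Z\<close> and \<open>X \<otimes> (Y \<otimes> Z)\<close> identified.\<close>

locale tensor_algebra3 =
  XY: tensor_algebra sX sY sXY tXY + YZ: tensor_algebra sY sZ sYZ tYZ +
  XY_Z: tensor_algebra sXY sZ sT tXY_Z + X_YZ: tensor_algebra sX sYZ sT tX_YZ
  for sX :: "'k::field \<Rightarrow> 'x::ring \<Rightarrow> 'x"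
    and sY :: "'k \<Rightarrow> 'y::ring \<Rightarrow> 'y"
    and sZ :: "'k \<Rightarrow> 'z::ring \<Rightarrow> 'z"
    and sXY :: "'k \<Rightarrow> 'xy::ring \<Rightarrow> 'xy" and tXY :: "'x \<Rightarrow> 'y \<Rightarrow> 'xy"
    and sYZ :: "'k \<Rightarrow> 'yz::ring \<Rightarrow> 'yz" and tYZ :: "'y \<Rightarrow> 'z \<Rightarrow> 'yz"
    and sT :: "'k \<Rightarrow> 't::ring \<Rightarrow> 't"
    and tXY_Z :: "'xy \<Rightarrow> 'z \<Rightarrow> 't" and tX_YZ :: "'x \<Rightarrow> 'yz \<Rightarrow> 't" +
  assumes tens_assoc: "tXY_Z (tXY x y) z = tX_YZ x (tYZ y z)"

text \<open>
  \<open>f \<otimes> g : P \<otimes> R \<rightarrow> M(Q)\<close> for linear maps \<open>f, g\<close> from \<open>P, R\<close> into the multiplier algebras of the two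
  tensor factors of \<open>Q\<close>.
\<close>

definition hom_tensor ::
  "('k::field \<Rightarrow> 'pr::ab_group_add \<Rightarrow> 'pr) \<Rightarrow> ('p \<Rightarrow> 'r \<Rightarrow> 'pr) \<Rightarrow>
   ('k \<Rightarrow> 'q::ring \<Rightarrow> 'q) \<Rightarrow> ('q1::ring \<Rightarrow> 'q2::ring \<Rightarrow> 'q) \<Rightarrow>
   ('p \<Rightarrow> 'q1 multiplier) \<Rightarrow> ('r \<Rightarrow> 'q2 multiplier) \<Rightarrow> 'pr \<Rightarrow> 'q multiplier" where
  "hom_tensor sPR tPR sQ tQ f g =
     tensor_lift sPR (mult_scale sQ) tPR (\<lambda>x a. mult_tensor tQ (f x) (g a))"

definition hom_into_multipliers ::
  "('k::field \<Rightarrow> 'p::ring \<Rightarrow> 'p) \<Rightarrow> ('k \<Rightarrow> 'q::ring \<Rightarrow> 'q) \<Rightarrow> ('p \<Rightarrow> 'q multiplier) \<Rightarrow> bool" where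
  "hom_into_multipliers sP sQ F \<longleftrightarrow>
     Vector_Spaces.linear sP (mult_scale sQ) F \<and> (\<forall>x y. F (x * y) = F x * F y)"

text \<open>
  \<open>n = F(m)\<close> for the canonical extension \<open>M(P) \<rightarrow> M(Q)\<close> of a homomorphism \<open>F : P \<rightarrow> M(Q)\<close>, which is
  characterised by \<open>F(m) F(p) = F(m p)\<close> and \<open>F(p) F(m) = F(p m)\<close>.
\<close>

definition extends_to ::
  "('p::ring \<Rightarrow> 'q::ring multiplier) \<Rightarrow> 'p multiplier \<Rightarrow> 'q multiplier \<Rightarrow> bool" where
  "extends_to F m n \<longleftrightarrow> (\<forall>p. n * F p = F (lmul m p) \<and> F p * n = F (rmul m p))"

text \<open>
  \<open>(\<alpha> \<otimes> \<iota>)\<alpha> = (\<iota> \<otimes> \<Delta>)\<alpha>\<close> for \<open>\<alpha> : X \<rightarrow> M(X \<otimes> A)\<close> whose values become elements of \<open>X \<otimes> A\<close> after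
  multiplying with \<open>1 \<otimes> b\<close>, \<open>b \<in> A\<close>, on either side.  The two sides of the equation are multipliers
  of \<open>X \<otimes> A \<otimes> A\<close> whose common value at \<open>x\<close> is \<open>n\<close>: the left one is given by
  \<open>(\<alpha> \<otimes> \<iota>)(\<alpha>(x)) (1 \<otimes> 1 \<otimes> b) = (\<alpha> \<otimes> \<iota>)(\<alpha>(x)(1 \<otimes> b))\<close> together with its mirror image, the right one by
  extending \<open>\<iota> \<otimes> \<Delta>\<close>.  Taking \<open>\<alpha> = \<Delta>\<close> gives the coassociativity of \<open>\<Delta>\<close>.
\<close>

definition coassociative ::
  "('k::field \<Rightarrow> 'xa::ring \<Rightarrow> 'xa) \<Rightarrow> ('x::ring \<Rightarrow> 'a::ring \<Rightarrow> 'xa) \<Rightarrow>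
   ('k \<Rightarrow> 'xaa::ring \<Rightarrow> 'xaa) \<Rightarrow> ('xa \<Rightarrow> 'a \<Rightarrow> 'xaa) \<Rightarrow> ('x \<Rightarrow> 'aa::ring \<Rightarrow> 'xaa) \<Rightarrow>
   ('x \<Rightarrow> 'xa multiplier) \<Rightarrow> ('a \<Rightarrow> 'aa multiplier) \<Rightarrow> bool" where
  "coassociative sXA tXA sXAA tXA_A tX_AA \<alpha> \<Delta> \<longleftrightarrow>
     (let \<alpha>\<iota> = hom_tensor sXA tXA sXAA tXA_A \<alpha> of_alg;
          \<iota>\<Delta> = hom_tensor sXA tXA sXAA tX_AA of_alg \<Delta>
      in \<forall>x. \<exists>n.
           (\<forall>b z. of_alg z = \<alpha> x * mult_tensor tXA 1 (of_alg b) \<longrightarrow>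
              n * mult_tensor tXA_A 1 (of_alg b) = \<alpha>\<iota> z) \<and>
           (\<forall>b z. of_alg z = mult_tensor tXA 1 (of_alg b) * \<alpha> x \<longrightarrow>
              mult_tensor tXA_A 1 (of_alg b) * n = \<alpha>\<iota> z) \<and>
           extends_to \<iota>\<Delta> (\<alpha> x) n)"

text \<open>
  The linear map \<open>P \<otimes> R \<rightarrow> M(Q)\<close> induced by \<open>F\<close> is a bijection onto \<open>Q \<subseteq> M(Q)\<close>.
\<close>

definition induces_bijection ::
  "('k::field \<Rightarrow> 'pr::ab_group_add \<Rightarrow> 'pr) \<Rightarrow> ('p \<Rightarrow> 'r \<Rightarrow> 'pr) \<Rightarrow>
   ('k \<Rightarrow> 'q::ring \<Rightarrow> 'q) \<Rightarrow> ('p \<Rightarrow> 'r \<Rightarrow> 'q multiplier) \<Rightarrow> bool" where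
  "induces_bijection sPR tPR sQ F \<longleftrightarrow>
     bij_betw (tensor_lift sPR (mult_scale sQ) tPR F) UNIV (range of_alg)"


section \<open>Algebraic quantum groups\<close>

text \<open>Products such as \<open>\<Delta>(A)(A \<otimes> A)\<close> denote the linear span of the products of elements.\<close>

locale regular_multiplier_hopf_algebra =
  fixes sA :: "'k::field \<Rightarrow> 'a::ring \<Rightarrow> 'a"
    and sAA :: "'k \<Rightarrow> 'aa::ring \<Rightarrow> 'aa" and tAA :: "'a \<Rightarrow> 'a \<Rightarrow> 'aa"
    and sAAA :: "'k \<Rightarrow> 'aaa::ring \<Rightarrow> 'aaa"
    and tAA_A :: "'aa \<Rightarrow> 'a \<Rightarrow> 'aaa" and tA_AA :: "'a \<Rightarrow> 'aa \<Rightarrow> 'aaa"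
    and \<Delta> :: "'a \<Rightarrow> 'aa multiplier"
  assumes tensor_powers: "tensor_algebra3 sA sA sA sAA tAA sAA tAA sAAA tAA_A tA_AA"
    and comult_hom: "hom_into_multipliers sA sAA \<Delta>"
    and comult_nondeg_left: "module.span sAA {lmul (\<Delta> a) z | a z. True} = UNIV"
    and comult_nondeg_right: "module.span sAA {rmul (\<Delta> a) z | a z. True} = UNIV"
    and comult_coassoc: "coassociative sAA tAA sAAA tAA_A tA_AA \<Delta> \<Delta>"
    and bij_T1: "induces_bijection sAA tAA sAA (\<lambda>a b. \<Delta> a * mult_tensor tAA 1 (of_alg b))"
    and bij_T2: "induces_bijection sAA tAA sAA (\<lambda>a b. mult_tensor tAA (of_alg a) 1 * \<Delta> b)"
    and bij_T3: "induces_bijection sAA tAA sAA (\<lambda>a b. \<Delta> a * mult_tensor tAA (of_alg b) 1)"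
    and bij_T4: "induces_bijection sAA tAA sAA (\<lambda>a b. mult_tensor tAA 1 (of_alg a) * \<Delta> b)"

text \<open>
  The counit is the homomorphism \<open>\<epsilon> : A \<rightarrow> k\<close> with \<open>(\<epsilon> \<otimes> \<iota>)(\<Delta>(a)(1 \<otimes> b)) = ab\<close> and
  \<open>(\<iota> \<otimes> \<epsilon>)((a \<otimes> 1)\<Delta>(b)) = ab\<close>.
\<close>

definition is_counit ::
  "('k::field \<Rightarrow> 'a::ring \<Rightarrow> 'a) \<Rightarrow> ('k \<Rightarrow> 'aa::ring \<Rightarrow> 'aa) \<Rightarrow> ('a \<Rightarrow> 'a \<Rightarrow> 'aa) \<Rightarrow>
   ('a \<Rightarrow> 'aa multiplier) \<Rightarrow> ('a \<Rightarrow> 'k) \<Rightarrow> bool" where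
  "is_counit sA sAA tAA \<Delta> \<epsilon> \<longleftrightarrow>
     Vector_Spaces.linear sA (*) \<epsilon> \<and> (\<forall>a b. \<epsilon> (a * b) = \<epsilon> a * \<epsilon> b) \<and>
     (\<forall>a b z. of_alg z = \<Delta> a * mult_tensor tAA 1 (of_alg b) \<longrightarrow>
        tensor_lift sAA sA tAA (\<lambda>x y. sA (\<epsilon> x) y) z = a * b) \<and>
     (\<forall>a b z. of_alg z = mult_tensor tAA (of_alg a) 1 * \<Delta> b \<longrightarrow>
        tensor_lift sAA sA tAA (\<lambda>x y. sA (\<epsilon> y) x) z = a * b)"

text \<open>\<open>\<phi>\<close> is a non-zero functional with \<open>(\<iota> \<otimes> \<phi>)(\<Delta>(a)(b \<otimes> 1)) = \<phi>(a) b\<close>.\<close>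

definition is_left_integral ::
  "('k::field \<Rightarrow> 'a::ring \<Rightarrow> 'a) \<Rightarrow> ('k \<Rightarrow> 'aa::ring \<Rightarrow> 'aa) \<Rightarrow> ('a \<Rightarrow> 'a \<Rightarrow> 'aa) \<Rightarrow>
   ('a \<Rightarrow> 'aa multiplier) \<Rightarrow> ('a \<Rightarrow> 'k) \<Rightarrow> bool" where
  "is_left_integral sA sAA tAA \<Delta> \<phi> \<longleftrightarrow>
     Vector_Spaces.linear sA (*) \<phi> \<and> (\<exists>a. \<phi> a \<noteq> 0) \<and>
     (\<forall>a b z. of_alg z = \<Delta> a * mult_tensor tAA (of_alg b) 1 \<longrightarrow>
        tensor_lift sAA sA tAA (\<lambda>x y. sA (\<phi> y) x) z = sA (\<phi> a) b)"

locale algebraic_quantum_group =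
  regular_multiplier_hopf_algebra sA sAA tAA sAAA tAA_A tA_AA \<Delta>
  for sA :: "'k::field \<Rightarrow> 'a::ring \<Rightarrow> 'a"
    and sAA :: "'k \<Rightarrow> 'aa::ring \<Rightarrow> 'aa" and tAA :: "'a \<Rightarrow> 'a \<Rightarrow> 'aa"
    and sAAA :: "'k \<Rightarrow> 'aaa::ring \<Rightarrow> 'aaa"
    and tAA_A :: "'aa \<Rightarrow> 'a \<Rightarrow> 'aaa" and tA_AA :: "'a \<Rightarrow> 'aa \<Rightarrow> 'aaa"
    and \<Delta> :: "'a \<Rightarrow> 'aa multiplier" +
  assumes left_integral: "\<exists>\<phi>. is_left_integral sA sAA tAA \<Delta> \<phi>"

locale compact_type_quantum_group =
  algebraic_quantum_group sA sAA tAA sAAA tAA_A tA_AA \<Delta>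
  for sA :: "'k::field \<Rightarrow> 'a::ring \<Rightarrow> 'a"
    and sAA :: "'k \<Rightarrow> 'aa::ring \<Rightarrow> 'aa" and tAA :: "'a \<Rightarrow> 'a \<Rightarrow> 'aa"
    and sAAA :: "'k \<Rightarrow> 'aaa::ring \<Rightarrow> 'aaa"
    and tAA_A :: "'aa \<Rightarrow> 'a \<Rightarrow> 'aaa" and tA_AA :: "'a \<Rightarrow> 'aa \<Rightarrow> 'aaa"
    and \<Delta> :: "'a \<Rightarrow> 'aa multiplier" +
  assumes unit: "\<exists>u::'a. \<forall>a. u * a = a \<and> a * u = a"

locale discrete_type_quantum_group =
  algebraic_quantum_group sA sAA tAA sAAA tAA_A tA_AA \<Delta>
  for sA :: "'k::field \<Rightarrow> 'a::ring \<Rightarrow> 'a"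
    and sAA :: "'k \<Rightarrow> 'aa::ring \<Rightarrow> 'aa" and tAA :: "'a \<Rightarrow> 'a \<Rightarrow> 'aa"
    and sAAA :: "'k \<Rightarrow> 'aaa::ring \<Rightarrow> 'aaa"
    and tAA_A :: "'aa \<Rightarrow> 'a \<Rightarrow> 'aaa" and tA_AA :: "'a \<Rightarrow> 'aa \<Rightarrow> 'aaa"
    and \<Delta> :: "'a \<Rightarrow> 'aa multiplier" +
  assumes left_cointegral:
    "\<exists>\<epsilon> h. is_counit sA sAA tAA \<Delta> \<epsilon> \<and> h \<noteq> 0 \<and> (\<forall>a. a * h = sA (\<epsilon> a) h)"


section \<open>Galois objects\<close>

locale right_coaction =
  fixes sA :: "'k::field \<Rightarrow> 'a::ring \<Rightarrow> 'a"
    and sAA :: "'k \<Rightarrow> 'aa::ring \<Rightarrow> 'aa" and tAA :: "'a \<Rightarrow> 'a \<Rightarrow> 'aa"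
    and \<Delta> :: "'a \<Rightarrow> 'aa multiplier"
    and sX :: "'k \<Rightarrow> 'x::ring \<Rightarrow> 'x"
    and sXA :: "'k \<Rightarrow> 'xa::ring \<Rightarrow> 'xa" and tXA :: "'x \<Rightarrow> 'a \<Rightarrow> 'xa"
    and sXAA :: "'k \<Rightarrow> 'xaa::ring \<Rightarrow> 'xaa"
    and tXA_A :: "'xa \<Rightarrow> 'a \<Rightarrow> 'xaa" and tX_AA :: "'x \<Rightarrow> 'aa \<Rightarrow> 'xaa"
    and \<alpha> :: "'x \<Rightarrow> 'xa multiplier"
  assumes tensor_XAA: "tensor_algebra3 sX sA sA sXA tXA sAA tAA sXAA tXA_A tX_AA"
    and coaction_hom: "hom_into_multipliers sX sXA \<alpha>"
    and coaction_inj: "inj \<alpha>"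
    and coaction_left: "\<alpha> x * mult_tensor tXA 1 (of_alg a) \<in> range of_alg"
    and coaction_right: "mult_tensor tXA 1 (of_alg a) * \<alpha> x \<in> range of_alg"
    and coaction_coassoc: "coassociative sXA tXA sXAA tXA_A tX_AA \<alpha> \<Delta>"

locale reduced_right_coaction = right_coaction +
  assumes reduced: "mult_tensor tXA (of_alg y) 1 * \<alpha> x \<in> range of_alg"

locale right_galois_object =
  reduced_right_coaction sA sAA tAA \<Delta> sX sXA tXA sXAA tXA_A tX_AA \<alpha> +
  XX: tensor_product sX sX sXX tXX
  for sA :: "'k::field \<Rightarrow> 'a::ring \<Rightarrow> 'a"
    and sAA :: "'k \<Rightarrow> 'aa::ring \<Rightarrow> 'aa" and tAA :: "'a \<Rightarrow> 'a \<Rightarrow> 'aa"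
    and \<Delta> :: "'a \<Rightarrow> 'aa multiplier"
    and sX :: "'k \<Rightarrow> 'x::ring \<Rightarrow> 'x"
    and sXX :: "'k \<Rightarrow> 'xx::ab_group_add \<Rightarrow> 'xx" and tXX :: "'x \<Rightarrow> 'x \<Rightarrow> 'xx"
    and sXA :: "'k \<Rightarrow> 'xa::ring \<Rightarrow> 'xa" and tXA :: "'x \<Rightarrow> 'a \<Rightarrow> 'xa"
    and sXAA :: "'k \<Rightarrow> 'xaa::ring \<Rightarrow> 'xaa"
    and tXA_A :: "'xa \<Rightarrow> 'a \<Rightarrow> 'xaa" and tX_AA :: "'x \<Rightarrow> 'aa \<Rightarrow> 'xaa"
    and \<alpha> :: "'x \<Rightarrow> 'xa multiplier" +
  assumes coinvariants:
      "{f. extends_to \<alpha> f (mult_tensor tXA f 1)} = {mult_scale sX c 1 | c. True}"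
    and galois: "induces_bijection sXX tXX sXA (\<lambda>x y. mult_tensor tXA (of_alg x) 1 * \<alpha> y)"


section \<open>Algebras of compact and of discrete type\<close>

locale compact_type_algebra = nondeg_algebra scale
  for scale :: "'k::field \<Rightarrow> 'a::ring \<Rightarrow> 'a" +
  assumes unit: "\<exists>u::'a. \<forall>x. u * x = x \<and> x * u = x"

locale discrete_type_algebra = nondeg_algebra scale
  for scale :: "'k::field \<Rightarrow> 'a::ring \<Rightarrow> 'a" +
  assumes finite_dim_left: "\<exists>B. finite B \<and> span B = range (\<lambda>y::'a. x * y)"
    and finite_dim_right: "\<exists>B. finite B \<and> span B = range (\<lambda>y::'a. y * x)"

end

theory Submission
  imports Defs
begin

text \<open>
  For a Galois object \<open>(X, \<alpha>)\<close> let \<open>V(x \<otimes> y) = (x \<otimes> 1)\<alpha>(y)\<close> be the Galois map and \<open>W(x \<otimes> y) = \<alpha>(x)(y \<otimes> 1)\<close>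
  its opposite version.  The proof rests on a functional \<open>\<phi>X\<close> on \<open>X\<close>: by left invariance of \<open>\<phi>\<close> the
  multiplier \<open>(\<iota> \<otimes> \<phi>)\<alpha>(y)\<close> of \<open>X\<close> is coinvariant, hence a scalar \<open>\<phi>X(y)\<close> (\<open>ex_\<phi>X\<close>).

  Compact type.  If \<open>A\<close> has a unit, then \<open>\<alpha>(y) \<in> X \<otimes> A\<close>, so \<open>(\<iota> \<otimes> \<phi>)\<alpha>(y)\<close> is an element of \<open>X\<close>; for
  suitable \<open>y\<close> it is a non-zero multiple of the unit.  If \<open>X\<close> has a unit, then \<open>\<alpha>(1) \<in> X \<otimes> A\<close> is a unit of
  \<open>X \<otimes> A\<close>, because \<open>V\<close> is onto, and \<open>A\<close> has a unit as well.

  Discrete type.  If \<open>h\<close> is a left cointegral of \<open>A\<close>, then \<open>(\<iota> \<otimes> \<phi>)(\<alpha>(x)(z \<otimes> h)) = \<phi>(h)xz\<close>.  Writing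
  \<open>z \<otimes> h = \<Sum>\<^sub>i \<alpha>(y\<^sub>i)(w\<^sub>i \<otimes> 1)\<close>, the same expression is \<open>\<Sum>\<^sub>i \<phi>X(x y\<^sub>i)w\<^sub>i\<close>, so \<open>Xz\<close> has finite dimension;
  since the form \<open>\<phi>X(xy)\<close> is non-degenerate, so has \<open>zX\<close> (\<open>finite_dim_right_imp_left\<close>).  Conversely, if \<open>Xz\<close>
  has finite dimension, non-degeneracy of that form expresses \<open>y \<mapsto> yz\<close> by finitely many functionals
  \<open>\<phi>X(\<cdot> s)\<close>, and these data yield an \<open>h \<in> A\<close> with \<open>\<phi>(ah) = \<epsilon>(a)\<close> for all \<open>a\<close>, which has to be a left
  cointegral because \<open>\<phi>\<close> is faithful (\<open>finite_dim_right_imp_cointegral\<close>).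

  This uses three facts: the existence of the counit (\<open>ex_counit\<close>); faithfulness of \<open>\<phi>\<close> on either side
  (\<open>integral_faithful_left\<close>, \<open>integral_faithful_right\<close>), from which faithfulness of \<open>\<phi>X\<close> is derived; and
  surjectivity of \<open>W\<close> (\<open>W_induct\<close>), which follows from that of \<open>V\<close> by means of the bijective antipode.
  Counit and antipode are read off from the canonical bijections of \<open>A \<otimes> A\<close>.  Coassociativity
  enters these calculations only in the sliced form that the operators \<open>x \<mapsto> (\<theta> \<otimes> \<iota>)((r \<otimes> 1)\<alpha>(x))\<close> are colinear
  (\<open>coassoc_slice_V\<close>, \<open>coassoc_V\<close>).
\<close>

section \<open>Linear maps\<close>

abbreviation lin :: "('k::field \<Rightarrow> 'v::ab_group_add \<Rightarrow> 'v) \<Rightarrow> ('k \<Rightarrow> 'u::ab_group_add \<Rightarrow> 'u) \<Rightarrow> ('v \<Rightarrow> 'u) \<Rightarrow> bool"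
  where "lin \<equiv> Vector_Spaces.linear"

lemma lin_add: "lin s t f \<Longrightarrow> f (x + y) = f x + f y"
  and lin_scale: "lin s t f \<Longrightarrow> f (s c x) = t c (f x)"
  by (auto simp: Vector_Spaces.linear_iff)

lemma lin_zero: "lin s t f \<Longrightarrow> f 0 = 0"
  using lin_add[of s t f 0 0] by simp

lemma lin_diff: "lin s t f \<Longrightarrow> f (x - y) = f x - f y"
  using lin_add[of s t f "x - y" y] by simp

lemma lin_sum: "lin s t f \<Longrightarrow> f (\<Sum>i\<in>I. g i) = (\<Sum>i\<in>I. f (g i))"
  by (induction I rule: infinite_finite_induct) (auto simp: lin_add lin_zero)

lemma linI:
  assumes "vector_space s" "vector_space t" "\<And>x y. f (x + y) = f x + f y"
    "\<And>c x. f (s c x) = t c (f x)"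
  shows "lin s t f"
  using assms by (simp add: Vector_Spaces.linear_iff)

lemma lin_vs: assumes "lin s t f" shows "vector_space s" "vector_space t"
  using assms by (simp_all add: Vector_Spaces.linear_iff)

lemma bilinI:
  assumes "vector_space sV" "vector_space sW" "vector_space sU"
    "\<And>v v' w. B (v + v') w = B v w + B v' w" "\<And>v w w'. B v (w + w') = B v w + B v w'"
    "\<And>c v w. B (sV c v) w = sU c (B v w)" "\<And>c v w. B v (sW c w) = sU c (B v w)"
  shows "bilin sV sW sU B"
  using assms by (simp add: bilin_def Vector_Spaces.linear_iff)

lemma bilinD:
  assumes "bilin sV sW sU B"
  shows "vector_space sV" "vector_space sW" "vector_space sU"
    "B (v + v') w = B v w + B v' w" "B v (w + w') = B v w + B v w'"
    "B (sV c v) w = sU c (B v w)" "B v (sW c w) = sU c (B v w)"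
  using assms by (simp_all add: bilin_def Vector_Spaces.linear_iff)

lemma (in vector_space) functionals_separate:
  assumes "\<And>\<theta>. lin scale (*) \<theta> \<Longrightarrow> \<theta> x = \<theta> y"
  shows "x = y"
proof (rule ccontr)
  assume "x \<noteq> y"
  then obtain f where "lin scale (*) f" "f (x - y) = 1"
    using separating_functional[of "x - y"] by auto
  with assms[of f] lin_diff[of scale "(*)" f x y] show False by simp
qed

lemma (in algebra) lin_mult:
  shows lin_mult_left: "lin scale scale (\<lambda>x. a * x)" and lin_mult_right: "lin scale scale (\<lambda>x. x * a)"
  by (auto intro!: linI simp: vector_space_axioms algebra_simps mult_scale_left mult_scale_right)

context vector_space
begin

lemma finite_dim_subspace:
  assumes "finite B" "subspace U" "U \<subseteq> span B"
  shows "\<exists>C. finite C \<and> span C = U"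
proof -
  obtain C where C: "C \<subseteq> U" "independent C" "U \<subseteq> span C"
    by (rule maximal_independent_subset[of U])
  have "finite C" using independent_span_bound[OF assms(1) C(2)] C(1) assms(3) by blast
  moreover have "span C = U" using span_minimal[OF C(1) assms(2)] C(3) by blast
  ultimately show ?thesis by blast
qed

text \<open>
  This is the finite-dimensionality argument of the discrete case in coordinates.  By induction on the
  number of functionals: if \<open>F v\<close> does not vanish on the common kernel of the others, subtracting
  \<open>F v y\<close> times a vector \<open>y1\<close> with \<open>F v y1 = 1\<close> from \<open>y\<close> leaves a map that is controlled by the
  others alone.
\<close>

lemma factor_through_functionals:
  assumes "finite N" "\<And>u. lin scale (*) (F u)" "lin scale s g"
    and "\<And>y. (\<And>u. u \<in> N \<Longrightarrow> F u y = 0) \<Longrightarrow> g y = 0"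
  shows "\<exists>b. \<forall>y. g y = (\<Sum>u\<in>N. s (F u y) (b u))"
  using assms(1,3,4)
proof (induction N arbitrary: g rule: finite_induct)
  case empty
  then show ?case by simp
next
  case (insert v N)
  interpret s: vector_space s by (rule lin_vs[OF insert.prems(1)])
  note Fs = lin_add[OF assms(2)] lin_scale[OF assms(2)] lin_diff[OF assms(2)]
  note gs = lin_add[OF insert.prems(1)] lin_scale[OF insert.prems(1)] lin_diff[OF insert.prems(1)]
  show ?case
  proof (cases "\<exists>y. (\<forall>u\<in>N. F u y = 0) \<and> F v y \<noteq> 0")
    case False
    have "\<exists>b. \<forall>y. g y = (\<Sum>u\<in>N. s (F u y) (b u))"
      by (rule insert.IH[OF insert.prems(1)]) (use False in \<open>auto intro!: insert.prems(2)\<close>)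
    then obtain b where b: "\<And>y. g y = (\<Sum>u\<in>N. s (F u y) (b u))" by blast
    have "g y = (\<Sum>u\<in>insert v N. s (F u y) ((b(v := 0)) u))" for y
    proof -
      have "(\<Sum>u\<in>N. s (F u y) ((b(v := 0)) u)) = (\<Sum>u\<in>N. s (F u y) (b u))"
        by (rule sum.cong) (use insert.hyps(2) in auto)
      then show ?thesis using insert.hyps by (simp add: b)
    qed
    then show ?thesis by blast
  next
    case True
    then obtain y1' where y1': "\<And>u. u \<in> N \<Longrightarrow> F u y1' = 0" "F v y1' \<noteq> 0" by blast
    define y1 where "y1 = scale (inverse (F v y1')) y1'"
    have y1: "\<And>u. u \<in> N \<Longrightarrow> F u y1 = 0" "F v y1 = 1" using y1' by (auto simp: y1_def Fs)
    define g' where "g' y = g (y - scale (F v y) y1)" for y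
    have "lin scale s g'"
      unfolding g'_def
      by (rule linI[OF vector_space_axioms s.vector_space_axioms])
        (simp_all add: gs Fs scale_left_distrib s.scale_left_distrib s.scale_right_diff_distrib)
    moreover have "g' y = 0" if "\<And>u. u \<in> N \<Longrightarrow> F u y = 0" for y
      unfolding g'_def by (rule insert.prems(2)) (use that y1 in \<open>auto simp: Fs\<close>)
    ultimately obtain b where b: "\<And>y. g' y = (\<Sum>u\<in>N. s (F u y) (b u))"
      using insert.IH[of g'] by blast
    have "g y = (\<Sum>u\<in>insert v N. s (F u y) ((b(v := g y1)) u))" for y
    proof -
      have "(\<Sum>u\<in>N. s (F u y) ((b(v := g y1)) u)) = (\<Sum>u\<in>N. s (F u y) (b u))"
        by (rule sum.cong) (use insert.hyps(2) in auto)
      then have "(\<Sum>u\<in>insert v N. s (F u y) ((b(v := g y1)) u)) = s (F v y) (g y1) + g' y"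
        using insert.hyps by (simp add: b)
      also have "\<dots> = g y" by (simp add: g'_def gs)
      finally show ?thesis by simp
    qed
    then show ?thesis by blast
  qed
qed

text \<open>
  Adding one vector to a spanning set enlarges the common kernel of the functionals chosen so far by at
  most one dimension, and one more functional removes it.
\<close>

lemma finitely_many_separate:
  assumes "finite B" "\<And>u. lin scale (*) (F u)" "\<And>v. (\<And>u. F u v = 0) \<Longrightarrow> v = 0"
  shows "\<exists>N. finite N \<and> (\<forall>v\<in>span B. (\<forall>u\<in>N. F u v = 0) \<longrightarrow> v = 0)"
  using assms(1)
proof (induction B rule: finite_induct)
  case empty
  show ?case by (intro exI[of _ "{}"]) simp
next
  case (insert b B)
  note Fs = lin_add[OF assms(2)] lin_scale[OF assms(2)] lin_diff[OF assms(2)]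
  obtain N where N: "finite N" "\<And>v. v \<in> span B \<Longrightarrow> (\<forall>u\<in>N. F u v = 0) \<Longrightarrow> v = 0"
    using insert.IH by blast
  show ?case
  proof (cases "\<exists>v\<in>span (insert b B). (\<forall>u\<in>N. F u v = 0) \<and> v \<noteq> 0")
    case False
    with N(1) show ?thesis by blast
  next
    case True
    then obtain v0 where v0: "v0 \<in> span (insert b B)" "\<forall>u\<in>N. F u v0 = 0" "v0 \<noteq> 0" by blast
    obtain u0 where u0: "F u0 v0 \<noteq> 0" using assms(3) v0(3) by blast
    obtain c0 where c0: "v0 - scale c0 b \<in> span B" using v0(1) by (auto simp: span_insert)
    have "c0 \<noteq> 0" using N(2)[of v0] v0 c0 by auto
    have "v = 0" if v: "v \<in> span (insert b B)" "\<forall>u\<in>insert u0 N. F u v = 0" for v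
    proof -
      obtain c where c: "v - scale c b \<in> span B" using v(1) by (auto simp: span_insert)
      let ?k = "c / c0"
      have "(v - scale c b) - scale ?k (v0 - scale c0 b) \<in> span B"
        by (rule span_diff[OF c span_scale[OF c0]])
      moreover have "(v - scale c b) - scale ?k (v0 - scale c0 b) = v - scale ?k v0"
        using \<open>c0 \<noteq> 0\<close> by (simp add: scale_right_diff_distrib)
      ultimately have "v - scale ?k v0 = 0"
        using N(2)[of "v - scale ?k v0"] v(2) v0(2) by (simp add: Fs)
      then have *: "v = scale ?k v0" by simp
      have "F u0 v = ?k * F u0 v0" by (subst *) (rule Fs)
      then have "?k * F u0 v0 = 0" using v(2) by simp
      with u0 have "?k = 0" by simp
      then show ?thesis using * by simp
    qed
    with N(1) show ?thesis by (intro exI[of _ "insert u0 N"]) auto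
  qed
qed

end

section \<open>Slices of tensors\<close>

context tensor_product
begin

lemma lift_simps:
  assumes "bilin sV sW sU B"
  shows lift_add: "tensor_lift sT sU tens B (x + y) = tensor_lift sT sU tens B x + tensor_lift sT sU tens B y"
    and lift_scale: "tensor_lift sT sU tens B (sT c x) = sU c (tensor_lift sT sU tens B x)"
  by (rule lin_add[OF tensor_lift(1)[OF assms]], rule lin_scale[OF tensor_lift(1)[OF assms]])

lemma tens_induct [case_names add tens]:
  assumes "\<And>x y. P x \<Longrightarrow> P y \<Longrightarrow> P (x + y)" "\<And>a b. P (tens a b)"
  shows "P z"
proof -
  have "z \<in> T.span {tens v w | v w. True}" using span_tens by auto
  then show ?thesis
  proof (induction z rule: T.span_induct_alt)
    case base
    have "tens 0 0 = 0" using tens_simps(1)[of 0 0 0] by simp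
    then show ?case using assms(2)[of 0 0] by simp
  next
    case (step c x y)
    then obtain v w where "x = tens v w" by auto
    then have "sT c x = tens (sV c v) w" by (simp add: tens_simps)
    with step assms show ?case by metis
  qed
qed

lemma lift_plus:
  assumes "bilin sV sW sU B" "bilin sV sW sU B'"
  shows "bilin sV sW sU (\<lambda>v w. B v w + B' v w)"
    "tensor_lift sT sU tens (\<lambda>v w. B v w + B' v w) z = tensor_lift sT sU tens B z + tensor_lift sT sU tens B' z"
proof -
  interpret U: vector_space sU by (rule bilinD(3)[OF assms(1)])
  show bil: "bilin sV sW sU (\<lambda>v w. B v w + B' v w)"
    by (rule bilinI) (simp_all add: bilinD[OF assms(1)] bilinD[OF assms(2)] U.scale_right_distrib algebra_simps)
  show "tensor_lift sT sU tens (\<lambda>v w. B v w + B' v w) z = tensor_lift sT sU tens B z + tensor_lift sT sU tens B' z"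
    by (induction z rule: tens_induct)
      (simp_all add: tensor_lift(2)[OF bil] lift_add[OF bil] tensor_lift(2)[OF assms(1)] lift_add[OF assms(1)]
        tensor_lift(2)[OF assms(2)] lift_add[OF assms(2)] algebra_simps)
qed

text \<open>
  The slice maps \<open>\<theta> \<otimes> \<iota>\<close> and \<open>\<iota> \<otimes> \<omega>\<close>.  Identities in triple tensor products are replaced
  below by their slices, so that most calculations take place in tensors with two legs.
\<close>

definition left_slice :: "('v \<Rightarrow> 'k) \<Rightarrow> 't \<Rightarrow> 'w"
  where "left_slice \<theta> = tensor_lift sT sW tens (\<lambda>v w. sW (\<theta> v) w)"

definition right_slice :: "('w \<Rightarrow> 'k) \<Rightarrow> 't \<Rightarrow> 'v"
  where "right_slice \<omega> = tensor_lift sT sV tens (\<lambda>v w. sV (\<omega> w) v)"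

lemma bilin_left_slice: "lin sV (*) \<theta> \<Longrightarrow> bilin sV sW sW (\<lambda>v w. sW (\<theta> v) w)"
  by (auto intro!: bilinI simp: V.vector_space_axioms W.vector_space_axioms lin_add lin_scale
      W.scale_left_distrib W.scale_right_distrib mult.commute)

lemma bilin_right_slice: "lin sW (*) \<omega> \<Longrightarrow> bilin sV sW sV (\<lambda>v w. sV (\<omega> w) v)"
  by (auto intro!: bilinI simp: V.vector_space_axioms W.vector_space_axioms lin_add lin_scale
      V.scale_left_distrib V.scale_right_distrib mult.commute)

lemma lin_left_slice: "lin sV (*) \<theta> \<Longrightarrow> lin sT sW (left_slice \<theta>)"
  unfolding left_slice_def by (rule tensor_lift(1)[OF bilin_left_slice])

lemma lin_right_slice: "lin sW (*) \<omega> \<Longrightarrow> lin sT sV (right_slice \<omega>)"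
  unfolding right_slice_def by (rule tensor_lift(1)[OF bilin_right_slice])

lemma left_slice_simps [simp]:
  assumes "lin sV (*) \<theta>"
  shows "left_slice \<theta> (tens v w) = sW (\<theta> v) w" "left_slice \<theta> (x + y) = left_slice \<theta> x + left_slice \<theta> y"
    "left_slice \<theta> (sT c x) = sW c (left_slice \<theta> x)" "left_slice \<theta> 0 = 0" "left_slice \<theta> (x - y) = left_slice \<theta> x - left_slice \<theta> y"
    "left_slice \<theta> (\<Sum>i\<in>I. g i) = (\<Sum>i\<in>I. left_slice \<theta> (g i))"
  using lin_left_slice[OF assms] tensor_lift(2)[OF bilin_left_slice[OF assms]]
  by (auto simp: lin_add lin_scale lin_zero lin_diff lin_sum left_slice_def)

lemma right_slice_simps [simp]:
  assumes "lin sW (*) \<omega>"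
  shows "right_slice \<omega> (tens v w) = sV (\<omega> w) v" "right_slice \<omega> (x + y) = right_slice \<omega> x + right_slice \<omega> y"
    "right_slice \<omega> (sT c x) = sV c (right_slice \<omega> x)" "right_slice \<omega> 0 = 0" "right_slice \<omega> (x - y) = right_slice \<omega> x - right_slice \<omega> y"
    "right_slice \<omega> (\<Sum>i\<in>I. g i) = (\<Sum>i\<in>I. right_slice \<omega> (g i))"
  using lin_right_slice[OF assms] tensor_lift(2)[OF bilin_right_slice[OF assms]]
  by (auto simp: lin_add lin_scale lin_zero lin_diff lin_sum right_slice_def)

lemma slice_slice: "lin sV (*) \<theta> \<Longrightarrow> lin sW (*) \<omega> \<Longrightarrow> \<omega> (left_slice \<theta> z) = \<theta> (right_slice \<omega> z)"
  by (induction z rule: tens_induct) (auto simp: lin_add lin_scale mult.commute)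

lemma eq_by_slices:
  assumes "\<And>\<theta>. lin sV (*) \<theta> \<Longrightarrow> left_slice \<theta> x = left_slice \<theta> y"
  shows "x = y"
proof -
  have "x - y = 0"
  proof (rule separating_forms)
    fix \<theta> \<omega> F assume *: "lin sV (*) \<theta>" "lin sW (*) \<omega>" "lin sT (*) F"
      and F: "\<And>v w. F (tens v w) = \<theta> v * \<omega> w"
    have "F = (\<lambda>z. \<omega> (left_slice \<theta> z))"
      by (rule linear_eqI[OF *(3) linear_comp[OF lin_left_slice[OF *(1)] *(2)]])
        (simp add: F * lin_scale[OF *(2)])
    then show "F (x - y) = 0" using * assms[OF *(1)] by (simp add: lin_zero)
  qed
  then show ?thesis by simp
qed

lemma eq_by_right_slices:
  assumes "\<And>\<omega>. lin sW (*) \<omega> \<Longrightarrow> right_slice \<omega> x = right_slice \<omega> y"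
  shows "x = y"
  by (rule eq_by_slices, rule W.functionals_separate) (simp add: slice_slice assms)

text \<open>
  Expanding the left leg in a basis of \<open>V\<close> writes a tensor by means of its own left slices; so a tensor all
  of whose left slices lie in a subspace is a sum of elementary tensors with right legs in that
  subspace.
\<close>

lemma slice_expansion:
  obtains I :: "'v set" and \<theta> where "finite I" "\<And>e. lin sV (*) (\<theta> e)" "z = (\<Sum>e\<in>I. tens e (left_slice (\<theta> e) z))"
proof -
  obtain E where E: "V.independent E" "UNIV \<subseteq> V.span E"
    by (rule V.maximal_independent_subset[of UNIV])
  define \<theta> where "\<theta> = (\<lambda>e v. V.representation E v e)"
  have sp: "v \<in> V.span E" for v by (rule subsetD[OF E(2) UNIV_I])
  have \<theta>: "lin sV (*) (\<theta> e)" for e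
    unfolding \<theta>_def
    by (rule linI[OF V.vector_space_axioms vector_space_self])
      (simp_all only: V.representation_add[OF E(1) sp sp] V.representation_scale[OF E(1) sp])
  have zero: "tens e 0 = 0" for e using tens_simps(2)[of e 0 0] by simp
  have tens_sum: "tens (\<Sum>i\<in>J. f i) b = (\<Sum>i\<in>J. tens (f i) b)" if "finite J" for J :: "'v set" and f b
    using that tens_simps(1)[of 0 0 b] by (induction J rule: finite_induct) (auto simp: tens_simps)
  have "\<exists>I. finite I \<and> (\<forall>J. finite J \<and> I \<subseteq> J \<longrightarrow> z = (\<Sum>e\<in>J. tens e (left_slice (\<theta> e) z)))"
  proof (induction z rule: tens_induct)
    case (add x y)
    then obtain I I' where I: "finite I" "finite I'"
      "\<And>J. finite J \<Longrightarrow> I \<subseteq> J \<Longrightarrow> x = (\<Sum>e\<in>J. tens e (left_slice (\<theta> e) x))"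
      "\<And>J. finite J \<Longrightarrow> I' \<subseteq> J \<Longrightarrow> y = (\<Sum>e\<in>J. tens e (left_slice (\<theta> e) y))" by metis
    have "x + y = (\<Sum>e\<in>J. tens e (left_slice (\<theta> e) (x + y)))" if "finite J" "I \<union> I' \<subseteq> J" for J
      using I(3)[of J] I(4)[of J] that by (simp add: \<theta> tens_simps sum.distrib)
    with I(1,2) show ?case by (intro exI[of _ "I \<union> I'"]) auto
  next
    case (tens a b)
    let ?I = "{e. V.representation E a e \<noteq> 0}"
    have fin: "finite ?I" by (rule V.finite_representation)
    have "tens a b = (\<Sum>e\<in>J. tens e (left_slice (\<theta> e) (tens a b)))" if J: "finite J" "?I \<subseteq> J" for J
    proof -
      have "a = (\<Sum>e\<in>?I. sV (\<theta> e a) e)"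
        using V.sum_nonzero_representation_eq[OF E(1) sp[of a]] by (simp add: \<theta>_def)
      also have "\<dots> = (\<Sum>e\<in>J. sV (\<theta> e a) e)"
        by (rule sum.mono_neutral_left) (use J in \<open>auto simp: \<theta>_def\<close>)
      finally have "tens a b = (\<Sum>e\<in>J. tens (sV (\<theta> e a) e) b)" using tens_sum[OF J(1)] by metis
      also have "\<dots> = (\<Sum>e\<in>J. tens e (left_slice (\<theta> e) (tens a b)))"
        by (simp only: left_slice_simps(1)[OF \<theta>] tens_simps)
      finally show ?thesis .
    qed
    with fin show ?case by blast
  qed
  then obtain I where "finite I" "z = (\<Sum>e\<in>I. tens e (left_slice (\<theta> e) z))" by blast
  with \<theta> show ?thesis using that by blast
qed

end

section \<open>Multipliers of a tensor product\<close>

lemma of_alg_mult: "of_alg (a * b) = of_alg a * of_alg b"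
  by (rule multiplier_eqI) (auto simp: algebra_simps)

lemma of_alg_add: "of_alg (a + b) = of_alg a + of_alg b"
  by (rule multiplier_eqI) (auto simp: algebra_simps)

lemma of_alg_lmul: "of_alg (lmul m z) = m * of_alg z"
  by (rule multiplier_eqI) (auto simp: lmul_mult rmul_lmul)

lemma of_alg_rmul: "of_alg (rmul m z) = of_alg z * m"
  by (rule multiplier_eqI) (auto simp: rmul_mult rmul_lmul)

lemma (in algebra) of_alg_scale: "of_alg (scale c a) = mult_scale scale c (of_alg a)"
  by (rule multiplier_eqI) (auto simp: mult_scale_left mult_scale_right)

context nondeg_algebra
begin

lemma lmul_scale [simp]: "lmul m (scale c x) = scale c (lmul m x)"
  and rmul_scale [simp]: "rmul m (scale c x) = scale c (rmul m x)"
  using multiplier_linear[of m] by (auto simp: lin_scale)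

lemma times_mult_scale:
  "mult_scale scale c m * n = mult_scale scale c (m * n)" "n * mult_scale scale c m = mult_scale scale c (n * m)"
  by (auto intro!: multiplier_eqI)

lemma multiplier_cancel_left: "(\<And>z::'a. of_alg z * m = of_alg z * n) \<Longrightarrow> m = n"
proof (rule multiplier_eqI)
  assume *: "\<And>z::'a. of_alg z * m = of_alg z * n"
  show r: "rmul m x = rmul n x" for x
    using *[of x] by (simp add: of_alg_rmul[symmetric] of_alg_eq_iff)
  show "lmul m x = lmul n x" for x
    by (rule cancel_left) (simp add: rmul_lmul[symmetric] r)
qed

lemma multiplier_cancel_right: "(\<And>z::'a. m * of_alg z = n * of_alg z) \<Longrightarrow> m = n"
proof (rule multiplier_eqI)
  assume *: "\<And>z::'a. m * of_alg z = n * of_alg z"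
  show r: "lmul m x = lmul n x" for x
    using *[of x] by (simp add: of_alg_lmul[symmetric] of_alg_eq_iff)
  show "rmul m x = rmul n x" for x
    by (rule cancel_right) (simp add: rmul_lmul r)
qed

end

context tensor_algebra
begin

lemma mult_tensor_times: "mult_tensor tens m n * mult_tensor tens m' n' = mult_tensor tens (m * m') (n * n')"
  by (rule mult_tensor_unique) simp_all

lemma of_alg_tens: "of_alg (tens a b) = mult_tensor tens (of_alg a) (of_alg b)"
  by (rule mult_tensor_unique) (simp_all add: tens_mult)

lemma mult_tensor_one: "mult_tensor tens 1 1 = 1"
  by (rule mult_tensor_unique[symmetric]) simp_all

lemma mult_tensor_add:
  "mult_tensor tens (m + m') n = mult_tensor tens m n + mult_tensor tens m' n"
  "mult_tensor tens m (n + n') = mult_tensor tens m n + mult_tensor tens m n'"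
  by (rule mult_tensor_unique[symmetric]; simp add: tens_simps)+

lemma mult_tensor_scale:
  "mult_tensor tens (mult_scale sA c m) n = mult_scale sT c (mult_tensor tens m n)"
  "mult_tensor tens m (mult_scale sB c n) = mult_scale sT c (mult_tensor tens m n)"
  by (rule mult_tensor_unique[symmetric]; simp add: tens_simps)+

lemma bilin_mult_tensor:
  assumes "lin s (mult_scale sA) f" "lin t (mult_scale sB) g"
  shows "bilin s t (mult_scale sT) (\<lambda>x y. mult_tensor tens (f x) (g y))"
  by (rule bilinI)
    (simp_all add: lin_vs[OF assms(1)] lin_vs[OF assms(2)] T.vector_space_multiplier
      lin_add[OF assms(1)] lin_add[OF assms(2)] lin_scale[OF assms(1)] lin_scale[OF assms(2)]
      mult_tensor_add mult_tensor_scale)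

lemma left_slice_mult_right_leg:
  assumes "lin sA (*) \<theta>"
  shows "left_slice \<theta> (lmul (mult_tensor tens 1 n) z) = lmul n (left_slice \<theta> z)"
    "left_slice \<theta> (rmul (mult_tensor tens 1 n) z) = rmul n (left_slice \<theta> z)"
  by (induction z rule: tens_induct; simp add: assms lmul_add rmul_add)+

lemma right_slice_mult_left_leg:
  assumes "lin sB (*) \<omega>"
  shows "right_slice \<omega> (lmul (mult_tensor tens m 1) z) = lmul m (right_slice \<omega> z)"
    "right_slice \<omega> (rmul (mult_tensor tens m 1) z) = rmul m (right_slice \<omega> z)"
  by (induction z rule: tens_induct; simp add: assms lmul_add rmul_add)+

lemma lin_lmul: "lin sA (*) \<theta> \<Longrightarrow> lin sA (*) (\<lambda>x. \<theta> (lmul m x))"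
  and lin_rmul: "lin sA (*) \<theta> \<Longrightarrow> lin sA (*) (\<lambda>x. \<theta> (rmul m x))"
  using A.multiplier_linear[of m] by (auto intro: linear_comp)

lemma left_slice_mult_left_leg:
  assumes "lin sA (*) \<theta>"
  shows "left_slice \<theta> (lmul (mult_tensor tens m 1) z) = left_slice (\<lambda>x. \<theta> (lmul m x)) z"
    "left_slice \<theta> (rmul (mult_tensor tens m 1) z) = left_slice (\<lambda>x. \<theta> (rmul m x)) z"
  by (induction z rule: tens_induct; simp add: assms lmul_add rmul_add lin_lmul lin_rmul)+

lemma cancel_left_leg:
  assumes "\<And>a. mult_tensor tens (of_alg a) 1 * m = mult_tensor tens (of_alg a) 1 * n"
  shows "m = n"
proof (rule T.multiplier_cancel_left)
  fix z show "of_alg z * m = of_alg z * n"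
  proof (induction z rule: tens_induct)
    case (tens a b)
    have "of_alg (tens a b) = mult_tensor tens 1 (of_alg b) * mult_tensor tens (of_alg a) 1"
      by (simp add: of_alg_tens mult_tensor_times)
    then show ?case using assms[of a] by (simp add: mult.assoc)
  qed (simp add: of_alg_add distrib_right)
qed

lemma cancel_right_leg:
  assumes "\<And>b. m * mult_tensor tens 1 (of_alg b) = n * mult_tensor tens 1 (of_alg b)"
  shows "m = n"
proof (rule T.multiplier_cancel_right)
  fix z show "m * of_alg z = n * of_alg z"
  proof (induction z rule: tens_induct)
    case (tens a b)
    have "of_alg (tens a b) = mult_tensor tens 1 (of_alg b) * mult_tensor tens (of_alg a) 1"
      by (simp add: of_alg_tens mult_tensor_times)
    then show ?case using assms[of b] by (simp add: mult.assoc[symmetric])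
  qed (simp add: of_alg_add distrib_left)
qed

end

text \<open>
  The element of \<open>X\<close> that a multiplier in \<open>X \<subseteq> M(X)\<close> comes from; the value is arbitrary for the other
  multipliers.
\<close>

definition unalg :: "'a::ring multiplier \<Rightarrow> 'a" where
  "unalg m = (SOME z. of_alg z = m)"

lemma of_alg_unalg: "m \<in> range of_alg \<Longrightarrow> of_alg (unalg m) = m"
  unfolding unalg_def by (rule someI_ex) auto

text \<open>
  A map into \<open>M(Q)\<close> whose linearisation has range \<open>Q\<close> takes its values in \<open>Q\<close>; so the Galois map and the
  canonical maps of a multiplier Hopf algebra can be handled as bijections of vector spaces.
\<close>

lemma (in tensor_product) bij_lift:
  assumes Q: "nondeg_algebra sQ" and F: "bilin sV sW (mult_scale sQ) F"
    and ind: "induces_bijection sT tens sQ F"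
  shows "\<And>p r. of_alg (unalg (F p r)) = F p r" "bilin sV sW sQ (\<lambda>p r. unalg (F p r))"
    "bij (tensor_lift sT sQ tens (\<lambda>p r. unalg (F p r)))"
proof -
  define T where "T = (\<lambda>p r. unalg (F p r))"
  interpret Q: nondeg_algebra sQ by (rule Q)
  let ?L = "tensor_lift sT (mult_scale sQ) tens F"
  have bb: "bij_betw ?L UNIV (range of_alg)" using ind by (simp add: induces_bijection_def)
  have "F p r \<in> range of_alg" for p r
    using bspec[OF bij_betwE[OF bb] UNIV_I, of "tens p r"] unfolding tensor_lift(2)[OF F] .
  then have 1: "of_alg (T p r) = F p r" for p r unfolding T_def by (rule of_alg_unalg)
  then show "of_alg (unalg (F p r)) = F p r" for p r by (simp add: T_def)
  note inj = Q.of_alg_eq_iff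
  have 2: "bilin sV sW sQ T"
    by (rule bilinI; (simp add: V.vector_space_axioms W.vector_space_axioms Q.vector_space_axioms)?;
        subst inj[symmetric], simp add: 1 of_alg_add Q.of_alg_scale bilinD[OF F])
  then show "bilin sV sW sQ (\<lambda>p r. unalg (F p r))" by (simp add: T_def)
  have 3: "?L z = of_alg (tensor_lift sT sQ tens T z)" for z
    by (induction z rule: tens_induct)
      (simp_all add: lift_add[OF F] lift_add[OF 2] tensor_lift(2)[OF F] tensor_lift(2)[OF 2] 1 of_alg_add)
  have "bij (tensor_lift sT sQ tens T)"
  proof (rule bijI)
    show "inj (tensor_lift sT sQ tens T)"
      using bij_betw_imp_inj_on[OF bb] by (auto simp: inj_on_def 3)
    show "surj (tensor_lift sT sQ tens T)"
    proof -
      have "\<exists>z. w = tensor_lift sT sQ tens T z" for w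
      proof -
        have "of_alg w \<in> range ?L" using bij_betw_imp_surj_on[OF bb] by blast
        then obtain z where "of_alg w = ?L z" by blast
        then show ?thesis using 3 inj by metis
      qed
      then show ?thesis unfolding surj_def by blast
    qed
  qed
  then show "bij (tensor_lift sT sQ tens (\<lambda>p r. unalg (F p r)))" by (simp add: T_def)
qed

text \<open>
  The form in which the surjectivity of the Galois map and of the canonical maps is used: additive
  statements only have to be checked on the values of the bilinear map.
\<close>

lemma (in tensor_product) surj_lift_induct:
  assumes "bilin sV sW sU B" "surj (tensor_lift sT sU tens B)"
    and "\<And>x y. P x \<Longrightarrow> P y \<Longrightarrow> P (x + y)" "\<And>v w. P (B v w)"
  shows "P z"
proof -
  have "P (tensor_lift sT sU tens B t)" for t
  proof (induction t rule: tens_induct)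
    case (add x y)
    then show ?case unfolding lift_add[OF assms(1)] by (rule assms(3))
  next
    case (tens v w)
    show ?case unfolding tensor_lift(2)[OF assms(1)] by (rule assms(4))
  qed
  then show ?thesis using assms(2) by (metis surjD)
qed

section \<open>Coactions seen through slices\<close>

text \<open>
  The products of \<open>F(x) \<in> M(X \<otimes> A)\<close> with one leg, as elements of \<open>X \<otimes> A\<close>.  For \<open>F = \<Delta>\<close> the
  versions \<open>right2\<close>, \<open>left1\<close>, \<open>right1\<close>, \<open>left2\<close> are the canonical maps \<open>T1\<close>, \<open>T2\<close>, \<open>T3\<close>, \<open>T4\<close> of a multiplier
  Hopf algebra, for a coaction \<open>F = \<alpha>\<close> the version \<open>left1\<close> is the Galois map.
\<close>

definition right1 where "right1 t F a b = unalg (F a * mult_tensor t (of_alg b) 1)"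
definition right2 where "right2 t F a b = unalg (F a * mult_tensor t 1 (of_alg b))"
definition left1 where "left1 t F a b = unalg (mult_tensor t (of_alg a) 1 * F b)"
definition left2 where "left2 t F a b = unalg (mult_tensor t 1 (of_alg a) * F b)"
lemmas leg_defs = right1_def right2_def left1_def left2_def

lemma lin_of_alg: "nondeg_algebra s \<Longrightarrow> lin s (mult_scale s) of_alg"
proof -
  assume "nondeg_algebra s"
  then interpret nondeg_algebra s .
  show ?thesis
    by (rule linI) (simp_all add: vector_space_axioms vector_space_multiplier of_alg_add of_alg_scale)
qed

lemma bilin_times:
  fixes sU :: "'k::field \<Rightarrow> 'u::ring \<Rightarrow> 'u"
  assumes "nondeg_algebra sU" "lin s (mult_scale sU) f" "lin t (mult_scale sU) g"
  shows "bilin s t (mult_scale sU) (\<lambda>x y. f x * g y)"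
proof -
  interpret nondeg_algebra sU by fact
  show ?thesis
    by (rule bilinI) (simp_all add: lin_vs[OF assms(2)] lin_vs[OF assms(3)] vector_space_multiplier
       lin_add[OF assms(2)] lin_add[OF assms(3)] lin_scale[OF assms(2)] lin_scale[OF assms(3)]
      algebra_simps times_mult_scale)
qed

lemma bilin_unalg:
  fixes sU :: "'k::field \<Rightarrow> 'u::ring \<Rightarrow> 'u"
  assumes "nondeg_algebra sU" "bilin s t (mult_scale sU) F" and cov: "\<And>x y. F x y \<in> range of_alg"
  shows "bilin s t sU (\<lambda>x y. unalg (F x y))"
proof -
  interpret nondeg_algebra sU by fact
  show ?thesis
    by (rule bilinI; (simp add: bilinD(1,2)[OF assms(2)] vector_space_axioms)?;
      subst of_alg_eq_iff[symmetric],
      simp only: of_alg_unalg[OF cov] of_alg_add of_alg_scale; rule bilinD[OF assms(2)])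
qed

lemma lin_first_leg: "tensor_algebra sP sR sQ t \<Longrightarrow> lin sP (mult_scale sQ) (\<lambda>a. mult_tensor t (of_alg a) 1)"
proof -
  assume "tensor_algebra sP sR sQ t"
  then interpret tensor_algebra sP sR sQ t .
  show ?thesis
    by (rule linI) (simp_all add: A.vector_space_axioms T.vector_space_multiplier of_alg_add mult_tensor_add
        A.of_alg_scale mult_tensor_scale)
qed

lemma lin_second_leg: "tensor_algebra sP sR sQ t \<Longrightarrow> lin sR (mult_scale sQ) (\<lambda>a. mult_tensor t 1 (of_alg a))"
proof -
  assume "tensor_algebra sP sR sQ t"
  then interpret tensor_algebra sP sR sQ t .
  show ?thesis
    by (rule linI) (simp_all add: B.vector_space_axioms T.vector_space_multiplier of_alg_add mult_tensor_add
        B.of_alg_scale mult_tensor_scale)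
qed

text \<open>
  What a reduced coaction \<open>\<alpha>\<close> of \<open>A\<close> on \<open>X\<close> has in common with the comultiplication itself.  The case
  \<open>X = A\<close>, \<open>\<alpha> = \<Delta>\<close> gives the calculations in \<open>A\<close>, the case of a Galois object those in \<open>X\<close>.
\<close>

locale covered_coaction = tensor_algebra3 sX sA sA sXA tXA sAA tAA sXAA tXA_A tX_AA
  for sX :: "'k::field \<Rightarrow> 'x::ring \<Rightarrow> 'x"
    and sA :: "'k \<Rightarrow> 'a::ring \<Rightarrow> 'a"
    and sXA :: "'k \<Rightarrow> 'xa::ring \<Rightarrow> 'xa" and tXA :: "'x \<Rightarrow> 'a \<Rightarrow> 'xa"
    and sAA :: "'k \<Rightarrow> 'aa::ring \<Rightarrow> 'aa" and tAA :: "'a \<Rightarrow> 'a \<Rightarrow> 'aa"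
    and sXAA :: "'k \<Rightarrow> 'xaa::ring \<Rightarrow> 'xaa"
    and tXA_A :: "'xa \<Rightarrow> 'a \<Rightarrow> 'xaa" and tX_AA :: "'x \<Rightarrow> 'aa \<Rightarrow> 'xaa" +
  fixes \<Delta> :: "'a \<Rightarrow> 'aa multiplier" and \<alpha> :: "'x \<Rightarrow> 'xa multiplier"
  assumes \<Delta>_hom: "hom_into_multipliers sA sAA \<Delta>" and \<alpha>_hom: "hom_into_multipliers sX sXA \<alpha>"
    and \<Delta>_nondeg: "module.span sAA {lmul (\<Delta> a) z | a z. True} = UNIV"
    and T1_cov: "\<Delta> a * mult_tensor tAA 1 (of_alg b) \<in> range of_alg"
    and T2_cov: "mult_tensor tAA (of_alg b) 1 * \<Delta> a \<in> range of_alg"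
    and T4_cov: "mult_tensor tAA 1 (of_alg b) * \<Delta> a \<in> range of_alg"
    and G_cov: "\<alpha> x * mult_tensor tXA 1 (of_alg b) \<in> range of_alg"
    and V_cov: "mult_tensor tXA (of_alg y) 1 * \<alpha> x \<in> range of_alg"
    and H_cov: "mult_tensor tXA 1 (of_alg b) * \<alpha> x \<in> range of_alg"
    and coassoc: "coassociative sXA tXA sXAA tXA_A tX_AA \<alpha> \<Delta>"
begin

abbreviation T1 where "T1 \<equiv> right2 tAA \<Delta>"
abbreviation T2 where "T2 \<equiv> left1 tAA \<Delta>"
abbreviation T4 where "T4 \<equiv> left2 tAA \<Delta>"
abbreviation G where "G \<equiv> right2 tXA \<alpha>"
abbreviation V where "V \<equiv> left1 tXA \<alpha>"
abbreviation H where "H \<equiv> left2 tXA \<alpha>"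

lemma \<Delta>_mult: "\<Delta> (a * b) = \<Delta> a * \<Delta> b" and lin_\<Delta>: "lin sA (mult_scale sAA) \<Delta>"
  using \<Delta>_hom by (auto simp: hom_into_multipliers_def)
lemma \<alpha>_mult: "\<alpha> (x * y) = \<alpha> x * \<alpha> y" and lin_\<alpha>: "lin sX (mult_scale sXA) \<alpha>"
  using \<alpha>_hom by (auto simp: hom_into_multipliers_def)

lemmas of_alg_T = of_alg_unalg[OF T1_cov, folded leg_defs] of_alg_unalg[OF T2_cov, folded leg_defs]
  of_alg_unalg[OF T4_cov, folded leg_defs]
lemmas of_alg_V = of_alg_unalg[OF G_cov, folded leg_defs] of_alg_unalg[OF V_cov, folded leg_defs]
  of_alg_unalg[OF H_cov, folded leg_defs]

lemmas lin_legs_AA = lin_first_leg[OF YZ.tensor_algebra_axioms] lin_second_leg[OF YZ.tensor_algebra_axioms]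
lemmas lin_legs_XA = lin_first_leg[OF XY.tensor_algebra_axioms] lin_second_leg[OF XY.tensor_algebra_axioms]

lemmas bilin_T_multipliers =
  bilin_times[OF YZ.nondeg_algebra_T lin_\<Delta> lin_legs_AA(2)]
  bilin_times[OF YZ.nondeg_algebra_T lin_legs_AA(1) lin_\<Delta>]
  bilin_times[OF YZ.nondeg_algebra_T lin_legs_AA(2) lin_\<Delta>]
lemmas bilin_V_multipliers =
  bilin_times[OF XY.nondeg_algebra_T lin_\<alpha> lin_legs_XA(2)]
  bilin_times[OF XY.nondeg_algebra_T lin_legs_XA(1) lin_\<alpha>]

lemmas bilin_T1 = bilin_unalg[OF YZ.nondeg_algebra_T bilin_T_multipliers(1) T1_cov, folded leg_defs]
lemmas bilin_T2 = bilin_unalg[OF YZ.nondeg_algebra_T bilin_T_multipliers(2) T2_cov, folded leg_defs]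
lemmas bilin_T4 = bilin_unalg[OF YZ.nondeg_algebra_T bilin_T_multipliers(3) T4_cov, folded leg_defs]
lemmas bilin_G = bilin_unalg[OF XY.nondeg_algebra_T bilin_V_multipliers(1) G_cov, folded leg_defs]
lemmas bilin_V = bilin_unalg[OF XY.nondeg_algebra_T bilin_V_multipliers(2) V_cov, folded leg_defs]

lemmas G_simps = bilinD(4-7)[OF bilin_G]
lemmas V_simps = bilinD(4-7)[OF bilin_V]
lemmas T1_simps = bilinD(4-7)[OF bilin_T1]
lemmas T2_simps = bilinD(4-7)[OF bilin_T2]
lemmas T4_simps = bilinD(4-7)[OF bilin_T4]

lemma V_right: "rmul (mult_tensor tXA 1 (of_alg d)) (V r y) = lmul (mult_tensor tXA (of_alg r) 1) (G y d)"
  by (subst XY.T.of_alg_eq_iff[symmetric]) (simp add: of_alg_rmul of_alg_lmul of_alg_V mult.assoc)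

lemma V_left: "lmul (mult_tensor tXA (of_alg s) 1) (V r y) = V (s * r) y"
  by (subst XY.T.of_alg_eq_iff[symmetric])
    (simp add: of_alg_lmul of_alg_V mult.assoc[symmetric] XY.mult_tensor_times of_alg_mult)

lemma V_times: "V r (x * y) = rmul (\<alpha> y) (V r x)"
  by (subst XY.T.of_alg_eq_iff[symmetric]) (simp add: of_alg_rmul of_alg_V mult.assoc \<alpha>_mult)

lemma V_eqD: "(\<And>r. V r y = V r y') \<Longrightarrow> \<alpha> y = \<alpha> y'"
  by (rule XY.cancel_left_leg) (metis of_alg_V(2))

text \<open>
  The operators \<open>x \<mapsto> (\<theta> \<otimes> \<iota>)((r \<otimes> 1)\<alpha>(x))\<close> from \<open>X\<close> to \<open>A\<close> are right colinear, which is what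
  remains of coassociativity after slicing the first leg (\<open>coassoc_slice_V\<close>).
\<close>

definition slice_V :: "('x \<Rightarrow> 'k) \<Rightarrow> 'x \<Rightarrow> 'x \<Rightarrow> 'a" where "slice_V \<theta> r y = XY.left_slice \<theta> (V r y)"

definition left_map :: "('x \<Rightarrow> 'a) \<Rightarrow> 'xa \<Rightarrow> 'aa" where
  "left_map f = tensor_lift sXA sAA tXA (\<lambda>x c. tAA (f x) c)"

lemma lin_slice_V: "lin sX (*) \<theta> \<Longrightarrow> lin sX sA (slice_V \<theta> r)"
  unfolding slice_V_def
  by (rule linI) (simp_all add: V_simps XY.A.vector_space_axioms XY.B.vector_space_axioms)

lemma bilin_left_map: "lin sX sA f \<Longrightarrow> bilin sX sA sAA (\<lambda>x c. tAA (f x) c)"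
  by (rule bilinI) (simp_all add: lin_vs lin_add[of _ _ f] lin_scale[of _ _ f] YZ.tens_simps YZ.T.vector_space_axioms
     XY.B.vector_space_axioms XY.A.vector_space_axioms)

lemma left_map_simps [simp]:
  assumes "lin sX sA f"
  shows "left_map f (tXA x c) = tAA (f x) c" "left_map f (z + z') = left_map f z + left_map f z'"
  unfolding left_map_def by (simp_all add: XY.tensor_lift(2)[OF bilin_left_map[OF assms]] XY.lift_add[OF bilin_left_map[OF assms]])

abbreviation \<alpha>\<iota> where "\<alpha>\<iota> \<equiv> hom_tensor sXA tXA sXAA tXA_A \<alpha> of_alg"
abbreviation \<iota>\<Delta> where "\<iota>\<Delta> \<equiv> hom_tensor sXA tXA sXAA tX_AA of_alg \<Delta>"

lemmas bilin_\<alpha>\<iota> = XY_Z.bilin_mult_tensor[OF lin_\<alpha> lin_of_alg[OF XY.B.nondeg_algebra_axioms]]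
lemmas bilin_\<iota>\<Delta> = X_YZ.bilin_mult_tensor[OF lin_of_alg[OF XY.A.nondeg_algebra_axioms] lin_\<Delta>]

lemma \<alpha>\<iota>_simps: "\<alpha>\<iota> (tXA x a) = mult_tensor tXA_A (\<alpha> x) (of_alg a)" "\<alpha>\<iota> (z + z') = \<alpha>\<iota> z + \<alpha>\<iota> z'"
  unfolding hom_tensor_def by (simp_all add: XY.tensor_lift(2)[OF bilin_\<alpha>\<iota>] XY.lift_add[OF bilin_\<alpha>\<iota>])

lemma \<iota>\<Delta>_simps: "\<iota>\<Delta> (tXA x a) = mult_tensor tX_AA (of_alg x) (\<Delta> a)" "\<iota>\<Delta> (z + z') = \<iota>\<Delta> z + \<iota>\<Delta> z'"
  unfolding hom_tensor_def by (simp_all add: XY.tensor_lift(2)[OF bilin_\<iota>\<Delta>] XY.lift_add[OF bilin_\<iota>\<Delta>])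

lemma \<iota>\<Delta>_mult: "\<iota>\<Delta> (z * z') = \<iota>\<Delta> z * \<iota>\<Delta> z'"
proof (induction z rule: XY.tens_induct)
  case (tens x a)
  show ?case
    by (induction z' rule: XY.tens_induct)
      (simp_all add: XY.tens_mult \<iota>\<Delta>_simps X_YZ.mult_tensor_times of_alg_mult \<Delta>_mult algebra_simps)
qed (simp add: algebra_simps \<iota>\<Delta>_simps)

lemma \<iota>\<Delta>_left: "\<iota>\<Delta> (lmul (mult_tensor tXA (of_alg r) 1) z) = mult_tensor tX_AA (of_alg r) 1 * \<iota>\<Delta> z"
  by (induction z rule: XY.tens_induct)
    (simp_all add: lmul_add \<iota>\<Delta>_simps X_YZ.mult_tensor_times of_alg_mult algebra_simps)

lemma first_leg_assoc:
  "mult_tensor tX_AA (of_alg r) 1 = mult_tensor tXA_A (mult_tensor tXA (of_alg r) 1) 1"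
proof (rule XY_Z.mult_tensor_unique)
  fix z c
  show "lmul (mult_tensor tX_AA (of_alg r) 1) (tXA_A z c) =
      tXA_A (lmul (mult_tensor tXA (of_alg r) 1) z) (lmul 1 c)"
    by (induction z rule: XY.tens_induct) (simp_all add: XY_Z.tens_simps lmul_add tens_assoc)
  show "rmul (mult_tensor tX_AA (of_alg r) 1) (tXA_A z c) =
      tXA_A (rmul (mult_tensor tXA (of_alg r) 1) z) (rmul 1 c)"
    by (induction z rule: XY.tens_induct) (simp_all add: XY_Z.tens_simps rmul_add tens_assoc)
qed

lemma third_leg_assoc:
  "mult_tensor tXA_A 1 (of_alg d) = mult_tensor tX_AA 1 (mult_tensor tAA 1 (of_alg d))"
proof (rule X_YZ.mult_tensor_unique)
  fix x w
  show "lmul (mult_tensor tXA_A 1 (of_alg d)) (tX_AA x w) =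
      tX_AA (lmul 1 x) (lmul (mult_tensor tAA 1 (of_alg d)) w)"
    by (induction w rule: YZ.tens_induct) (simp_all add: X_YZ.tens_simps lmul_add tens_assoc[symmetric])
  show "rmul (mult_tensor tXA_A 1 (of_alg d)) (tX_AA x w) =
      tX_AA (rmul 1 x) (rmul (mult_tensor tAA 1 (of_alg d)) w)"
    by (induction w rule: YZ.tens_induct) (simp_all add: X_YZ.tens_simps rmul_add tens_assoc[symmetric])
qed

lemma lmul_\<Delta>_induct:
  assumes "\<And>x y. P x \<Longrightarrow> P y \<Longrightarrow> P (x + y)" "\<And>a z. P (lmul (\<Delta> a) z)"
  shows "P z"
proof -
  have "z \<in> YZ.T.span {lmul (\<Delta> a) z | a z. True}" using \<Delta>_nondeg by simp
  then show ?thesis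
  proof (induction z rule: YZ.T.span_induct_alt)
    case base
    show ?case using assms(2)[of 0 0] lmul_add[of "\<Delta> 0" 0 0] by simp
  next
    case (step c x y)
    then obtain a w where "x = lmul (\<Delta> a) w" by auto
    then have "sAA c x = lmul (\<Delta> a) (sAA c w)" by simp
    with step assms show ?case by metis
  qed
qed

text \<open>
  As \<open>\<Delta>(A)(A \<otimes> A) = A \<otimes> A\<close>, the hypothesis says that \<open>m\<close> and \<open>m'\<close> agree on \<open>XX \<otimes> A \<otimes> A\<close>;
  non-degeneracy removes the second factor \<open>X\<close>.
\<close>

lemma cancel_\<iota>\<Delta>:
  assumes *: "\<And>z. m * \<iota>\<Delta> z = m' * \<iota>\<Delta> z"
  shows "m = m'"
proof (rule XY_Z.T.multiplier_cancel_right)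
  have 1: "lmul m (tX_AA (s * s') w) = lmul m' (tX_AA (s * s') w)" for s s' w
  proof (induction w rule: lmul_\<Delta>_induct)
    case (2 a w)
    have "lmul (m * \<iota>\<Delta> (tXA s a)) (tX_AA s' w) = lmul (m' * \<iota>\<Delta> (tXA s a)) (tX_AA s' w)"
      by (simp only: *)
    then show ?case by (simp add: \<iota>\<Delta>_simps)
  qed (simp add: X_YZ.tens_simps lmul_add)
  have 2: "lmul m (tX_AA s w) = lmul m' (tX_AA s w)" for s w
  proof (rule XY_Z.T.cancel_right)
    fix u show "lmul m (tX_AA s w) * u = lmul m' (tX_AA s w) * u"
      by (induction u rule: X_YZ.tens_induct)
        (simp_all add: algebra_simps lmul_mult[symmetric] X_YZ.tens_mult 1)
  qed
  show "m * of_alg z = m' * of_alg z" for z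
    by (induction z rule: X_YZ.tens_induct) (simp_all add: of_alg_lmul[symmetric] 2 lmul_add of_alg_add distrib_left)
qed

text \<open>
  These are the two sides of coassociativity, multiplied by \<open>p \<otimes> 1 \<otimes> 1\<close> from the left and by
  \<open>1 \<otimes> 1 \<otimes> d\<close> from either side, and sliced in the first leg: for the common value \<open>n\<close> of both sides,
  \<open>(p \<otimes> 1 \<otimes> 1)n\<close> is \<open>(\<iota> \<otimes> \<Delta>)((p \<otimes> 1)\<alpha>(y))\<close>, while \<open>n(1 \<otimes> 1 \<otimes> d)\<close> is
  \<open>(\<alpha> \<otimes> \<iota>)(\<alpha>(y)(1 \<otimes> d))\<close>.
\<close>

lemma coassoc_slice_V:
  assumes \<theta>: "lin sX (*) \<theta>"
  shows "T1 (slice_V \<theta> p y) d = left_map (slice_V \<theta> p) (G y d)" "T4 d (slice_V \<theta> p y) = left_map (slice_V \<theta> p) (H d y)"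
proof -
  let ?p = "mult_tensor tX_AA (of_alg p) 1" and ?d = "mult_tensor tXA_A 1 (of_alg d)"
  obtain n where nG: "n * ?d = \<alpha>\<iota> (G y d)" and nH: "?d * n = \<alpha>\<iota> (H d y)" and n: "extends_to \<iota>\<Delta> (\<alpha> y) n"
    using coassoc of_alg_V(1)[of y d] of_alg_V(3)[of d y] unfolding coassociative_def Let_def by metis
  have n_iD: "n * \<iota>\<Delta> z = \<iota>\<Delta> (lmul (\<alpha> y) z)" for z using n by (simp add: extends_to_def)
  have pn: "?p * n = \<iota>\<Delta> (V p y)"
  proof (rule cancel_\<iota>\<Delta>)
    fix z
    have "?p * n * \<iota>\<Delta> z = \<iota>\<Delta> (lmul (mult_tensor tXA (of_alg p) 1) (lmul (\<alpha> y) z))"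
      by (simp add: mult.assoc n_iD \<iota>\<Delta>_left)
    also have "lmul (mult_tensor tXA (of_alg p) 1) (lmul (\<alpha> y) z) = V p y * z"
      by (metis lmul_of_alg lmul_simps(4) of_alg_V(2))
    finally show "?p * n * \<iota>\<Delta> z = \<iota>\<Delta> (V p y) * \<iota>\<Delta> z" by (simp add: \<iota>\<Delta>_mult)
  qed
  \<comment> \<open>\<open>L = \<theta> \<otimes> \<iota> \<otimes> \<iota>\<close>\<close>
  define L where "L = X_YZ.left_slice \<theta>"
  have L: "L (tX_AA x w) = sAA (\<theta> x) w" "L (u + u') = L u + L u'" for x w u u'
    by (simp_all add: L_def \<theta>)
  have L': "L (tXA_A z c) = tAA (XY.left_slice \<theta> z) c" for z c
    by (induction z rule: XY.tens_induct) (simp_all add: L \<theta> tens_assoc XY_Z.tens_simps YZ.tens_simps)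
  let ?B = "\<lambda>x c. tXA_A (V p x) c"
  have B: "bilin sX sA sXAA ?B"
    by (rule bilinI) (simp_all add: V_simps XY_Z.tens_simps XY.A.vector_space_axioms
        XY.B.vector_space_axioms XY_Z.T.vector_space_axioms)
  let ?L = "tensor_lift sXA sXAA tXA ?B"
  note Ls = XY.tensor_lift(2)[OF B] XY.lift_add[OF B]
  have p\<alpha>\<iota>: "?p * \<alpha>\<iota> z = of_alg (?L z)" for z
    by (induction z rule: XY.tens_induct)
      (simp_all add: Ls \<alpha>\<iota>_simps first_leg_assoc XY_Z.mult_tensor_times of_alg_V(2)[symmetric]
        XY_Z.of_alg_tens distrib_left of_alg_add)
  have LL: "L (?L z) = left_map (slice_V \<theta> p) z" for z
    by (induction z rule: XY.tens_induct) (simp_all add: Ls L L' lin_slice_V \<theta> slice_V_def[symmetric])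
  have t1: "bilin sX sA sXAA (\<lambda>x a. tX_AA x (T1 a d))" "bilin sX sA sXAA (\<lambda>x a. tX_AA x (T4 d a))"
    by (rule bilinI; simp add: T1_simps T4_simps X_YZ.tens_simps XY.A.vector_space_axioms
        XY.B.vector_space_axioms XY_Z.T.vector_space_axioms)+
  note ts = XY.tensor_lift(2)[OF t1(1)] XY.lift_add[OF t1(1)] XY.tensor_lift(2)[OF t1(2)] XY.lift_add[OF t1(2)]
  have r: "\<iota>\<Delta> z * ?d = of_alg (tensor_lift sXA sXAA tXA (\<lambda>x a. tX_AA x (T1 a d)) z)"
    "?d * \<iota>\<Delta> z = of_alg (tensor_lift sXA sXAA tXA (\<lambda>x a. tX_AA x (T4 d a)) z)" for z
    by (induction z rule: XY.tens_induct;
      simp add: ts \<iota>\<Delta>_simps third_leg_assoc X_YZ.mult_tensor_times of_alg_T[symmetric] X_YZ.of_alg_tens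
        distrib_left distrib_right of_alg_add)+
  have rs: "L (tensor_lift sXA sXAA tXA (\<lambda>x a. tX_AA x (T1 a d)) z) = T1 (XY.left_slice \<theta> z) d"
    "L (tensor_lift sXA sXAA tXA (\<lambda>x a. tX_AA x (T4 d a)) z) = T4 d (XY.left_slice \<theta> z)" for z
    by (induction z rule: XY.tens_induct; simp add: ts L T1_simps T4_simps \<theta>)+
  have comm: "?p * ?d = ?d * ?p"
    by (simp add: first_leg_assoc XY_Z.mult_tensor_times)
  have "of_alg (tensor_lift sXA sXAA tXA (\<lambda>x a. tX_AA x (T1 a d)) (V p y)) = of_alg (?L (G y d))"
    by (simp only: r[symmetric] pn[symmetric] p\<alpha>\<iota>[symmetric] nG[symmetric] mult.assoc)
  then show "T1 (slice_V \<theta> p y) d = left_map (slice_V \<theta> p) (G y d)"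
    unfolding XY_Z.T.of_alg_eq_iff slice_V_def[of \<theta> p y] rs(1)[symmetric] LL[symmetric] by (rule arg_cong)
  have "of_alg (tensor_lift sXA sXAA tXA (\<lambda>x a. tX_AA x (T4 d a)) (V p y)) = of_alg (?L (H d y))"
    by (simp only: r[symmetric] pn[symmetric] p\<alpha>\<iota>[symmetric] nH[symmetric] mult.assoc[symmetric] comm)
  then show "T4 d (slice_V \<theta> p y) = left_map (slice_V \<theta> p) (H d y)"
    unfolding XY_Z.T.of_alg_eq_iff slice_V_def[of \<theta> p y] rs(2)[symmetric] LL[symmetric] by (rule arg_cong)
qed

lemma right_slice_left_map:
  assumes "lin sA (*) \<omega>" "lin sX sA f"
  shows "YZ.right_slice \<omega> (left_map f z) = f (XY.right_slice \<omega> z)"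
  by (induction z rule: XY.tens_induct) (simp_all add: assms lin_add[OF assms(2)] lin_scale[OF assms(2)])

text \<open>
  The sliced form of \<open>(\<alpha> \<otimes> \<iota>)((x \<otimes> 1)\<alpha>(y)) = (\<alpha>(x) \<otimes> 1)(\<iota> \<otimes> \<Delta>)(\<alpha>(y))\<close>.  After multiplication by
  \<open>1 \<otimes> d\<close> from the right it follows from multiplicativity of \<open>\<alpha>\<close> and \<open>coassoc_slice_V\<close>.
\<close>

lemma coassoc_V:
  assumes \<theta>: "lin sX (*) \<theta>"
  shows "bilin sX sA sAA (\<lambda>r b. T2 b (slice_V \<theta> r y))"
    "left_map (slice_V \<theta> p) (V x y) = tensor_lift sXA sAA tXA (\<lambda>r b. T2 b (slice_V \<theta> r y)) (V p x)"
proof -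
  have E1: "slice_V \<theta> (r + r') y = slice_V \<theta> r y + slice_V \<theta> r' y" "slice_V \<theta> (sX c r) y = sA c (slice_V \<theta> r y)" for r r' c y
    by (simp_all add: slice_V_def V_simps \<theta>)
  show B: "bilin sX sA sAA (\<lambda>r b. T2 b (slice_V \<theta> r y))"
    by (rule bilinI) (simp_all add: T2_simps E1 XY.A.vector_space_axioms
        XY.B.vector_space_axioms YZ.T.vector_space_axioms)
  note Bs = XY.tensor_lift(2)[OF B] XY.lift_add[OF B]
  have "of_alg (left_map (slice_V \<theta> p) (V x y)) = of_alg (tensor_lift sXA sAA tXA (\<lambda>r b. T2 b (slice_V \<theta> r y)) (V p x))"
  proof (rule YZ.cancel_right_leg)
    fix d
    have 1: "left_map f (rmul (mult_tensor tXA 1 (of_alg d)) z) = rmul (mult_tensor tAA 1 (of_alg d)) (left_map f z)"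
      if "lin sX sA f" for f z
      by (induction z rule: XY.tens_induct) (simp_all add: that rmul_add)
    have b3: "bilin sX sA sAA (\<lambda>r b. tAA (b * slice_V \<theta> r x') c)" for x' c
      by (rule bilinI) (simp_all add: E1 algebra_simps YZ.tens_simps XY.A.vector_space_axioms
        XY.B.vector_space_axioms YZ.T.vector_space_axioms XY.B.mult_scale_left XY.B.mult_scale_right)
    have b2: "bilin sX sA sAA (\<lambda>r b. lmul (mult_tensor tAA (of_alg b) 1) (left_map (slice_V \<theta> r) z))" for z
    proof (induction z rule: XY.tens_induct)
      case (add z z')
      show ?case using XY.lift_plus(1)[OF add] by (simp add: left_map_simps(2)[OF lin_slice_V[OF \<theta>]] lmul_add)
    next
      case (tens x' c)
      show ?case by (simp add: lin_slice_V \<theta> b3)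
    qed
    have Ex: "slice_V \<theta> p (x * y') = tensor_lift sXA sA tXA (\<lambda>r b. b * slice_V \<theta> r y') (V p x)"
      "bilin sX sA sA (\<lambda>r b. b * slice_V \<theta> r y')" for y'
    proof -
      show B': "bilin sX sA sA (\<lambda>r b. b * slice_V \<theta> r y')"
        by (rule bilinI) (simp_all add: E1 algebra_simps XY.A.vector_space_axioms
          XY.B.vector_space_axioms XY.B.mult_scale_left XY.B.mult_scale_right)
      have "XY.left_slice \<theta> (rmul (\<alpha> y') z) = tensor_lift sXA sA tXA (\<lambda>r b. b * slice_V \<theta> r y') z" for z
      proof (induction z rule: XY.tens_induct)
        case (tens r b)
        have "rmul (\<alpha> y') (tXA r b) = lmul (mult_tensor tXA 1 (of_alg b)) (V r y')"
          by (subst XY.T.of_alg_eq_iff[symmetric])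
            (simp add: of_alg_rmul of_alg_lmul of_alg_V XY.of_alg_tens mult.assoc[symmetric] XY.mult_tensor_times)
        then show ?case
          by (simp add: XY.tensor_lift(2)[OF B'] slice_V_def[symmetric] XY.left_slice_mult_right_leg \<theta>)
      qed (simp add: rmul_add \<theta> XY.lift_add[OF B'])
      then show "slice_V \<theta> p (x * y') = tensor_lift sXA sA tXA (\<lambda>r b. b * slice_V \<theta> r y') (V p x)"
        by (simp add: slice_V_def[of _ p] V_times)
    qed
    have 2: "left_map (slice_V \<theta> p) (lmul (mult_tensor tXA (of_alg x) 1) z) =
        tensor_lift sXA sAA tXA (\<lambda>r b. lmul (mult_tensor tAA (of_alg b) 1) (left_map (slice_V \<theta> r) z)) (V p x)" for z
    proof (induction z rule: XY.tens_induct)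
      case (add z z')
      show ?case using add
        by (simp add: lmul_add left_map_simps(2)[OF lin_slice_V[OF \<theta>]] XY.lift_plus(2)[OF b2 b2])
    next
      case (tens y' c)
      have "tAA (tensor_lift sXA sA tXA (\<lambda>r b. b * slice_V \<theta> r y') w) c =
         tensor_lift sXA sAA tXA (\<lambda>r b. tAA (b * slice_V \<theta> r y') c) w" for w
        by (induction w rule: XY.tens_induct)
          (simp_all add: XY.tensor_lift(2)[OF b3] XY.lift_add[OF b3] XY.tensor_lift(2)[OF Ex(2)] XY.lift_add[OF Ex(2)]
             YZ.tens_simps)
      then show ?case by (simp add: lin_slice_V \<theta> Ex(1))
    qed
    have "rmul (mult_tensor tAA 1 (of_alg d)) (left_map (slice_V \<theta> p) (V x y)) = left_map (slice_V \<theta> p) (rmul (mult_tensor tXA 1 (of_alg d)) (V x y))"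
      by (simp add: 1 lin_slice_V \<theta>)
    also have "\<dots> = left_map (slice_V \<theta> p) (lmul (mult_tensor tXA (of_alg x) 1) (G y d))" by (simp only: V_right)
    also have "\<dots> = tensor_lift sXA sAA tXA (\<lambda>r b. lmul (mult_tensor tAA (of_alg b) 1) (left_map (slice_V \<theta> r) (G y d))) (V p x)"
      by (rule 2)
    also have "\<dots> = rmul (mult_tensor tAA 1 (of_alg d)) (tensor_lift sXA sAA tXA (\<lambda>r b. T2 b (slice_V \<theta> r y)) w)"
      if "w = V p x" for w
      unfolding that[symmetric]
    proof (induction w rule: XY.tens_induct)
      case (tens r b)
      have "lmul (mult_tensor tAA (of_alg b) 1) (T1 a d) = rmul (mult_tensor tAA 1 (of_alg d)) (T2 b a)" for a
        by (subst YZ.T.of_alg_eq_iff[symmetric]) (simp add: of_alg_lmul of_alg_rmul of_alg_T mult.assoc)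
      then show ?case
        unfolding XY.tensor_lift(2)[OF b2] XY.tensor_lift(2)[OF B]
        by (simp add: coassoc_slice_V(1)[OF \<theta>, symmetric])
    qed (simp add: XY.lift_add[OF b2] XY.lift_add[OF B] rmul_add)
    finally have "rmul (mult_tensor tAA 1 (of_alg d)) (left_map (slice_V \<theta> p) (V x y)) =
        rmul (mult_tensor tAA 1 (of_alg d)) (tensor_lift sXA sAA tXA (\<lambda>r b. T2 b (slice_V \<theta> r y)) (V p x))" by simp
    then show "of_alg (left_map (slice_V \<theta> p) (V x y)) * mult_tensor tAA 1 (of_alg d) =
        of_alg (tensor_lift sXA sAA tXA (\<lambda>r b. T2 b (slice_V \<theta> r y)) (V p x)) * mult_tensor tAA 1 (of_alg d)"
      by (simp only: of_alg_rmul[symmetric])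
  qed
  then show "left_map (slice_V \<theta> p) (V x y) = tensor_lift sXA sAA tXA (\<lambda>r b. T2 b (slice_V \<theta> r y)) (V p x)"
    by (simp only: YZ.T.of_alg_eq_iff)
qed

end

section \<open>The counit\<close>

context regular_multiplier_hopf_algebra
begin

interpretation T: tensor_algebra3 sA sA sA sAA tAA sAA tAA sAAA tAA_A tA_AA by (rule tensor_powers)

lemma lin_comult: "lin sA (mult_scale sAA) \<Delta>"
  using comult_hom by (simp add: hom_into_multipliers_def)

lemmas legs = lin_first_leg[OF T.XY.tensor_algebra_axioms] lin_second_leg[OF T.XY.tensor_algebra_axioms]

lemmas bij_T_lift =
  T.XY.bij_lift[OF T.XY.nondeg_algebra_T bilin_times[OF T.XY.nondeg_algebra_T lin_comult legs(2)] bij_T1, folded right2_def]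
  T.XY.bij_lift[OF T.XY.nondeg_algebra_T bilin_times[OF T.XY.nondeg_algebra_T legs(1) lin_comult] bij_T2, folded left1_def]
  T.XY.bij_lift[OF T.XY.nondeg_algebra_T bilin_times[OF T.XY.nondeg_algebra_T lin_comult legs(1)] bij_T3, folded right1_def]
  T.XY.bij_lift[OF T.XY.nondeg_algebra_T bilin_times[OF T.XY.nondeg_algebra_T legs(2) lin_comult] bij_T4, folded left2_def]

lemma covered: "covered_coaction sA sA sAA tAA sAA tAA sAAA tAA_A tA_AA \<Delta> \<Delta>"
  by (intro covered_coaction.intro covered_coaction_axioms.intro)
    (use T.tensor_algebra3_axioms comult_hom comult_nondeg_left comult_coassoc
      bij_T_lift(1,4,10) in \<open>simp_all add: rangeI flip: bij_T_lift(1,4,10)\<close>)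

end

sublocale regular_multiplier_hopf_algebra \<subseteq> AA: tensor_algebra sA sA sAA tAA
  using covered by (simp add: covered_coaction_def tensor_algebra3_def)

sublocale regular_multiplier_hopf_algebra \<subseteq> A: covered_coaction sA sA sAA tAA sAA tAA sAAA tAA_A tA_AA \<Delta> \<Delta>
  by (rule covered)

context regular_multiplier_hopf_algebra
begin

abbreviation T1 where "T1 \<equiv> right2 tAA \<Delta>"
abbreviation T2 where "T2 \<equiv> left1 tAA \<Delta>"
abbreviation T3 where "T3 \<equiv> right1 tAA \<Delta>"
abbreviation T4 where "T4 \<equiv> left2 tAA \<Delta>"
abbreviation m1 where "m1 a \<equiv> mult_tensor tAA (of_alg a) 1"
abbreviation m2 where "m2 a \<equiv> mult_tensor tAA 1 (of_alg a)"

lemmas of_alg_T1 = bij_T_lift(1) and of_alg_T2 = bij_T_lift(4) and of_alg_T3 = bij_T_lift(7)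
  and of_alg_T4 = bij_T_lift(10)
lemmas bilin_T3 = bij_T_lift(8)
lemmas T3_simps = bilinD(4-7)[OF bilin_T3]
lemmas T1_induct = AA.surj_lift_induct[OF bij_T_lift(2) bij_is_surj[OF bij_T_lift(3)]]
lemmas T2_induct = AA.surj_lift_induct[OF bij_T_lift(5) bij_is_surj[OF bij_T_lift(6)]]
lemmas T3_induct = AA.surj_lift_induct[OF bij_T_lift(8) bij_is_surj[OF bij_T_lift(9)]]
lemmas T4_induct = AA.surj_lift_induct[OF bij_T_lift(11) bij_is_surj[OF bij_T_lift(12)]]

abbreviation T1h where "T1h \<equiv> tensor_lift sAA sAA tAA T1"
abbreviation T2h where "T2h \<equiv> tensor_lift sAA sAA tAA T2"
abbreviation T4h where "T4h \<equiv> tensor_lift sAA sAA tAA T4"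
abbreviation J1 where "J1 \<equiv> inv T1h"
abbreviation J2 where "J2 \<equiv> inv T2h"
abbreviation J4 where "J4 \<equiv> inv T4h"

lemma lin_inv:
  assumes "lin s t f" "bij f" shows "lin t s (inv f)"
  using assms(2)
  by (intro linI lin_vs[OF assms(1)])
    (metis assms bij_inv_eq_iff lin_add, metis assms bij_inv_eq_iff lin_scale)

lemmas lin_J = 
  lin_inv[OF AA.tensor_lift(1)[OF bij_T_lift(2)] bij_T_lift(3)]
  lin_inv[OF AA.tensor_lift(1)[OF bij_T_lift(5)] bij_T_lift(6)]
  lin_inv[OF AA.tensor_lift(1)[OF bij_T_lift(11)] bij_T_lift(12)]

lemmas Th_simps [simp] =
  AA.tensor_lift(2)[OF bij_T_lift(2)] AA.lift_add[OF bij_T_lift(2)]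
  AA.tensor_lift(2)[OF bij_T_lift(5)] AA.lift_add[OF bij_T_lift(5)]
  AA.tensor_lift(2)[OF bij_T_lift(11)] AA.lift_add[OF bij_T_lift(11)]

lemmas J_simps [simp] =
  lin_add[OF lin_J(1)] lin_add[OF lin_J(2)] lin_add[OF lin_J(3)]
  lin_scale[OF lin_J(1)] lin_scale[OF lin_J(2)] lin_scale[OF lin_J(3)]
  inv_f_f[OF bij_is_inj[OF bij_T_lift(3)]] inv_f_f[OF bij_is_inj[OF bij_T_lift(6)]] inv_f_f[OF bij_is_inj[OF bij_T_lift(12)]]
  surj_f_inv_f[OF bij_is_surj[OF bij_T_lift(3)]] surj_f_inv_f[OF bij_is_surj[OF bij_T_lift(6)]]
  surj_f_inv_f[OF bij_is_surj[OF bij_T_lift(12)]]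

lemma J_T [simp]: "J1 (T1 a b) = tAA a b" "J2 (T2 a b) = tAA a b" "J4 (T4 a b) = tAA a b"
  using J_simps(7)[of "tAA a b"] J_simps(8)[of "tAA a b"] J_simps(9)[of "tAA a b"] by simp_all

lemmas T_simps = A.T1_simps A.T2_simps T3_simps A.T4_simps

lemma T1_left: "lmul (m1 c) (T1 a d) = rmul (m2 d) (T2 c a)"
  and T3_left: "lmul (m1 c) (T3 a d) = rmul (m1 d) (T2 c a)"
  and T3_right: "rmul (m2 d) (T3 a c) = rmul (m1 c) (T1 a d)"
  and T4_left: "lmul (m1 c) (T4 d a) = lmul (m2 d) (T2 c a)"
  and T2_\<Delta>: "rmul (\<Delta> b) (T2 c a) = T2 c (a * b)"
  and T4_\<Delta>: "rmul (\<Delta> b) (T4 c a) = T4 c (a * b)"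
  and T3_\<Delta>: "lmul (\<Delta> b) (T3 a c) = T3 (b * a) c"
  and T2_left: "lmul (m1 b) (T2 c a) = T2 (b * c) a"
  and T4_left2: "lmul (m2 b) (T4 c a) = T4 (b * c) a"
  and tens_\<Delta>: "rmul (\<Delta> b) (tAA p q) = lmul (m2 q) (T2 p b)"
  and tens_\<Delta>': "rmul (\<Delta> b) (tAA p q) = lmul (m1 p) (T4 q b)"
  by (subst AA.T.of_alg_eq_iff[symmetric],
      simp add: of_alg_lmul of_alg_rmul of_alg_T1 of_alg_T2 of_alg_T3 of_alg_T4 AA.of_alg_tens of_alg_mult
        A.\<Delta>_mult AA.mult_tensor_times mult.assoc[symmetric];
      simp add: mult.assoc AA.mult_tensor_times)+

abbreviation mm where "mm \<equiv> tensor_lift sAA sA tAA (\<lambda>x y. x * y)"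

lemma bilin_mm: "bilin sA sA sA (\<lambda>x y. x * y)"
  by (rule bilinI) (simp_all add: AA.A.vector_space_axioms algebra_simps AA.A.mult_scale_left AA.A.mult_scale_right)

lemmas mm_simps [simp] = AA.tensor_lift(2)[OF bilin_mm] AA.lift_add[OF bilin_mm]

lemma is_counit_iff:
  "is_counit sA sAA tAA \<Delta> \<epsilon> \<longleftrightarrow> lin sA (*) \<epsilon> \<and> (\<forall>a b. \<epsilon> (a * b) = \<epsilon> a * \<epsilon> b) \<and>
     (\<forall>a b. AA.left_slice \<epsilon> (T1 a b) = a * b) \<and> (\<forall>a b. AA.right_slice \<epsilon> (T2 a b) = a * b)"
proof -
  have "of_alg z = \<Delta> a * m2 b \<longleftrightarrow> z = T1 a b" "of_alg z = m1 a * \<Delta> b \<longleftrightarrow> z = T2 a b" for z a b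
    by (simp_all only: of_alg_T1[symmetric] of_alg_T2[symmetric] AA.T.of_alg_eq_iff)
  then show ?thesis by (simp add: is_counit_def AA.left_slice_def AA.right_slice_def)
qed

text \<open>
  Van Daele's construction.  With \<open>m\<close> the multiplication, colinearity of \<open>slice_V\<close> shows that
  \<open>m(T1\<^sup>-\<^sup>1(q \<otimes> b))\<close> is a scalar multiple of \<open>b\<close> for \<open>q = (\<theta> \<otimes> \<iota>)((c \<otimes> 1)\<Delta>(a))\<close>, the scalar being
  \<open>\<theta>(ca)\<close>.  Since such \<open>q\<close> span \<open>A\<close>, the scalar defines a functional \<open>\<epsilon>\<close> on all of \<open>A\<close>.
\<close>

lemma ex_counit: "\<exists>\<epsilon>. is_counit sA sAA tAA \<Delta> \<epsilon>"
proof -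
  obtain p0 :: 'a where "p0 \<noteq> 0" using AA.A.nonzero by blast
  then obtain \<theta>0 where \<theta>0: "lin sA (*) \<theta>0" "\<theta>0 p0 = 1" using AA.A.separating_functional by blast
  define \<epsilon> where "\<epsilon> q = \<theta>0 (mm (J2 (tAA p0 q)))" for q
  have lin_\<epsilon>: "lin sA (*) \<epsilon>"
    unfolding \<epsilon>_def
    by (rule linI) (simp_all add: AA.A.vector_space_axioms vector_space_self AA.tens_simps
      AA.lift_scale[OF bilin_mm] lin_add[OF \<theta>0(1)] lin_scale[OF \<theta>0(1)])
  have J1_E: "mm (J1 (tAA (A.slice_V \<theta> c a) b)) = sA (\<theta> (c * a)) b" if \<theta>: "lin sA (*) \<theta>" for \<theta> c a b
  proof -
    note E = A.lin_slice_V[OF \<theta>]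
    have 1: "T1h (A.left_map (A.slice_V \<theta> c) z) = A.left_map (A.slice_V \<theta> c) (T1h z)" for z
      by (induction z rule: AA.tens_induct) (simp_all add: E A.coassoc_slice_V(1)[OF \<theta>])
    have 2: "mm (A.left_map (A.slice_V \<theta> c) z) = AA.left_slice \<theta> (lmul (m1 c) (T1h z))" for z
      by (induction z rule: AA.tens_induct)
        (simp_all add: E \<theta> lmul_add T1_left AA.left_slice_mult_right_leg A.slice_V_def[symmetric])
    have "J1 (tAA (A.slice_V \<theta> c a) b) = A.left_map (A.slice_V \<theta> c) (J1 (tAA a b))"
      using 1[of "J1 (tAA a b)"] J_simps(7)[of "A.left_map (A.slice_V \<theta> c) (J1 (tAA a b))"] by (simp add: E)
    then show ?thesis by (simp add: 2 \<theta>)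
  qed
  have "mm (J1 (tAA (AA.left_slice \<theta>0 (T2h t)) b)) = sA (\<theta>0 (mm t)) b" for t b
    by (induction t rule: AA.tens_induct)
      (simp_all add: \<theta>0 AA.tens_simps lin_add[OF \<theta>0(1)] AA.A.scale_left_distrib J1_E A.slice_V_def[symmetric])
  from this[of "J2 (tAA p0 q)" b for q b] have key: "mm (J1 (tAA q b)) = sA (\<epsilon> q) b" for q b
    by (simp add: \<theta>0 \<epsilon>_def)
  have "AA.left_slice \<epsilon> z = mm (J1 z)" for z
    by (induction z rule: AA.tens_induct) (simp_all add: lin_\<epsilon> key)
  then have law1: "AA.left_slice \<epsilon> (T1 a b) = a * b" for a b by simp
  have law2: "AA.right_slice \<epsilon> (T2 c a) = c * a" for c a
  proof (rule AA.A.functionals_separate)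
    fix \<theta> assume \<theta>: "lin sA (*) \<theta>"
    have "sA (\<epsilon> (A.slice_V \<theta> c a)) p0 = sA (\<theta> (c * a)) p0" using key J1_E[OF \<theta>] by metis
    then have "\<epsilon> (A.slice_V \<theta> c a) = \<theta> (c * a)" using \<open>p0 \<noteq> 0\<close> by simp
    then show "\<theta> (AA.right_slice \<epsilon> (T2 c a)) = \<theta> (c * a)"
      by (simp add: AA.slice_slice[OF \<theta> lin_\<epsilon>, symmetric] A.slice_V_def)
  qed
  \<comment> \<open>multiplicativity: evaluate \<open>\<iota> \<otimes> \<epsilon>\<close> on \<open>(p \<otimes> q)\<Delta>(b) = (1 \<otimes> q)(p \<otimes> 1)\<Delta>(b)\<close> in two ways\<close>
  have 1: "AA.right_slice \<epsilon> (rmul (\<Delta> b) z) = AA.right_slice \<epsilon> z * b" for b z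
    by (induction z rule: T2_induct) (simp_all add: lin_\<epsilon> rmul_add T2_\<Delta> law2 algebra_simps)
  have 2: "AA.right_slice \<epsilon> (lmul (m2 q) z) = sA (\<epsilon> q) (AA.right_slice \<epsilon> z)" for q z
  proof (induction z rule: T2_induct)
    case (2 p b)
    show ?case using 1[of b "tAA p q"] by (simp add: tens_\<Delta> lin_\<epsilon> law2 AA.A.mult_scale_left)
  qed (simp add: lin_\<epsilon> lmul_add AA.A.scale_right_distrib)
  have "\<epsilon> (q * r) = \<epsilon> q * \<epsilon> r" for q r
    using 2[of q "tAA p0 r"] \<open>p0 \<noteq> 0\<close> by (simp add: lin_\<epsilon>)
  with lin_\<epsilon> law1 law2 show ?thesis by (auto simp: is_counit_iff)
qed

end

locale counital_multiplier_hopf_algebra =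
  regular_multiplier_hopf_algebra sA sAA tAA sAAA tAA_A tA_AA \<Delta>
  for sA :: "'k::field \<Rightarrow> 'a::ring \<Rightarrow> 'a"
    and sAA :: "'k \<Rightarrow> 'aa::ring \<Rightarrow> 'aa" and tAA :: "'a \<Rightarrow> 'a \<Rightarrow> 'aa"
    and sAAA :: "'k \<Rightarrow> 'aaa::ring \<Rightarrow> 'aaa"
    and tAA_A :: "'aa \<Rightarrow> 'a \<Rightarrow> 'aaa" and tA_AA :: "'a \<Rightarrow> 'aa \<Rightarrow> 'aaa"
    and \<Delta> :: "'a \<Rightarrow> 'aa multiplier" +
  fixes \<epsilon> :: "'a \<Rightarrow> 'k"
  assumes counit: "is_counit sA sAA tAA \<Delta> \<epsilon>"
begin

lemma lin_\<epsilon>: "lin sA (*) \<epsilon>" and \<epsilon>_mult: "\<epsilon> (a * b) = \<epsilon> a * \<epsilon> b"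
  and left_slice_T1: "AA.left_slice \<epsilon> (T1 a b) = a * b" and right_slice_T2: "AA.right_slice \<epsilon> (T2 a b) = a * b"
  using counit by (auto simp: is_counit_iff)

lemmas \<epsilon>_simps [simp] = AA.left_slice_simps[OF lin_\<epsilon>] AA.right_slice_simps[OF lin_\<epsilon>] lin_add[OF lin_\<epsilon>] lin_scale[OF lin_\<epsilon>] \<epsilon>_mult

lemma ex_\<epsilon>_one: "\<exists>e. \<epsilon> e = 1"
proof (rule ccontr)
  assume *: "\<nexists>e. \<epsilon> e = 1"
  have "\<epsilon> a = 0" for a :: 'a
    using * lin_scale[OF lin_\<epsilon>, of "inverse (\<epsilon> a)" a] by (metis left_inverse)
  then have "\<epsilon> = (\<lambda>_. 0)" by auto
  moreover have "AA.left_slice (\<lambda>_. 0) z = 0" for z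
    using \<epsilon>_simps(1,2) unfolding \<open>\<epsilon> = (\<lambda>_. 0)\<close> by (induction z rule: AA.tens_induct) simp_all
  ultimately have "a * b = 0" for a b :: 'a using left_slice_T1[of a b] by simp
  then show False using AA.A.nonzero AA.A.nondeg_left by blast
qed

text \<open>
  A fixed element with counit \<open>1\<close>, to normalise formulas that determine an element only up to the factor
  \<open>\<epsilon>(q)\<close>.
\<close>

definition e0 where "e0 = (SOME e. \<epsilon> e = 1)"

lemma \<epsilon>_e0 [simp]: "\<epsilon> e0 = 1" unfolding e0_def by (rule someI_ex) (rule ex_\<epsilon>_one)

lemma right_slice_T3: "AA.right_slice \<epsilon> (T3 a c) = a * c"
proof (rule AA.A.cancel_left)
  fix y
  have "y * AA.right_slice \<epsilon> (T3 a c) = AA.right_slice \<epsilon> (rmul (m1 c) (T2 y a))"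
    by (simp add: T3_left[symmetric] AA.right_slice_mult_left_leg[OF lin_\<epsilon>])
  then show "y * AA.right_slice \<epsilon> (T3 a c) = y * (a * c)"
    by (simp add: AA.right_slice_mult_left_leg[OF lin_\<epsilon>] right_slice_T2 mult.assoc)
qed

lemma right_slice_right: "AA.right_slice \<epsilon> (rmul (m2 d) z) = sA (\<epsilon> d) (AA.right_slice \<epsilon> z)"
  by (induction z rule: AA.tens_induct) (simp_all add: rmul_add AA.A.scale_right_distrib mult.commute)

lemma mm_eq: "mm z = AA.right_slice \<epsilon> (T2h z)"
  by (induction z rule: AA.tens_induct) (simp_all add: right_slice_T2)

lemma mm_surj: "\<exists>z. mm z = a"
  by (rule exI[of _ "J2 (tAA a e0)"]) (simp add: mm_eq)

section \<open>The antipode\<close>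

text \<open>
  In Sweedler notation \<open>T2\<^sup>-\<^sup>1(p \<otimes> c) = p S(c\<^sub>1) \<otimes> c\<^sub>2\<close>, so \<open>mS\<close> is the map \<open>p \<otimes> c \<mapsto> p S(c)\<close>
  (\<open>mS_tens\<close>).  A left linear map such as \<open>p \<mapsto> mS (p \<otimes> c)\<close> need not be multiplication by an element
  of \<open>A\<close>; it is here, because \<open>T4\<close> takes its values in \<open>A \<otimes> A\<close>, so that \<open>(1 \<otimes> c)\<Delta>(e0)\<close> is in \<open>A \<otimes> A\<close>.
\<close>

abbreviation mS where "mS z \<equiv> AA.right_slice \<epsilon> (J2 z)"
definition S where "S c = mS (T4 c e0)"

lemma J2_left: "J2 (lmul (m1 p) z) = lmul (m1 p) (J2 z)"
  by (induction z rule: T2_induct) (simp_all add: lmul_add T2_left)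

lemma J2_\<Delta>: "J2 (rmul (\<Delta> d) z) = rmul (m2 d) (J2 z)"
  by (induction z rule: T2_induct) (simp_all add: rmul_add T2_\<Delta>)

lemma mS_left: "mS (lmul (m1 p) z) = p * mS z"
  by (simp add: J2_left AA.right_slice_mult_left_leg[OF lin_\<epsilon>])

lemma mS_\<Delta>: "mS (rmul (\<Delta> d) z) = sA (\<epsilon> d) (mS z)"
  by (simp add: J2_\<Delta> right_slice_right)

lemma mS_tens: "mS (tAA p c) = p * S c"
  using mS_\<Delta>[of e0 "tAA p c"] by (simp add: S_def mS_left[symmetric] tens_\<Delta>')

lemma mS_T4: "mS (T4 c q) = sA (\<epsilon> q) (S c)"
  by (rule AA.A.cancel_left)
    (simp add: mS_left[symmetric] tens_\<Delta>'[symmetric] mS_\<Delta> mS_tens AA.A.mult_scale_right)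

lemma lin_S: "lin sA sA S"
  unfolding S_def by (rule linI) (simp_all add: AA.A.vector_space_axioms T_simps)

lemmas S_simps [simp] = lin_add[OF lin_S] lin_scale[OF lin_S] lin_sum[OF lin_S]

text \<open>The bijection \<open>T2\<^sup>-\<^sup>1 T4\<close> of \<open>A \<otimes> A\<close> induces \<open>S\<close> on the quotient by the kernel of \<open>\<iota> \<otimes> \<epsilon>\<close>, so \<open>S\<close> is onto.\<close>

lemma S_right_slice: "S (AA.right_slice \<epsilon> z) = mS (T4h z)"
  by (induction z rule: AA.tens_induct) (simp_all add: mS_T4)

text \<open>
  The same description of the inverse map \<open>T4\<^sup>-\<^sup>1 T2\<close>, which therefore respects the kernel of
  \<open>\<iota> \<otimes> \<epsilon>\<close> as well; this makes \<open>S\<close> injective.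
\<close>

lemma J4_right_slice: "b * AA.right_slice \<epsilon> (J4 (T2h z)) = AA.right_slice \<epsilon> (J4 (tAA (AA.right_slice \<epsilon> z) b))"
proof -
  have J4_left: "J4 (lmul (m2 p) z) = lmul (m1 p) (J4 z)" for p z
    by (induction z rule: T4_induct) (simp_all add: lmul_add T4_left2)
  have J4_\<Delta>: "J4 (rmul (\<Delta> d) z) = rmul (m2 d) (J4 z)" for d z
    by (induction z rule: T4_induct) (simp_all add: rmul_add T4_\<Delta>)
  show ?thesis
  proof (induction z rule: AA.tens_induct)
    case (tens u v)
    have "b * AA.right_slice \<epsilon> (J4 (T2 u v)) = AA.right_slice \<epsilon> (J4 (lmul (m2 b) (T2 u v)))"
      by (simp add: J4_left AA.right_slice_mult_left_leg[OF lin_\<epsilon>])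
    also have "\<dots> = AA.right_slice \<epsilon> (J4 (rmul (\<Delta> v) (tAA u b)))" by (simp add: tens_\<Delta>)
    finally show ?case by (simp add: J4_\<Delta> right_slice_right AA.tens_simps)
  qed (simp add: algebra_simps AA.tens_simps)
qed

lemma S_surj: "\<exists>c. S c = s"
  using S_right_slice[of "J4 (T2 s e0)"] by auto

lemma S_inj:
  assumes "S c = S c'" shows "c = c'"
proof -
  have "d = 0" if "S d = 0" for d
  proof (rule AA.A.nondeg_right)
    fix b
    have "AA.right_slice \<epsilon> (J2 (T4 d e0)) = 0" using that by (simp add: S_def)
    moreover have "AA.right_slice \<epsilon> (J4 (tAA 0 b)) = 0"
      using AA.tens_simps(3)[of 0 0 b] by (simp add: lin_zero[OF lin_J(3)])
    ultimately show "b * d = 0" using J4_right_slice[of b "J2 (T4 d e0)"] by simp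
  qed
  from this[of "c - c'"] show ?thesis using assms lin_diff[OF lin_S, of c c'] by simp
qed

lemma S_mult: "S (a * c) = S c * S a"
proof (rule AA.A.cancel_left)
  fix p
  have "mS (lmul (m2 a) z) = mS z * S a" for z
    by (induction z rule: T2_induct)
      (simp_all add: lmul_add T4_left[symmetric] mS_left mS_T4 algebra_simps AA.A.mult_scale_left AA.A.mult_scale_right)
  from this[of "tAA p c"] show "p * S (a * c) = p * (S c * S a)"
    by (simp add: mS_tens mult.assoc)
qed

abbreviation Sm where "Sm \<equiv> tensor_lift sAA sA tAA (\<lambda>p q. S p * q)"

lemma bilin_Sm: "bilin sA sA sA (\<lambda>p q. S p * q)"
  by (rule bilinI) (simp_all add: AA.A.vector_space_axioms algebra_simps AA.A.mult_scale_left AA.A.mult_scale_right)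

lemmas Sm_simps [simp] = AA.tensor_lift(2)[OF bilin_Sm] AA.lift_add[OF bilin_Sm]

text \<open>
  This is \<open>S(a\<^sub>1)a\<^sub>2 = \<epsilon>(a)1\<close>, multiplied by \<open>d\<close>.  It comes from the formula
  \<open>p S(a\<^sub>1) \<otimes> a\<^sub>2 d = T2\<^sup>-\<^sup>1(p \<otimes> a)(1 \<otimes> d)\<close>, which is checked on the right slices, and from the fact that
  multiplication undoes \<open>T2\<^sup>-\<^sup>1\<close> up to \<open>\<iota> \<otimes> \<epsilon>\<close>.
\<close>

lemma Sm_T1: "Sm (T1 a d) = sA (\<epsilon> a) d"
proof (rule AA.A.cancel_left)
  fix p
  define z where "z = J2 (tAA p a)"
  have z: "T2h z = tAA p a" by (simp add: z_def)
  have lin_f: "lin sA sA (\<lambda>q. p * S q)"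
    by (rule linI) (simp_all add: AA.A.vector_space_axioms algebra_simps AA.A.mult_scale_right)
  have "A.left_map (\<lambda>q. p * S q) (T1 a d) = rmul (m2 d) z"
  proof (rule AA.eq_by_right_slices)
    fix \<omega> assume \<omega>: "lin sA (*) \<omega>"
    \<comment> \<open>\<open>D\<close> is left colinear, so it commutes with \<open>T2\<close> in the second leg\<close>
    define D where "D a = AA.right_slice \<omega> (T1 a d)" for a
    have D: "D (x + y) = D x + D y" "D (sA c x) = sA c (D x)" for x y c
      by (simp_all add: D_def T_simps \<omega>)
    have B: "bilin sA sA sAA (\<lambda>u v. T2 u (D v))"
      by (rule bilinI) (simp_all add: D T_simps AA.A.vector_space_axioms AA.T.vector_space_axioms)
    have "tensor_lift sAA sAA tAA (\<lambda>u v. T2 u (D v)) z = tAA p (D a)"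
    proof (rule AA.eq_by_slices)
      fix \<theta> assume \<theta>: "lin sA (*) \<theta>"
      have "AA.left_slice \<theta> (T2 u (D v)) = D (AA.left_slice \<theta> (T2 u v))" for u v
        using A.right_slice_left_map[OF \<omega> A.lin_slice_V[OF \<theta>], of u "T1 v d"] A.coassoc_slice_V(1)[OF \<theta>, of u v d]
        by (simp add: A.slice_V_def[symmetric] D_def)
      then have "AA.left_slice \<theta> (tensor_lift sAA sAA tAA (\<lambda>u v. T2 u (D v)) w) = D (AA.left_slice \<theta> (T2h w))" for w
        by (induction w rule: AA.tens_induct)
          (simp_all add: AA.tensor_lift(2)[OF B] AA.lift_add[OF B] \<theta> D)
      then show "AA.left_slice \<theta> (tensor_lift sAA sAA tAA (\<lambda>u v. T2 u (D v)) z) = AA.left_slice \<theta> (tAA p (D a))"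
        by (simp add: z \<theta> D)
    qed
    moreover have "mS (tensor_lift sAA sAA tAA (\<lambda>u v. T2 u (D v)) w) = AA.right_slice \<omega> (rmul (m2 d) w)" for w
    proof (induction w rule: AA.tens_induct)
      case (tens u v)
      have "\<epsilon> (D v) = \<omega> (v * d)" by (simp add: D_def AA.slice_slice[OF lin_\<epsilon> \<omega>, symmetric] left_slice_T1)
      then show ?case by (simp add: AA.tensor_lift(2)[OF B] \<omega>)
    qed (simp add: AA.lift_add[OF B] \<omega> rmul_add)
    ultimately have "p * S (D a) = AA.right_slice \<omega> (rmul (m2 d) z)" by (metis mS_tens)
    then show "AA.right_slice \<omega> (A.left_map (\<lambda>q. p * S q) (T1 a d)) = AA.right_slice \<omega> (rmul (m2 d) z)"
      by (simp add: A.right_slice_left_map[OF \<omega> lin_f] D_def)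
  qed
  moreover have "mm (A.left_map (\<lambda>q. p * S q) w) = p * Sm w" for w
    by (induction w rule: AA.tens_induct) (simp_all add: lin_f algebra_simps)
  moreover have "mm (rmul (m2 d) w) = mm w * d" for w
    by (induction w rule: AA.tens_induct) (simp_all add: algebra_simps rmul_add)
  ultimately have "p * Sm (T1 a d) = AA.right_slice \<epsilon> (tAA p a) * d" by (metis mm_eq z)
  then show "p * Sm (T1 a d) = p * sA (\<epsilon> a) d"
    by (simp add: AA.A.mult_scale_left AA.A.mult_scale_right)
qed

lemma Sm_T3: "Sm (T3 a c) = sA (\<epsilon> a) (S c)"
proof (rule AA.A.cancel_right)
  fix d
  have "Sm w * d = Sm (rmul (m2 d) w)" "Sm (rmul (m1 c) w) = S c * Sm w" for w
    by (induction w rule: AA.tens_induct; simp add: algebra_simps rmul_add S_mult)+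
  then have "Sm (T3 a c) * d = S c * Sm (T1 a d)" by (metis T3_right)
  then show "Sm (T3 a c) * d = sA (\<epsilon> a) (S c) * d"
    by (simp add: Sm_T1 AA.A.mult_scale_left AA.A.mult_scale_right)
qed

section \<open>Faithfulness of the left integral\<close>

lemma is_left_integral_iff:
  "is_left_integral sA sAA tAA \<Delta> \<phi> \<longleftrightarrow>
     lin sA (*) \<phi> \<and> (\<exists>a. \<phi> a \<noteq> 0) \<and> (\<forall>a b. AA.right_slice \<phi> (T3 a b) = sA (\<phi> a) b)"
proof -
  have "of_alg z = \<Delta> a * m1 b \<longleftrightarrow> z = T3 a b" for z a b
    by (simp only: of_alg_T3[symmetric] AA.T.of_alg_eq_iff)
  then show ?thesis by (simp add: is_left_integral_def AA.right_slice_def)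
qed

context
  fixes \<phi>
  assumes integral: "is_left_integral sA sAA tAA \<Delta> \<phi>"
begin

lemma lin_\<phi>: "lin sA (*) \<phi>" and \<phi>_nonzero: "\<exists>a. \<phi> a \<noteq> 0" and \<phi>_T3: "AA.right_slice \<phi> (T3 a b) = sA (\<phi> a) b"
  using integral by (auto simp: is_left_integral_iff)

text \<open>
  Left invariance with the covering element on the other side.
\<close>

lemma \<phi>_T2: "AA.right_slice \<phi> (T2 b a) = sA (\<phi> a) b"
proof (rule AA.A.cancel_right)
  fix c
  have "AA.right_slice \<phi> (T2 b a) * c = AA.right_slice \<phi> (lmul (m1 b) (T3 a c))"
    by (simp add: T3_left AA.right_slice_mult_left_leg[OF lin_\<phi>])
  then show "AA.right_slice \<phi> (T2 b a) * c = sA (\<phi> a) b * c"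
    by (simp add: AA.right_slice_mult_left_leg[OF lin_\<phi>] \<phi>_T3 AA.A.mult_scale_left AA.A.mult_scale_right)
qed

lemma \<phi>_mult_nonzero:
  assumes "\<And>c d. k * \<phi> (c * d) = 0" shows "k = 0"
proof -
  have "k * \<phi> (mm z) = 0" for z
    by (induction z rule: AA.tens_induct) (use assms in \<open>simp_all add: lin_add[OF lin_\<phi>] distrib_left del: mult_eq_0_iff\<close>)
  then have "k * \<phi> a = 0" for a using mm_surj by metis
  then show ?thesis using \<phi>_nonzero by auto
qed

lemma tens_eq: "of_alg (tAA c d) = m1 c * m2 d" "of_alg (tAA c d) = m2 d * m1 c"
  by (simp_all add: AA.of_alg_tens AA.mult_tensor_times)

text \<open>
  The set \<open>L = {a. \<phi>(Aa) = 0}\<close> is a left ideal, and invariance makes it a coideal in the sense that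
  \<open>\<Delta>(a)(c \<otimes> 1) \<in> A \<otimes> L\<close> for \<open>a \<in> L\<close>.  Hence \<open>\<epsilon>(a)S(c) = S(a\<^sub>1 c)a\<^sub>2 \<in> L\<close>, and \<open>\<epsilon>(a) \<noteq> 0\<close> would imply
  \<open>L = A\<close>.  So \<open>\<epsilon>\<close> vanishes on \<open>L\<close>, and applying \<open>\<iota> \<otimes> \<epsilon>\<close> to \<open>\<Delta>(a)(c \<otimes> 1)\<close> gives \<open>ac = 0\<close>.
\<close>

lemma integral_faithful_left:
  assumes "\<And>b. \<phi> (b * a) = 0" shows "a = 0"
proof -
  have slice: "\<phi> (d * AA.left_slice \<theta> (T3 a c)) = 0"
    if a: "\<And>b. \<phi> (b * a) = 0" and \<theta>: "lin sA (*) \<theta>" for a c d \<theta>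
  proof -
    have 1: "AA.right_slice \<phi> (z * T3 a c) = 0" for z
    proof (induction z rule: T2_induct)
      case (2 u v)
      have "T2 u v * T3 a c = lmul (m1 u) (T3 (v * a) c)"
        by (metis T3_\<Delta> lmul_of_alg lmul_simps(4) of_alg_T2)
      then show ?case by (simp add: AA.right_slice_mult_left_leg[OF lin_\<phi>] \<phi>_T3 a)
    qed (simp add: lin_\<phi> distrib_right)
    have "AA.right_slice \<phi> (lmul (m2 d) (T3 a c)) = 0"
    proof (rule AA.A.nondeg_right)
      fix c'
      have "tAA c' d * w = lmul (m1 c') (lmul (m2 d) w)" for w
        using tens_eq[of c' d] by (metis lmul_of_alg lmul_simps(4))
      then show "c' * AA.right_slice \<phi> (lmul (m2 d) (T3 a c)) = 0"
        using 1[of "tAA c' d"] by (simp add: AA.right_slice_mult_left_leg[OF lin_\<phi>])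
    qed
    then have "\<theta> (AA.right_slice \<phi> (lmul (m2 d) (T3 a c))) = 0" by (simp add: lin_zero[OF \<theta>])
    then show ?thesis by (simp add: AA.slice_slice[OF \<theta> lin_\<phi>, symmetric] AA.left_slice_mult_right_leg \<theta>)
  qed
  have eps: "\<epsilon> a = 0" if a: "\<And>b. \<phi> (b * a) = 0" for a
  proof (rule \<phi>_mult_nonzero)
    fix d s
    obtain c where c: "S c = s" using S_surj by blast
    obtain I \<theta> where I: "finite I" "\<And>e. lin sA (*) (\<theta> e)" "T3 a c = (\<Sum>e\<in>I. tAA e (AA.left_slice (\<theta> e) (T3 a c)))"
      by (rule AA.slice_expansion[where z = "T3 a c"]) blast
    have "Sm (T3 a c) = (\<Sum>e\<in>I. S e * AA.left_slice (\<theta> e) (T3 a c))"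
      by (subst I(3)) (simp add: lin_sum[OF AA.tensor_lift(1)[OF bilin_Sm]])
    then have "\<phi> (d * Sm (T3 a c)) = (\<Sum>e\<in>I. \<phi> ((d * S e) * AA.left_slice (\<theta> e) (T3 a c)))"
      by (simp add: sum_distrib_left lin_sum[OF lin_\<phi>] mult.assoc)
    also have "\<dots> = 0" by (simp add: slice[OF a I(2)])
    finally show "\<epsilon> a * \<phi> (d * s) = 0"
      by (simp add: Sm_T3 c AA.A.mult_scale_right lin_scale[OF lin_\<phi>])
  qed
  show "a = 0"
  proof (rule AA.A.nondeg_left, rule AA.A.functionals_separate)
    fix c \<theta> assume \<theta>: "lin sA (*) \<theta>"
    have "\<epsilon> (AA.left_slice \<theta> (T3 a c)) = 0" by (rule eps) (rule slice[OF assms \<theta>])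
    then show "\<theta> (a * c) = \<theta> 0"
      by (simp add: AA.slice_slice[OF \<theta> lin_\<epsilon>] right_slice_T3 lin_zero[OF \<theta>])
  qed
qed

text \<open>
  Here \<open>R = {a. \<phi>(aA) = 0}\<close> is a right ideal with \<open>(c \<otimes> 1)\<Delta>(a) \<in> A \<otimes> R\<close> for \<open>a \<in> R\<close>, and the argument for
  \<open>L\<close> is repeated with \<open>\<epsilon>(a)S\<^sup>-\<^sup>1(c) = a\<^sub>2 S\<^sup>-\<^sup>1(ca\<^sub>1) \<in> R\<close>.
\<close>

lemma integral_faithful_right:
  assumes "\<And>b. \<phi> (a * b) = 0" shows "a = 0"
proof -
  have slice: "\<phi> (AA.left_slice \<theta> (T2 c a) * d) = 0"
    if a: "\<And>b. \<phi> (a * b) = 0" and \<theta>: "lin sA (*) \<theta>" for a c d \<theta>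
  proof -
    have 1: "AA.right_slice \<phi> (T2 c a * z) = 0" for z
    proof (induction z rule: T3_induct)
      case (2 v u)
      have "T2 c a * T3 v u = lmul (m1 c) (T3 (a * v) u)"
        by (metis T3_\<Delta> lmul_of_alg lmul_simps(4) of_alg_T2)
      then show ?case by (simp add: AA.right_slice_mult_left_leg[OF lin_\<phi>] \<phi>_T3 a)
    qed (simp add: lin_\<phi> distrib_left)
    have "AA.right_slice \<phi> (rmul (m2 d) (T2 c a)) = 0"
    proof (rule AA.A.nondeg_left)
      fix c'
      have "w * tAA c' d = rmul (m1 c') (rmul (m2 d) w)" for w
        using tens_eq[of c' d] by (metis rmul_of_alg rmul_simps(4))
      then show "AA.right_slice \<phi> (rmul (m2 d) (T2 c a)) * c' = 0"
        using 1[of "tAA c' d"] by (simp add: AA.right_slice_mult_left_leg[OF lin_\<phi>])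
    qed
    then have "\<theta> (AA.right_slice \<phi> (rmul (m2 d) (T2 c a))) = 0" by (simp add: lin_zero[OF \<theta>])
    then show ?thesis by (simp add: AA.slice_slice[OF \<theta> lin_\<phi>, symmetric] AA.left_slice_mult_right_leg \<theta>)
  qed
  have eps: "\<epsilon> a = 0" if a: "\<And>b. \<phi> (a * b) = 0" for a
  proof (rule \<phi>_mult_nonzero)
    fix c d
    obtain S' where S': "\<And>s. S (S' s) = s" using S_surj by metis
    obtain I \<theta> where I: "finite I" "\<And>e. lin sA (*) (\<theta> e)" "T2 (S c) a = (\<Sum>e\<in>I. tAA e (AA.left_slice (\<theta> e) (T2 (S c) a)))"
      by (rule AA.slice_expansion[where z = "T2 (S c) a"]) blast
    let ?s = "\<lambda>e. AA.left_slice (\<theta> e) (T2 (S c) a)"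
    have "mS (T2 (S c) a) = (\<Sum>e\<in>I. mS (tAA e (?s e)))"
      by (subst I(3)) (simp add: lin_sum[OF lin_J(2)])
    then have "S (\<Sum>e\<in>I. ?s e * S' e) = S (sA (\<epsilon> a) c)" by (simp add: mS_tens S_mult S')
    then have "sA (\<epsilon> a) c = (\<Sum>e\<in>I. ?s e * S' e)" by (rule S_inj[symmetric])
    then have "\<phi> (sA (\<epsilon> a) c * d) = (\<Sum>e\<in>I. \<phi> (?s e * (S' e * d)))"
      by (simp add: sum_distrib_right lin_sum[OF lin_\<phi>] mult.assoc)
    also have "\<dots> = 0" by (simp add: slice[OF a I(2)])
    finally show "\<epsilon> a * \<phi> (c * d) = 0"
      by (simp add: AA.A.mult_scale_left lin_scale[OF lin_\<phi>])
  qed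
  show "a = 0"
  proof (rule AA.A.nondeg_right, rule AA.A.functionals_separate)
    fix c \<theta> assume \<theta>: "lin sA (*) \<theta>"
    have "\<epsilon> (AA.left_slice \<theta> (T2 c a)) = 0" by (rule eps) (rule slice[OF assms \<theta>])
    then show "\<theta> (c * a) = \<theta> 0"
      by (simp add: AA.slice_slice[OF \<theta> lin_\<epsilon>] right_slice_T2 lin_zero[OF \<theta>])
  qed
qed

end

end

section \<open>The Galois map of a Galois object\<close>

locale integral_galois_object =
  counital_multiplier_hopf_algebra sA sAA tAA sAAA tAA_A tA_AA \<Delta> \<epsilon> +
  right_galois_object sA sAA tAA \<Delta> sX sXX tXX sXA tXA sXAA tXA_A tX_AA \<alpha>
  for sA :: "'k::field \<Rightarrow> 'a::ring \<Rightarrow> 'a"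
    and sAA :: "'k \<Rightarrow> 'aa::ring \<Rightarrow> 'aa" and tAA :: "'a \<Rightarrow> 'a \<Rightarrow> 'aa"
    and sAAA :: "'k \<Rightarrow> 'aaa::ring \<Rightarrow> 'aaa"
    and tAA_A :: "'aa \<Rightarrow> 'a \<Rightarrow> 'aaa" and tA_AA :: "'a \<Rightarrow> 'aa \<Rightarrow> 'aaa"
    and \<Delta> :: "'a \<Rightarrow> 'aa multiplier" and \<epsilon> :: "'a \<Rightarrow> 'k"
    and sX :: "'k \<Rightarrow> 'x::ring \<Rightarrow> 'x"
    and sXX :: "'k \<Rightarrow> 'xx::ab_group_add \<Rightarrow> 'xx" and tXX :: "'x \<Rightarrow> 'x \<Rightarrow> 'xx"
    and sXA :: "'k \<Rightarrow> 'xa::ring \<Rightarrow> 'xa" and tXA :: "'x \<Rightarrow> 'a \<Rightarrow> 'xa"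
    and sXAA :: "'k \<Rightarrow> 'xaa::ring \<Rightarrow> 'xaa"
    and tXA_A :: "'xa \<Rightarrow> 'a \<Rightarrow> 'xaa" and tX_AA :: "'x \<Rightarrow> 'aa \<Rightarrow> 'xaa"
    and \<alpha> :: "'x \<Rightarrow> 'xa multiplier" +
  fixes \<phi> :: "'a \<Rightarrow> 'k"
  assumes integral: "is_left_integral sA sAA tAA \<Delta> \<phi>"

sublocale integral_galois_object \<subseteq> XA: tensor_algebra sX sA sXA tXA
  using tensor_XAA by (simp add: tensor_algebra3_def)

sublocale integral_galois_object \<subseteq> X: covered_coaction sX sA sXA tXA sAA tAA sXAA tXA_A tX_AA \<Delta> \<alpha>
  by (intro covered_coaction.intro covered_coaction_axioms.intro)
    (rule tensor_XAA comult_hom coaction_hom comult_nondeg_left A.T1_cov A.T2_cov A.T4_cov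
      coaction_left coaction_right coaction_coassoc reduced)+

context integral_galois_object
begin

abbreviation V where "V \<equiv> left1 tXA \<alpha>"
abbreviation G where "G \<equiv> right2 tXA \<alpha>"
abbreviation H where "H \<equiv> left2 tXA \<alpha>"
abbreviation W where "W \<equiv> right1 tXA \<alpha>"
abbreviation n1 where "n1 x \<equiv> mult_tensor tXA (of_alg x) 1"
abbreviation n2 where "n2 a \<equiv> mult_tensor tXA 1 (of_alg a)"

lemmas lin_\<phi> = lin_\<phi>[OF integral]
lemmas \<phi>_slices [simp] = XA.left_slice_simps XA.right_slice_simps[OF lin_\<phi>] AA.right_slice_simps[OF lin_\<phi>] 
lemmas \<phi>_simps [simp] = lin_add[OF lin_\<phi>] lin_scale[OF lin_\<phi>]
lemmas \<epsilon>_slices [simp] = XA.right_slice_simps[OF lin_\<epsilon>]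

lemmas bij_V = XX.bij_lift[OF XA.nondeg_algebra_T X.bilin_V_multipliers(2) galois, folded left1_def]
lemmas V_induct = XX.surj_lift_induct[OF bij_V(2) bij_is_surj[OF bij_V(3)]]

lemma V_inj:
  assumes "\<And>r. V r y = V r y'" shows "y = y'"
  using X.V_eqD[OF assms] coaction_inj by (auto dest: injD)

lemma right_slice_T1: "AA.right_slice \<epsilon> (T1 a d) = sA (\<epsilon> d) a"
proof (rule AA.A.cancel_left)
  fix y
  have "y * AA.right_slice \<epsilon> (T1 a d) = AA.right_slice \<epsilon> (rmul (m2 d) (T2 y a))"
    by (simp add: T1_left[symmetric] AA.right_slice_mult_left_leg[OF lin_\<epsilon>])
  then show "y * AA.right_slice \<epsilon> (T1 a d) = y * sA (\<epsilon> d) a"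
    by (simp add: right_slice_right right_slice_T2 AA.A.mult_scale_right)
qed

text \<open>
  Injectivity of \<open>\<alpha>\<close> gives \<open>(\<iota> \<otimes> \<epsilon>)\<alpha> = \<iota>\<close>: by coassociativity both sides have the same image
  under \<open>\<alpha>\<close>.
\<close>

lemma right_slice_G: "XA.right_slice \<epsilon> (G y d) = sX (\<epsilon> d) y"
proof (rule V_inj, rule XA.eq_by_slices)
  fix r \<theta> assume \<theta>: "lin sX (*) \<theta>"
  have "XA.left_slice \<theta> (V r (XA.right_slice \<epsilon> (G y d))) = X.slice_V \<theta> r (XA.right_slice \<epsilon> (G y d))" by (simp add: X.slice_V_def)
  also have "\<dots> = AA.right_slice \<epsilon> (T1 (X.slice_V \<theta> r y) d)"
    by (simp add: X.coassoc_slice_V(1)[OF \<theta>] X.right_slice_left_map[OF lin_\<epsilon> X.lin_slice_V[OF \<theta>]])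
  finally show "XA.left_slice \<theta> (V r (XA.right_slice \<epsilon> (G y d))) = XA.left_slice \<theta> (V r (sX (\<epsilon> d) y))"
    by (simp add: right_slice_T1 X.V_simps \<theta> X.slice_V_def)
qed

lemma right_slice_V: "XA.right_slice \<epsilon> (V r y) = r * y"
proof -
  have "XA.right_slice \<epsilon> (rmul (n2 d) z) = sX (\<epsilon> d) (XA.right_slice \<epsilon> z)" for d z
    by (induction z rule: XA.tens_induct) (simp_all add: rmul_add XX.V.scale_right_distrib mult.commute)
  from this[of e0 "V r y"] show ?thesis
    by (simp add: X.V_right XA.right_slice_mult_left_leg[OF lin_\<epsilon>] right_slice_G)
qed

lemma \<epsilon>_slice_V: "lin sX (*) \<theta> \<Longrightarrow> \<epsilon> (X.slice_V \<theta> r y) = \<theta> (r * y)"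
  by (simp add: X.slice_V_def XA.slice_slice lin_\<epsilon> right_slice_V)

text \<open>
  The map \<open>x \<otimes> c \<mapsto> \<alpha>(x)(1 \<otimes> S(c))\<close>.  It carries \<open>x y\<^sub>0 \<otimes> y\<^sub>1\<close> to \<open>x\<^sub>0 y\<^sub>0 \<otimes> x\<^sub>1 y\<^sub>1 S(y\<^sub>2) = x\<^sub>0 y \<otimes> x\<^sub>1\<close>,
  that is, \<open>V\<close> to the opposite Galois map \<open>W\<close>.  In particular \<open>W\<close> takes its values in \<open>X \<otimes> A\<close>.
\<close>

abbreviation twist where "twist \<equiv> tensor_lift sXA sXA tXA (\<lambda>x c. G x (S c))"

lemma bilin_twist: "bilin sX sA sXA (\<lambda>x c. G x (S c))"
  by (rule bilinI) (simp_all add: X.G_simps XX.V.vector_space_axioms AA.A.vector_space_axioms XA.T.vector_space_axioms)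

lemmas twist_simps [simp] = XA.tensor_lift(2)[OF bilin_twist] XA.lift_add[OF bilin_twist]

lemma left_slice_twist:
  assumes \<theta>: "lin sX (*) \<theta>"
  shows "XA.left_slice \<theta> (lmul (n1 p) (twist z)) = mS (X.left_map (X.slice_V \<theta> p) z)"
  by (induction z rule: XA.tens_induct)
    (simp_all add: lmul_add \<theta> X.lin_slice_V mS_tens X.V_right[symmetric] XA.left_slice_mult_right_leg X.slice_V_def[symmetric])

lemma of_alg_twist: "of_alg (twist (V x y)) = \<alpha> x * n1 y"
proof (rule XA.cancel_left_leg)
  fix p
  have "lmul (n1 p) (twist (V x y)) = rmul (n1 y) (V p x)"
  proof (rule XA.eq_by_slices)
    fix \<theta> assume \<theta>: "lin sX (*) \<theta>"
    note B = X.coassoc_V(1)[OF \<theta>]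
    have "mS (tensor_lift sXA sAA tXA (\<lambda>r b. T2 b (X.slice_V \<theta> r y)) w) = XA.left_slice \<theta> (rmul (n1 y) w)" for w
      by (induction w rule: XA.tens_induct)
        (simp_all add: rmul_add \<theta> XA.tensor_lift(2)[OF B] XA.lift_add[OF B] \<epsilon>_slice_V)
    then show "XA.left_slice \<theta> (lmul (n1 p) (twist (V x y))) = XA.left_slice \<theta> (rmul (n1 y) (V p x))"
      by (simp add: left_slice_twist \<theta> X.coassoc_V(2)[OF \<theta>])
  qed
  then have "n1 p * of_alg (twist (V x y)) = of_alg (V p x) * n1 y" by (metis of_alg_lmul of_alg_rmul)
  then show "n1 p * of_alg (twist (V x y)) = n1 p * (\<alpha> x * n1 y)" by (simp add: X.of_alg_V mult.assoc)
qed

lemma of_alg_W: "of_alg (W x y) = \<alpha> x * n1 y"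
  unfolding right1_def by (rule of_alg_unalg) (simp flip: of_alg_twist)

lemma twist_V: "twist (V x y) = W x y"
  by (subst XA.T.of_alg_eq_iff[symmetric]) (simp add: of_alg_twist of_alg_W)

lemma cancel_n1: "(\<And>p. lmul (n1 p) z = lmul (n1 p) z') \<Longrightarrow> z = z'"
  by (subst XA.T.of_alg_eq_iff[symmetric], rule XA.cancel_left_leg) (simp add: of_alg_lmul[symmetric])

lemma twist_H: "twist (H c x) = tXA x (S c)"
proof (rule cancel_n1, rule XA.eq_by_slices)
  fix p \<theta> assume \<theta>: "lin sX (*) \<theta>"
  show "XA.left_slice \<theta> (lmul (n1 p) (twist (H c x))) = XA.left_slice \<theta> (lmul (n1 p) (tXA x (S c)))"
    by (simp add: left_slice_twist \<theta> X.coassoc_slice_V(2)[OF \<theta>, symmetric] mS_T4 \<epsilon>_slice_V)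
qed

text \<open>
  \<open>W\<close> maps onto \<open>X \<otimes> A\<close>: the element \<open>x \<otimes> S(c)\<close> is the twist of \<open>(1 \<otimes> c)\<alpha>(x)\<close>, which lies in the span
  of the values of \<open>V\<close>, and \<open>S\<close> is onto.
\<close>

lemma W_induct [case_names add W]:
  assumes "\<And>x y. P x \<Longrightarrow> P y \<Longrightarrow> P (x + y)" "\<And>x y. P (W x y)"
  shows "P z"
proof -
  have "P (twist z)" for z
  proof (induction z rule: V_induct)
    case (1 x y)
    then show ?case using assms(1) by simp
  next
    case (2 x y)
    show ?case using assms(2) by (simp add: twist_V)
  qed
  then have "P (tXA x s)" for x s using S_surj[of s] twist_H by metis
  with assms(1) show ?thesis by (induction z rule: XA.tens_induct) blast+
qed

section \<open>The invariant functional\<close>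

lemma W_simps: "W (x + x') y = W x y + W x' y" "W x (y + y') = W x y + W x y'"
  by (simp_all flip: twist_V add: X.V_simps)

lemma V_W: "V p x * W y w = rmul (n1 w) (V p (x * y))"
  by (subst XA.T.of_alg_eq_iff[symmetric])
    (simp add: of_alg_mult of_alg_rmul of_alg_W X.of_alg_V X.\<alpha>_mult mult.assoc)

lemma W_left: "lmul (n1 p) (W y w) = rmul (n1 w) (V p y)"
  by (subst XA.T.of_alg_eq_iff[symmetric])
    (simp add: of_alg_lmul of_alg_rmul of_alg_W X.of_alg_V mult.assoc)

lemma W_right: "rmul (n1 x') (W y x) = W y (x * x')"
  by (subst XA.T.of_alg_eq_iff[symmetric])
    (simp add: of_alg_rmul of_alg_W of_alg_mult mult.assoc XA.mult_tensor_times)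

text \<open>
  The multiplier \<open>f = (\<iota> \<otimes> \<phi>)\<alpha>(y)\<close> is coinvariant because \<open>\<phi>\<close> is left invariant, hence it is a scalar.
  The right half \<open>\<alpha>(p)(f \<otimes> 1) = \<alpha>(pf)\<close> of coinvariance is \<open>coassoc_V\<close> with \<open>\<phi>\<close> applied to the last leg.
  It implies that \<open>(f \<otimes> 1)\<alpha>(p)\<close> and \<open>\<alpha>(fp)\<close> agree after multiplication by \<open>\<alpha>(q)\<close> from the left, and such
  products are detected by surjectivity of \<open>V\<close>.
\<close>

lemma ex_\<phi>X: "\<exists>c. \<forall>r. XA.right_slice \<phi> (V r y) = sX c r"
proof -
  define f where "f = Abs_multiplier (\<lambda>p. XA.right_slice \<phi> (W y p), \<lambda>p. XA.right_slice \<phi> (V p y))"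
  have l: "XA.right_slice \<phi> (W y (x * x')) = XA.right_slice \<phi> (W y x) * x'"
    and r: "XA.right_slice \<phi> (V (x * x') y) = x * XA.right_slice \<phi> (V x' y)"
    and lr: "XA.right_slice \<phi> (V x y) * x' = x * XA.right_slice \<phi> (W y x')" for x x'
    using XA.right_slice_mult_left_leg[OF lin_\<phi>, of "of_alg x"] XA.right_slice_mult_left_leg[OF lin_\<phi>, of "of_alg x'"]
    by (metis W_right rmul_of_alg, metis X.V_left lmul_of_alg, metis W_left lmul_of_alg rmul_of_alg)
  have f: "lmul f p = XA.right_slice \<phi> (W y p)" "rmul f p = XA.right_slice \<phi> (V p y)" for p
    unfolding f_def by (subst make_multiplier; simp add: W_simps X.V_simps l r lr)+
  let ?f = "mult_tensor tXA f 1"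
  have right: "\<alpha> p * ?f = \<alpha> (rmul f p)" for p
  proof (rule XA.cancel_left_leg)
    fix r
    have "V r (rmul f p) = rmul ?f (V r p)"
    proof (rule XA.eq_by_slices)
      fix \<theta> assume \<theta>: "lin sX (*) \<theta>"
      note B = X.coassoc_V(1)[OF \<theta>]
      have \<phi>E: "\<phi> (X.slice_V \<theta> r' y) = \<theta> (rmul f r')" for r'
        by (simp add: X.slice_V_def XA.slice_slice \<theta> lin_\<phi> f)
      have "AA.right_slice \<phi> (tensor_lift sXA sAA tXA (\<lambda>r b. T2 b (X.slice_V \<theta> r y)) w) = XA.left_slice \<theta> (rmul ?f w)" for w
        by (induction w rule: XA.tens_induct)
          (simp_all add: rmul_add \<theta> XA.tensor_lift(2)[OF B] XA.lift_add[OF B] \<phi>E \<phi>_T2[OF integral])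
      then have "XA.left_slice \<theta> (rmul ?f (V r p)) = AA.right_slice \<phi> (X.left_map (X.slice_V \<theta> r) (V p y))"
        by (simp add: X.coassoc_V(2)[OF \<theta>])
      also have "\<dots> = X.slice_V \<theta> r (rmul f p)"
        by (simp add: X.right_slice_left_map[OF lin_\<phi> X.lin_slice_V[OF \<theta>]] f)
      finally show "XA.left_slice \<theta> (V r (rmul f p)) = XA.left_slice \<theta> (rmul ?f (V r p))"
        by (simp add: X.slice_V_def)
    qed
    then have "n1 r * \<alpha> (rmul f p) = of_alg (V r p) * ?f" by (metis X.of_alg_V(2) of_alg_rmul)
    then show "n1 r * (\<alpha> p * ?f) = n1 r * \<alpha> (rmul f p)" by (simp add: X.of_alg_V mult.assoc)
  qed
  have left: "?f * \<alpha> p = \<alpha> (lmul f p)" for p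
  proof (rule XA.T.multiplier_cancel_left)
    fix z show "of_alg z * (?f * \<alpha> p) = of_alg z * \<alpha> (lmul f p)"
    proof (induction z rule: V_induct)
      case (2 x q)
      have "\<alpha> q * (?f * \<alpha> p) = \<alpha> q * \<alpha> (lmul f p)"
        by (simp add: mult.assoc[symmetric] right X.\<alpha>_mult[symmetric] rmul_lmul)
      then show ?case by (simp add: X.of_alg_V mult.assoc)
    qed (simp add: of_alg_add distrib_right)
  qed
  have "extends_to \<alpha> f ?f" using left right by (simp add: extends_to_def)
  then obtain c where "f = mult_scale sX c 1" using coinvariants by blast
  then have "rmul f r = sX c r" for r by simp
  then show ?thesis using f by auto
qed

definition \<phi>X where "\<phi>X y = (SOME c. \<forall>r. XA.right_slice \<phi> (V r y) = sX c r)"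

lemma \<phi>X_V: "XA.right_slice \<phi> (V r y) = sX (\<phi>X y) r"
  unfolding \<phi>X_def by (rule someI_ex[OF ex_\<phi>X[of y], rule_format])

lemma lin_\<phi>X: "lin sX (*) \<phi>X"
proof -
  obtain r :: 'x where r: "r \<noteq> 0" using XA.A.nonzero by blast
  have "sX (\<phi>X (x + y)) r = sX (\<phi>X x + \<phi>X y) r" "sX (\<phi>X (sX c x)) r = sX (c * \<phi>X x) r" for x y c
    by (simp_all flip: \<phi>X_V add: XX.V.scale_left_distrib X.V_simps)
      (simp_all add: \<phi>X_V)
  then show ?thesis
    using r by (intro linI) (simp_all add: XX.V.vector_space_axioms vector_space_self)
qed

lemma lin_\<phi>X_mult: "lin sX (*) (\<lambda>x. \<phi>X (x * y))" "lin sX (*) (\<lambda>x. \<phi>X (y * x))"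
  by (rule linear_comp[OF XA.A.lin_mult_right lin_\<phi>X], rule linear_comp[OF XA.A.lin_mult_left lin_\<phi>X])

lemma \<phi>X_W: "XA.right_slice \<phi> (W y w) = sX (\<phi>X y) w"
proof (rule XA.A.cancel_left)
  fix p
  have "p * XA.right_slice \<phi> (W y w) = XA.right_slice \<phi> (V p y) * w"
    using XA.right_slice_mult_left_leg[OF lin_\<phi>, of "of_alg p" "W y w"]
      XA.right_slice_mult_left_leg[OF lin_\<phi>, of "of_alg w" "V p y"] by (simp add: W_left)
  then show "p * XA.right_slice \<phi> (W y w) = p * sX (\<phi>X y) w"
    by (simp add: \<phi>X_V XA.A.mult_scale_left XA.A.mult_scale_right)
qed

lemma \<phi>X_nonzero: "\<exists>y. \<phi>X y \<noteq> 0"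
proof (rule ccontr)
  assume "\<not> ?thesis"
  then have "XA.right_slice \<phi> z = 0" for z by (induction z rule: V_induct) (simp_all add: \<phi>X_V)
  then have "sX (\<phi> a) x = 0" for a x using \<phi>_slices(7)[of x a] by metis
  then show False using \<phi>_nonzero[OF integral] XA.A.nonzero by auto
qed

lemma n_tens: "of_alg (tXA x a) = n1 x * n2 a" "of_alg (tXA x a) = n2 a * n1 x"
  by (simp_all add: XA.of_alg_tens XA.mult_tensor_times)

text \<open>
  The hypothesis is \<open>(\<iota> \<otimes> \<phi>)(V(p \<otimes> x)\<alpha>(y)) = 0\<close>.  As \<open>V\<close> is onto, \<open>V(p \<otimes> x)\<close> may be replaced by
  \<open>p \<otimes> a\<close>, and faithfulness of \<open>\<phi>\<close> applies to the second leg of \<open>(p \<otimes> 1)\<alpha>(y)\<close>.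
\<close>

lemma \<phi>X_faithful_left:
  assumes "\<And>x. \<phi>X (x * y) = 0" shows "y = 0"
proof -
  have 1: "XA.right_slice \<phi> (rmul (\<alpha> y) z) = 0" for z
    by (induction z rule: V_induct) (simp_all add: rmul_add X.V_times[symmetric] \<phi>X_V assms)
  have "V p y = V p 0" for p
  proof (rule XA.eq_by_slices)
    fix \<theta> assume \<theta>: "lin sX (*) \<theta>"
    have "rmul (\<alpha> y) (tXA p a) = lmul (n2 a) (V p y)" for a
      by (subst XA.T.of_alg_eq_iff[symmetric])
        (simp add: of_alg_lmul of_alg_rmul X.of_alg_V n_tens(2) mult.assoc)
    then have "\<theta> (XA.right_slice \<phi> (lmul (n2 a) (V p y))) = 0" for a
      using 1[of "tXA p a"] by (simp add: lin_zero[OF \<theta>])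
    then have "\<phi> (a * XA.left_slice \<theta> (V p y)) = 0" for a
      by (simp add: XA.slice_slice[OF \<theta> lin_\<phi>, symmetric] XA.left_slice_mult_right_leg \<theta>)
    then have "XA.left_slice \<theta> (V p y) = 0" by (rule integral_faithful_left[OF integral])
    then show "XA.left_slice \<theta> (V p y) = XA.left_slice \<theta> (V p 0)"
      using X.V_simps(2)[of p 0 0] by (simp add: \<theta>)
  qed
  then show "y = 0" by (rule V_inj)
qed

text \<open>
  The mirror image, where surjectivity of \<open>W\<close> replaces \<open>\<alpha>(y)(w \<otimes> 1)\<close> by \<open>w \<otimes> a\<close>.
\<close>

lemma \<phi>X_faithful_right:
  assumes "\<And>y. \<phi>X (x * y) = 0" shows "x = 0"
proof -
  have 1: "XA.right_slice \<phi> (V p x * z) = 0" for p z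
    by (induction z rule: W_induct)
      (simp_all add: distrib_left V_W XA.right_slice_mult_left_leg[OF lin_\<phi>] \<phi>X_V assms)
  have "V p x = V p 0" for p
  proof -
    have tens: "V p x * tXA w a = rmul (n2 a) (rmul (n1 w) (V p x))" for w a
      using n_tens(1)[of w a] by (metis rmul_of_alg rmul_simps(4))
    have 2: "rmul (n1 w) (V p x) = 0" for w
    proof (rule XA.eq_by_slices)
      fix \<theta> assume \<theta>: "lin sX (*) \<theta>"
      have "\<theta> (XA.right_slice \<phi> (rmul (n2 a) (rmul (n1 w) (V p x)))) = 0" for a
        using 1[of p "tXA w a"] by (simp add: lin_zero[OF \<theta>] tens)
      then have "\<phi> (XA.left_slice \<theta> (rmul (n1 w) (V p x)) * a) = 0" for a
        by (simp add: XA.slice_slice[OF \<theta> lin_\<phi>, symmetric] XA.left_slice_mult_right_leg \<theta>)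
      then show "XA.left_slice \<theta> (rmul (n1 w) (V p x)) = XA.left_slice \<theta> 0"
        using integral_faithful_right[OF integral] by (simp add: \<theta>)
    qed
    have "rmul m (0 :: 'xa) = 0" for m :: "'xa multiplier" using rmul_add[of m 0 0] by simp
    then have "V p x * z = 0" for z
      by (induction z rule: XA.tens_induct) (simp_all add: distrib_left tens 2)
    then have "V p x = 0" by (rule XA.T.nondeg_left)
    then show ?thesis using X.V_simps(2)[of p 0 0] by simp
  qed
  then show "x = 0" by (rule V_inj)
qed

section \<open>Compact type\<close>

lemma unit_of_alg: "(\<And>a. u * a = a) \<Longrightarrow> (\<And>a. a * u = a) \<Longrightarrow> of_alg u = 1"
  by (rule multiplier_eqI) simp_all

text \<open>
  Here \<open>\<alpha>(1)\<close> is an element of \<open>X \<otimes> A\<close>.  It is a right unit for all \<open>(x \<otimes> 1)\<alpha>(y)\<close>, hence for \<open>X \<otimes> A\<close>,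
  hence it is a unit by non-degeneracy, and one of its slices is a unit of \<open>A\<close>.
\<close>

lemma unit_X_imp_unit_A:
  assumes u: "\<And>x::'x. u * x = x" "\<And>x. x * u = x"
  shows "\<exists>e. \<forall>a::'a. e * a = a \<and> a * e = a"
proof -
  have n1u: "n1 u = 1" using unit_of_alg[OF u] by (simp add: XA.mult_tensor_one)
  have right: "z * V u u = z" for z
  proof -
    have "rmul (\<alpha> u) z = z" by (induction z rule: V_induct) (simp_all add: rmul_add X.V_times[symmetric] u)
    then show ?thesis using X.of_alg_V(2)[of u u] rmul_of_alg[of "V u u" z] by (simp add: n1u)
  qed
  have left: "V u u * z = z" for z
    by (rule XA.T.cancel_left) (simp add: mult.assoc[symmetric] right)
  have "u \<noteq> 0" using u(1) XA.A.nonzero by (metis mult_zero_left)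
  then obtain \<theta> where \<theta>: "lin sX (*) \<theta>" "\<theta> u = 1" using XX.V.separating_functional by blast
  let ?e = "XA.left_slice \<theta> (V u u)"
  have "?e * a = a \<and> a * ?e = a" for a
  proof -
    have "of_alg (tXA u a) = n2 a" by (simp add: n_tens n1u)
    then have "rmul (n2 a) (V u u) = tXA u a" "lmul (n2 a) (V u u) = tXA u a"
      using left[of "tXA u a"] right[of "tXA u a"] rmul_of_alg[of "tXA u a" "V u u"] lmul_of_alg[of "tXA u a" "V u u"]
      by simp_all
    then show ?thesis
      using XA.left_slice_mult_right_leg[OF \<theta>(1), of "of_alg a" "V u u"] \<theta> by simp
  qed
  then show ?thesis by blast
qed

text \<open>
  If \<open>A\<close> has a unit, the multiplier \<open>(\<iota> \<otimes> \<phi>)\<alpha>(y) = \<phi>X(y)1\<close> is an element of \<open>X\<close>.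
\<close>

lemma unit_A_imp_unit_X:
  assumes e: "\<And>a::'a. e * a = a" "\<And>a. a * e = a"
  shows "\<exists>u. \<forall>x::'x. u * x = x \<and> x * u = x"
proof -
  obtain y where y: "\<phi>X y \<noteq> 0" using \<phi>X_nonzero by blast
  let ?u = "sX (inverse (\<phi>X y)) (XA.right_slice \<phi> (G y e))"
  have n2e: "n2 e = 1" using unit_of_alg[OF e] by (simp add: XA.mult_tensor_one)
  have "p * XA.right_slice \<phi> (G y e) = sX (\<phi>X y) p" for p
    using XA.right_slice_mult_left_leg(1)[OF lin_\<phi>, of "of_alg p" "G y e"]
    by (simp add: X.V_right[symmetric] n2e \<phi>X_V)
  then have right: "p * ?u = p" for p using y by (simp add: XA.A.mult_scale_right)
  have "?u * p = p" for p
    by (rule XA.A.cancel_left) (simp add: mult.assoc[symmetric] right)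
  with right show ?thesis by blast
qed

section \<open>Discrete type\<close>

text \<open>
  Apply \<open>\<iota> \<otimes> \<phi>\<close> to \<open>\<alpha>(x)(z \<otimes> h)\<close>.  The cointegral turns \<open>\<phi>(\<cdot> h)\<close> into \<open>\<phi>(h)\<epsilon>\<close> with \<open>\<phi>(h) \<noteq> 0\<close>, so
  the result is \<open>\<phi>(h)xz\<close>; writing \<open>z \<otimes> h\<close> as a finite sum of \<open>\<alpha>(y)(w \<otimes> 1)\<close>, it is the corresponding sum of
  \<open>\<phi>X(xy)w\<close>, which lies in the span of finitely many \<open>w\<close>.
\<close>

lemma cointegral_imp_finite_dim_right:
  assumes h: "h \<noteq> 0" "\<And>a. a * h = sA (\<epsilon> a) h"
  shows "\<exists>B. finite B \<and> XX.V.span B = range (\<lambda>x. x * z)"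
proof -
  have \<phi>h: "\<phi> h \<noteq> 0"
  proof
    assume "\<phi> h = 0"
    then have "\<phi> (a * h) = 0" for a by (simp add: h)
    then show False using integral_faithful_left[OF integral] h(1) by blast
  qed
  have "\<exists>B. finite B \<and> (\<forall>x. XA.right_slice \<phi> (lmul (\<alpha> x) t) \<in> XX.V.span B)" for t
  proof (induction t rule: W_induct)
    case (add s t)
    then obtain B C where B: "finite B" "\<And>x. XA.right_slice \<phi> (lmul (\<alpha> x) s) \<in> XX.V.span B"
      and C: "finite C" "\<And>x. XA.right_slice \<phi> (lmul (\<alpha> x) t) \<in> XX.V.span C" by blast
    have "XA.right_slice \<phi> (lmul (\<alpha> x) (s + t)) \<in> XX.V.span (B \<union> C)" for x
      using XX.V.span_add[of _ "B \<union> C"] B(2)[of x] C(2)[of x] XX.V.span_mono[of B "B \<union> C"]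
        XX.V.span_mono[of C "B \<union> C"] by (simp add: lmul_add subset_iff)
    with B(1) C(1) show ?case by blast
  next
    case (W y w)
    have "lmul (\<alpha> x) (W y w) = W (x * y) w" for x
      by (subst XA.T.of_alg_eq_iff[symmetric]) (simp add: of_alg_lmul of_alg_W X.\<alpha>_mult mult.assoc)
    then show ?case
      by (intro exI[of _ "{w}"]) (simp add: \<phi>X_W XX.V.span_scale XX.V.span_base)
  qed
  then obtain B where B: "finite B" "\<And>x. XA.right_slice \<phi> (lmul (\<alpha> x) (tXA z h)) \<in> XX.V.span B" by blast
  have "XA.right_slice \<phi> (lmul (\<alpha> x) (tXA z h)) = sX (\<phi> h) (x * z)" for x
  proof -
    have 1: "XA.right_slice \<phi> (rmul (n2 h) w) = sX (\<phi> h) (XA.right_slice \<epsilon> w)" for w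
      by (induction w rule: XA.tens_induct) (simp_all add: rmul_add h XX.V.scale_right_distrib mult.commute)
    have "XA.right_slice \<phi> (G x h) = sX (\<phi> h) x"
    proof (rule XA.A.cancel_left)
      fix p show "p * XA.right_slice \<phi> (G x h) = p * sX (\<phi> h) x"
        using XA.right_slice_mult_left_leg(1)[OF lin_\<phi>, of "of_alg p" "G x h"] 1[of "V p x"]
        by (simp add: X.V_right right_slice_V XA.A.mult_scale_right)
    qed
    moreover have "lmul (\<alpha> x) (tXA z h) = rmul (n1 z) (G x h)"
      by (subst XA.T.of_alg_eq_iff[symmetric])
        (simp add: of_alg_lmul of_alg_rmul X.of_alg_V n_tens(2) mult.assoc)
    ultimately show ?thesis by (simp add: XA.right_slice_mult_left_leg[OF lin_\<phi>] XA.A.mult_scale_left)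
  qed
  then have "sX (inverse (\<phi> h)) (sX (\<phi> h) (x * z)) \<in> XX.V.span B" for x
    using XX.V.span_scale[OF B(2)[of x]] by simp
  then have "range (\<lambda>x. x * z) \<subseteq> XX.V.span B" using \<phi>h by auto
  then show ?thesis
    by (rule XX.V.finite_dim_subspace[OF B(1)
          module_hom.subspace_image[OF Vector_Spaces.linear.axioms(3)[OF XA.A.lin_mult_right] XX.V.subspace_UNIV]])
qed

text \<open>
  For the faithful form \<open>\<phi>X(xy)\<close> the maps \<open>y \<mapsto> zy\<close> and \<open>x \<mapsto> xz\<close> are transposes of each other, so one has
  finite rank with the other.
\<close>

lemma finite_dim_right_imp_left:
  assumes "finite B" "XX.V.span B = range (\<lambda>x. x * z)"
  shows "\<exists>B. finite B \<and> XX.V.span B = range (\<lambda>y. z * y)"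
proof -
  have vanish: "z * y = 0" if "\<And>b. b \<in> B \<Longrightarrow> \<phi>X (b * y) = 0" for y
  proof (rule \<phi>X_faithful_left)
    fix x
    have "x * z \<in> XX.V.span B" using assms(2) by simp
    then have "\<phi>X (x * z * y) = 0"
      by (induction rule: XX.V.span_induct_alt)
        (simp_all add: that lin_zero[OF lin_\<phi>X] lin_zero[OF lin_\<phi>X_mult(1)] lin_add[OF lin_\<phi>X_mult(1)] lin_scale[OF lin_\<phi>X_mult(1)])
    then show "\<phi>X (x * (z * y)) = 0" by (simp add: mult.assoc)
  qed
  have "\<exists>c. \<forall>y. z * y = (\<Sum>b\<in>B. sX (\<phi>X (b * y)) (c b))"
    by (rule XX.V.factor_through_functionals[where F = "\<lambda>b y. \<phi>X (b * y)" and g = "\<lambda>y. z * y",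
          OF assms(1) lin_\<phi>X_mult(2) XA.A.lin_mult_left vanish])
  then obtain c where c: "\<And>y. z * y = (\<Sum>b\<in>B. sX (\<phi>X (b * y)) (c b))" by blast
  have "z * y \<in> XX.V.span (c ` B)" for y
    unfolding c by (rule XX.V.span_sum, rule XX.V.span_scale, rule XX.V.span_base) simp
  then have "range (\<lambda>y. z * y) \<subseteq> XX.V.span (c ` B)" by blast
  then show ?thesis
    by (rule XX.V.finite_dim_subspace[OF finite_imageI[OF assms(1)]
          module_hom.subspace_image[OF Vector_Spaces.linear.axioms(3)[OF XA.A.lin_mult_left] XX.V.subspace_UNIV]])
qed

text \<open>
  As \<open>Xz\<close> has finite dimension and \<open>\<phi>X\<close> is faithful, \<open>yz\<close> is a finite sum of \<open>\<phi>X(yzu)b\<^sub>u\<close>.  By the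
  definition of \<open>\<phi>X\<close> this says \<open>(\<iota> \<otimes> \<phi>)(V(w \<otimes> y)Q) = wyz\<close> for the fixed element
  \<open>Q = \<Sum>\<^sub>u \<alpha>(zu)(b\<^sub>u \<otimes> 1)\<close> of \<open>X \<otimes> A\<close>.  Coacting on \<open>y\<close> and using that \<open>V\<close> is onto yields
  \<open>rz \<otimes> a = (\<iota> \<otimes> \<phi> \<otimes> \<iota>)((r \<otimes> \<Delta>(a))Q\<^sub>1\<^sub>2)\<close> for all \<open>a\<close>.  For \<open>\<theta>(rz) = 1\<close> the slice
  \<open>h = (\<theta>(r \<cdot>) \<otimes> \<iota>)(Q)\<close> then satisfies \<open>\<phi>(ah) = \<epsilon>(a)\<close>, and faithfulness of \<open>\<phi>\<close> turns this into
  \<open>ah = \<epsilon>(a)h\<close>.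
\<close>

lemma finite_dim_right_imp_cointegral:
  assumes fin: "\<And>z. \<exists>B. finite B \<and> XX.V.span B = range (\<lambda>x. x * z)"
  shows "\<exists>h. h \<noteq> 0 \<and> (\<forall>a. a * h = sA (\<epsilon> a) h)"
proof -
  obtain z r :: 'x where rz: "r * z \<noteq> 0" using XA.A.nonzero XA.A.nondeg_left by blast
  obtain \<theta> where \<theta>: "lin sX (*) \<theta>" "\<theta> (r * z) = 1" using XX.V.separating_functional[OF rz] by blast
  obtain B where B: "finite B" "XX.V.span B = range (\<lambda>x. x * z)" using fin by blast
  have "\<exists>N. finite N \<and> (\<forall>v\<in>XX.V.span B. (\<forall>u\<in>N. \<phi>X (v * u) = 0) \<longrightarrow> v = 0)"
    by (rule XX.V.finitely_many_separate[OF B(1) lin_\<phi>X_mult(1)]) (rule \<phi>X_faithful_right)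
  then obtain N where N: "finite N" "\<forall>v\<in>XX.V.span B. (\<forall>u\<in>N. \<phi>X (v * u) = 0) \<longrightarrow> v = 0"
    by blast
  have lin_zu: "lin sX (*) (\<lambda>y. \<phi>X (y * z * u))" for u
    using linear_comp[OF XA.A.lin_mult_right[of z] lin_\<phi>X_mult(1)[of u]] .
  have vanish: "y * z = 0" if "\<And>u. u \<in> N \<Longrightarrow> \<phi>X (y * z * u) = 0" for y
    by (rule N(2)[rule_format]) (use that B(2) in auto)
  have "\<exists>b. \<forall>y. y * z = (\<Sum>u\<in>N. sX (\<phi>X (y * z * u)) (b u))"
    by (rule XX.V.factor_through_functionals[where F = "\<lambda>u y. \<phi>X (y * z * u)" and g = "\<lambda>y. y * z",
          OF N(1) lin_zu XA.A.lin_mult_right vanish])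
  then obtain b where b: "\<And>y. y * z = (\<Sum>u\<in>N. sX (\<phi>X (y * z * u)) (b u))" by blast
  define Q where "Q = (\<Sum>u\<in>N. W (z * u) (b u))"
  have Q: "XA.right_slice \<phi> (V w y * Q) = w * y * z" for w y
  proof -
    have "XA.right_slice \<phi> (V w y * Q) = (\<Sum>u\<in>N. sX (\<phi>X (y * z * u)) (w * b u))"
      by (simp add: Q_def sum_distrib_left V_W XA.right_slice_mult_left_leg[OF lin_\<phi>] \<phi>X_V
          XA.A.mult_scale_left mult.assoc)
    also have "\<dots> = w * (\<Sum>u\<in>N. sX (\<phi>X (y * z * u)) (b u))"
      by (simp add: sum_distrib_left XA.A.mult_scale_right)
    finally show ?thesis by (simp only: b[of y, symmetric] mult.assoc[symmetric])
  qed
  \<comment> \<open>expanded into elementary tensors, so that the legs of \<open>Q\<close> can be used separately\<close>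
  obtain I \<eta> where I: "finite I" "\<And>e. lin sX (*) (\<eta> e)" "Q = (\<Sum>s\<in>I. tXA s (XA.left_slice (\<eta> s) Q))"
    by (rule XA.slice_expansion[where z = Q]) blast
  define q where "q s = XA.left_slice (\<eta> s) Q" for s
  have Qsum: "Q = (\<Sum>s\<in>I. tXA s (q s))" using I(3) by (simp add: q_def)
  have \<theta>s: "lin sX (*) (\<lambda>x. \<theta> (x * s))" for s by (rule linear_comp[OF XA.A.lin_mult_right \<theta>(1)])
  have \<psi>: "lin sA (*) (\<lambda>x. \<phi> (x * c))" for c by (rule linear_comp[OF AA.A.lin_mult_right lin_\<phi>])
  define E' where "E' s w = X.slice_V (\<lambda>x. \<theta> (x * s)) w" for s w
  have lin_slice_V': "lin sX sA (E' s w)" for s w unfolding E'_def by (rule X.lin_slice_V[OF \<theta>s])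
  have 1: "(\<Sum>s\<in>I. \<phi> (E' s w y * q s)) = \<theta> (w * y * z)" for w y
  proof -
    have "XA.left_slice \<theta> (g * tXA s c) = XA.left_slice (\<lambda>x. \<theta> (x * s)) g * c" for g s c
      by (induction g rule: XA.tens_induct)
        (simp_all add: \<theta> \<theta>s XA.tens_mult algebra_simps AA.A.mult_scale_left)
    then have "XA.left_slice \<theta> (V w y * Q) = (\<Sum>s\<in>I. E' s w y * q s)"
      by (subst Qsum) (simp add: sum_distrib_left \<theta> E'_def X.slice_V_def)
    then show ?thesis using XA.slice_slice[OF \<theta>(1) lin_\<phi>, of "V w y * Q"]
      by (simp add: Q lin_sum[OF lin_\<phi>])
  qed
  have 2: "(\<Sum>s\<in>I. AA.left_slice (\<lambda>x. \<phi> (x * q s)) (X.left_map (E' s w) g)) = XA.left_slice \<theta> (lmul (n1 w) (rmul (n1 z) g))" for w g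
    by (induction g rule: XA.tens_induct)
      (simp_all add: lin_slice_V' \<psi> \<theta> 1[symmetric] AA.A.scale_sum_left[symmetric] sum.distrib rmul_add lmul_add mult.assoc[symmetric])
  \<comment> \<open>by coassociativity, the coaction on \<open>y\<close> becomes the comultiplication on the second leg of \<open>V w y\<close>\<close>
  have 3: "XA.left_slice (\<lambda>x. \<theta> (x * z)) v * d = (\<Sum>s\<in>I. AA.left_slice (\<lambda>x. \<phi> (x * q s)) (T1 (XA.left_slice (\<lambda>x. \<theta> (x * s)) v) d))" for v d
  proof (induction v rule: V_induct)
    case (1 v v')
    then show ?case by (simp add: \<theta>s T_simps \<psi> sum.distrib distrib_right)
  next
    case (2 w y)
    have "lmul (n1 w) (rmul (n1 z) (G y d)) = rmul (n2 d) (rmul (n1 z) (V w y))"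
      by (subst XA.T.of_alg_eq_iff[symmetric])
        (simp add: of_alg_lmul of_alg_rmul X.of_alg_V mult.assoc XA.mult_tensor_times)
    then have "XA.left_slice \<theta> (lmul (n1 w) (rmul (n1 z) (G y d))) = XA.left_slice (\<lambda>x. \<theta> (x * z)) (V w y) * d"
      by (simp add: XA.left_slice_mult_right_leg XA.left_slice_mult_left_leg \<theta>)
    then show ?case
      using \<open>(\<Sum>s\<in>I. AA.left_slice (\<lambda>x. \<phi> (x * q s)) (X.left_map (E' s w) (G y d))) = _\<close>[symmetric] 
      by (simp add: X.coassoc_slice_V(1)[OF \<theta>s, symmetric] E'_def X.slice_V_def)
  qed
  define h where "h = (\<Sum>s\<in>I. sA (\<theta> (r * s)) (q s))"
  have h: "\<phi> (a * h) = (\<Sum>s\<in>I. \<theta> (r * s) * \<phi> (a * q s))" for a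
    by (simp add: h_def sum_distrib_left lin_sum[OF lin_\<phi>] AA.A.mult_scale_right)
  have "AA.left_slice (\<lambda>x. \<phi> (x * h)) t = (\<Sum>s\<in>I. sA (\<theta> (r * s)) (AA.left_slice (\<lambda>x. \<phi> (x * q s)) t))" for t
  proof (induction t rule: AA.tens_induct)
    case (add t t')
    then show ?case
      by (simp only: AA.left_slice_simps(2)[OF \<psi>] AA.A.scale_right_distrib sum.distrib)
  next
    case (tens a c)
    show ?case unfolding AA.left_slice_simps(1)[OF \<psi>] by (simp only: h AA.A.scale_sum_left AA.A.scale_scale)
  qed
  then have 4: "AA.left_slice (\<lambda>x. \<phi> (x * h)) (T1 a d) = a * d" for a d
    using 3[of "tXA r a" d] by (simp add: \<theta> \<theta>s T_simps \<psi>)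
  have 5: "AA.left_slice (\<lambda>x. \<phi> (x * h)) t = AA.left_slice \<epsilon> t" for t
    by (induction t rule: T1_induct) (simp_all add: \<psi> 4 left_slice_T1)
  obtain d :: 'a where "d \<noteq> 0" using AA.A.nonzero by blast
  then have \<phi>h: "\<phi> (a * h) = \<epsilon> a" for a using 5[of "tAA a d"] by (simp add: \<psi>)
  have "a * h = sA (\<epsilon> a) h" for a
  proof -
    have "\<phi> (c * (a * h - sA (\<epsilon> a) h)) = 0" for c
      using \<phi>h[of "c * a"] \<phi>h[of c]
      by (simp add: algebra_simps lin_diff[OF lin_\<phi>] AA.A.mult_scale_right)
    from integral_faithful_left[OF integral this] show ?thesis by simp
  qed
  moreover have "h \<noteq> 0"
  proof
    assume "h = 0"
    then show False using \<phi>h[of e0] lin_zero[OF lin_\<phi>] by simp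
  qed
  ultimately show ?thesis by blast
qed

end

section \<open>The characterisation of compact and discrete type\<close>

theorem theorem2p23:
  fixes sA :: "'k::field \<Rightarrow> 'a::ring \<Rightarrow> 'a"
    and sAA :: "'k \<Rightarrow> 'aa::ring \<Rightarrow> 'aa" and tAA :: "'a \<Rightarrow> 'a \<Rightarrow> 'aa"
    and sAAA :: "'k \<Rightarrow> 'aaa::ring \<Rightarrow> 'aaa"
    and tAA_A :: "'aa \<Rightarrow> 'a \<Rightarrow> 'aaa" and tA_AA :: "'a \<Rightarrow> 'aa \<Rightarrow> 'aaa"
    and \<Delta> :: "'a \<Rightarrow> 'aa multiplier"
    and sX :: "'k \<Rightarrow> 'x::ring \<Rightarrow> 'x"
    and sXX :: "'k \<Rightarrow> 'xx::ab_group_add \<Rightarrow> 'xx" and tXX :: "'x \<Rightarrow> 'x \<Rightarrow> 'xx"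
    and sXA :: "'k \<Rightarrow> 'xa::ring \<Rightarrow> 'xa" and tXA :: "'x \<Rightarrow> 'a \<Rightarrow> 'xa"
    and sXAA :: "'k \<Rightarrow> 'xaa::ring \<Rightarrow> 'xaa"
    and tXA_A :: "'xa \<Rightarrow> 'a \<Rightarrow> 'xaa" and tX_AA :: "'x \<Rightarrow> 'aa \<Rightarrow> 'xaa"
    and \<alpha> :: "'x \<Rightarrow> 'xa multiplier"
  assumes "algebraic_quantum_group sA sAA tAA sAAA tAA_A tA_AA \<Delta>"
    and "right_galois_object sA sAA tAA \<Delta> sX sXX tXX sXA tXA sXAA tXA_A tX_AA \<alpha>"
  shows "(compact_type_algebra sX \<longleftrightarrow>
            compact_type_quantum_group sA sAA tAA sAAA tAA_A tA_AA \<Delta>) \<and>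
         (discrete_type_algebra sX \<longleftrightarrow>
            discrete_type_quantum_group sA sAA tAA sAAA tAA_A tA_AA \<Delta>)"
proof -
  interpret Q: algebraic_quantum_group sA sAA tAA sAAA tAA_A tA_AA \<Delta> by (rule assms(1))
  obtain \<phi> where \<phi>: "is_left_integral sA sAA tAA \<Delta> \<phi>" using Q.left_integral by blast
  have setting: "integral_galois_object sA sAA tAA sAAA tAA_A tA_AA \<Delta> \<epsilon> sX sXX tXX sXA tXA sXAA tXA_A tX_AA \<alpha> \<phi>"
    if "is_counit sA sAA tAA \<Delta> \<epsilon>" for \<epsilon>
    by (intro integral_galois_object.intro integral_galois_object_axioms.intro counital_multiplier_hopf_algebra.intro
        counital_multiplier_hopf_algebra_axioms.intro that \<phi> assms(2) Q.regular_multiplier_hopf_algebra_axioms)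
  obtain \<epsilon> where \<epsilon>: "is_counit sA sAA tAA \<Delta> \<epsilon>" using Q.ex_counit by blast
  interpret integral_galois_object sA sAA tAA sAAA tAA_A tA_AA \<Delta> \<epsilon> sX sXX tXX sXA tXA sXAA tXA_A tX_AA \<alpha> \<phi>
    by (rule setting[OF \<epsilon>])
  have X: "nondeg_algebra sX" by (rule XA.A.nondeg_algebra_axioms)
  have compact: "compact_type_algebra sX \<longleftrightarrow> compact_type_quantum_group sA sAA tAA sAAA tAA_A tA_AA \<Delta>"
    unfolding compact_type_algebra_def compact_type_algebra_axioms_def
      compact_type_quantum_group_def compact_type_quantum_group_axioms_def
    using X assms(1) unit_X_imp_unit_A unit_A_imp_unit_X by blast
  have "discrete_type_quantum_group sA sAA tAA sAAA tAA_A tA_AA \<Delta>" if "discrete_type_algebra sX"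
  proof -
    interpret D: discrete_type_algebra sX by (rule that)
    show ?thesis
      using finite_dim_right_imp_cointegral[OF D.finite_dim_right] \<epsilon> assms(1)
      unfolding discrete_type_quantum_group_def discrete_type_quantum_group_axioms_def by blast
  qed
  moreover have "discrete_type_algebra sX" if D: "discrete_type_quantum_group sA sAA tAA sAAA tAA_A tA_AA \<Delta>"
  proof -
    obtain \<epsilon>' h where h: "is_counit sA sAA tAA \<Delta> \<epsilon>'" "h \<noteq> 0" "\<And>a. a * h = sA (\<epsilon>' a) h"
      using discrete_type_quantum_group.left_cointegral[OF D] by blast
    interpret D: integral_galois_object sA sAA tAA sAAA tAA_A tA_AA \<Delta> \<epsilon>' sX sXX tXX sXA tXA sXAA tXA_A tX_AA \<alpha> \<phi>
      by (rule setting[OF h(1)])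
    have "\<exists>B. finite B \<and> XX.V.span B = range (\<lambda>x. x * z)" for z
      by (rule D.cointegral_imp_finite_dim_right[OF h(2,3)])
    then show ?thesis
      using finite_dim_right_imp_left X
      unfolding discrete_type_algebra_def discrete_type_algebra_axioms_def by metis
  qed
  ultimately show ?thesis using compact by blast
qed

end
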